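(* Let $\lambda>0$, $p\ge 1$, $q>0$, let $v\ge 0$ be a weight function with $v\in L^{p'}_{loc}(\mathbb{R}^+)$, and let $\mathcal{L}f(x)=\int_{\mathbb{R}^+}\mathrm{e}^{-xy^\lambda}f(y)v(y)\,\mathrm{d}y$, $x\in\mathbb{R}^+$. With $A_\mathcal{L}$, $A_\mathcal{L}(t)$, $B_\mathcal{L}$, $B_p$, $B_q(t)$, $\bar B_q(t)$, $B_{q'}$ as defined in the context, the following hold. (i) If $1<p\le q<\infty$, then $\mathcal{L}:L^p\to L^q$ is compact if and only if $A_\mathcal{L}<\infty$, $\lim_{t\to 0}A_\mathcal{L}(t)=0$ and $\lim_{t\to\infty}A_\mathcal{L}(t)=0$. (ii) Let $1\le q<p<\infty$. If $q>1$, then $\mathcal{L}:L^p\to L^q$ is compact if and only if $B_\mathcal{L}<\infty$. If $q=1$, then $\mathcal{L}:L^p\to L^1$ is compact if and only if $B_p<\infty$. (iii) Let $0<q<1<p<\infty$. The operator $\mathcal{L}:L^p\to L^q$ is compact if $B_\mathcal{L}<\infty$. If $\mathcal{L}$ is compact from $L^p$ to $L^q$, then $\|B_q\|_{p'}<\infty$. (iv) Let $0<q<1=p$. $\mathcal{L}$ is compact from $L^1$ to $L^q$ if $B_{q'}<\infty$. If $\mathcal{L}$ is compact from $L^1$ to $L^q$, then $\operatorname{ess\,sup}_{t\in\mathbb{R}^+}B_q(t)<\infty$. (v) Let $1=p\le q<\infty$. The operator $\mathcal{L}$ is compact from $L^1$ to $L^q$ if and only if $$\operatorname{ess\,sup}_{t\in\mathbb{R}^+}\bar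 B_q(t)<\infty\quad\text{and}\quad \lim_{t\to 0}\bar B_q(t)=\lim_{t\to\infty}\bar B_q(t)=0.$$
   Context: $\mathbb{R}^+:=[0,\infty)$. For $0<r<\infty$, $L^r=L^r(\mathbb{R}^+)$ is the space of measurable real functions $f$ on $\mathbb{R}^+$ with $\|f\|_r:=(\int_{\mathbb{R}^+}|f(x)|^r\mathrm{d}x)^{1/r}<\infty$ (a quasi-norm when $r<1$), and $L^\infty$ is the usual space with the essential supremum norm. Conventions: $p':=p/(p-1)$ (so $p'=\infty$ if $p=1$), $q':=q/(q-1)$ for $q\neq1$, $r:=\frac{pq}{p-q}$ when $q<p$; products of the form $0\cdot\infty$ are equal to $0$. Definitions (for $t>0$): $$V_0(t):=\int_0^t v^{p'}(y)\,\mathrm{d}y,\qquad \bar v_0(t):=\operatorname{ess\,sup}_{0<x<t}v(x),$$ $$A_\mathcal{L}(t):=t^{-\lambda/q}\,[V_0(t)]^{1/p'},\qquad A_\mathcal{L}:=\sup_{t>0}A_\mathcal{L}(t),$$ $$B_\mathcal{L}:=\Bigl(\int_{\mathbb{R}^+}t^{-\lambda r/q}[V_0(t)]^{r/q'}v^{p'}(t)\,\mathrm{d}t\Bigr)^{1/r},\qquad B_p:=\Bigl(\int_{\mathbb{R}^+}y^{-\lambda p'}v^{p'}(y)\,\mathrm{d}y\Bigr)^{1/p'},$$ $$B_q(t):=t^{-\lambda/q}v(t),\qquad \bar B_q(t):=t^{-\lambda/q}\,\bar v_0(t),$$ $$B_{q'}:=\Bigl(\int_{\mathbb{R}^+}t^{-\lambda/(1-q)-1}\,\bar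 v_0(t)^{q/(1-q)}\,\mathrm{d}t\Bigr)^{(1-q)/q}\quad(0<q<1).$$ *)

theory Defs
  imports "HOL-Probability.Essential_Supremum"
begin

section \<open>Powers of extended nonnegative reals\<close>

text \<open>
  The power is the usual one on \<open>[0,\<infinity>]\<close>: a negative power of \<open>0\<close> is \<open>\<infinity>\<close>, and a zeroth power is \<open>1\<close>.
  This differs from \<open>powr\<close> on the reals, where \<open>0 powr a = 0\<close> for every \<open>a\<close>. Together with
  \<open>0 * \<infinity> = 0\<close> in \<^typ>\<open>ennreal\<close> it gives the expressions below their intended meaning, for example
  the factor \<open>V\<^sub>0(t)\<close> raised to the negative power \<open>r/q'\<close> when \<open>q < 1\<close>.
\<close>

definition enn_powr :: "ennreal \<Rightarrow> real \<Rightarrow> ennreal" where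
  "enn_powr x a =
     (if a = 0 then 1
      else if x = 0 then (if a < 0 then \<infinity> else 0)
      else if x = \<infinity> then (if a < 0 then 0 else \<infinity>)
      else ennreal (enn2real x powr a))"

section \<open>Lebesgue spaces\<close>

text \<open>
  Functions, not classes modulo null sets; only the values on the half-line \<open>{0..}\<close> matter. The
  exponent lies in \<open>]0,\<infinity>]\<close>, and \<open>Lr_norm\<close> is only a quasi-norm for exponents below \<open>1\<close>.
\<close>

definition Lr_norm :: "ennreal \<Rightarrow> real set \<Rightarrow> (real \<Rightarrow> real) \<Rightarrow> ennreal" where
  "Lr_norm r S f =
     (if r = \<infinity> then esssup (lebesgue_on S) (\<lambda>x. ennreal \<bar>f x\<bar>)
      else enn_powr (\<integral>\<^sup>+ x. ennreal (\<bar>f x\<bar> powr enn2real r) \<partial>lebesgue_on S) (1 / enn2real r))"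

definition Lr_space :: "ennreal \<Rightarrow> (real \<Rightarrow> real) set" where
  "Lr_space r = {f \<in> borel_measurable (lebesgue_on {0..}). Lr_norm r {0..} f < \<infinity>}"

definition Lr_loc :: "ennreal \<Rightarrow> (real \<Rightarrow> real) set" where
  "Lr_loc r = {f \<in> borel_measurable (lebesgue_on {0..}).
     \<forall>K. compact K \<and> K \<subseteq> {0..} \<longrightarrow> Lr_norm r K f < \<infinity>}"

definition Lr_bounded :: "ennreal \<Rightarrow> (real \<Rightarrow> real) set \<Rightarrow> bool" where
  "Lr_bounded r F \<longleftrightarrow>
     F \<subseteq> Lr_space r \<and> (\<exists>C::real. \<forall>f\<in>F. Lr_norm r {0..} f \<le> ennreal C)"

text \<open>
  Since \<open>L\<^sup>r\<close> is metrizable, also for \<open>r < 1\<close>, relative compactness is sequential: every sequence in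
  the set has a subsequence converging in (quasi-)norm to an element of \<open>L\<^sup>r\<close>.
\<close>

definition Lr_relatively_compact :: "ennreal \<Rightarrow> (real \<Rightarrow> real) set \<Rightarrow> bool" where
  "Lr_relatively_compact r G \<longleftrightarrow>
     G \<subseteq> Lr_space r \<and>
     (\<forall>h :: nat \<Rightarrow> real \<Rightarrow> real. range h \<subseteq> G \<longrightarrow>
        (\<exists>g\<in>Lr_space r. \<exists>s. strict_mono s \<and>
           (\<lambda>n. Lr_norm r {0..} (\<lambda>x. h (s n) x - g x)) \<longlonglongrightarrow> 0))"

section \<open>The Laplace-type operator\<close>

definition laplace_integrand ::
    "real \<Rightarrow> (real \<Rightarrow> real) \<Rightarrow> (real \<Rightarrow> real) \<Rightarrow> real \<Rightarrow> real \<Rightarrow> real" where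
  "laplace_integrand lam v f x y = exp (- (x * y powr lam)) * f y * v y"

definition laplace_op :: "real \<Rightarrow> (real \<Rightarrow> real) \<Rightarrow> (real \<Rightarrow> real) \<Rightarrow> real \<Rightarrow> real" where
  "laplace_op lam v f x = (\<integral>y. laplace_integrand lam v f x y \<partial>lebesgue_on {0..})"

text \<open>
  The Bochner integral of a non-integrable function is \<open>0\<close>, so that the operator acts from \<open>L\<^sup>p\<close>
  into \<open>L\<^sup>q\<close> has to include the existence of the integral for almost every \<open>x\<close>.
\<close>

definition laplace_maps :: "real \<Rightarrow> (real \<Rightarrow> real) \<Rightarrow> ennreal \<Rightarrow> ennreal \<Rightarrow> bool" where
  "laplace_maps lam v p q \<longleftrightarrow>
     (\<forall>f\<in>Lr_space p.
        (AE x in lebesgue_on {0..}. integrable (lebesgue_on {0..}) (laplace_integrand lam v f x)) \<and>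
        laplace_op lam v f \<in> Lr_space q)"

definition laplace_compact :: "real \<Rightarrow> (real \<Rightarrow> real) \<Rightarrow> ennreal \<Rightarrow> ennreal \<Rightarrow> bool" where
  "laplace_compact lam v p q \<longleftrightarrow>
     laplace_maps lam v p q \<and>
     (\<forall>F. Lr_bounded p F \<longrightarrow> Lr_relatively_compact q (laplace_op lam v ` F))"

section \<open>The characterizing quantities\<close>

text \<open>\<open>conj_exp\<close> is meant for arguments other than \<open>1\<close>; it is negative for arguments in \<open>]0,1[\<close>.\<close>

definition conj_exp :: "real \<Rightarrow> real" where
  "conj_exp p = p / (p - 1)"

definition conj_exp_ext :: "real \<Rightarrow> ennreal" where
  "conj_exp_ext p = (if p = 1 then \<infinity> else ennreal (conj_exp p))"

definition V0 :: "real \<Rightarrow> (real \<Rightarrow> real) \<Rightarrow> real \<Rightarrow> ennreal" where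
  "V0 p v t = (\<integral>\<^sup>+ y. ennreal (v y powr conj_exp p) \<partial>lebesgue_on {0<..<t})"

definition vbar0 :: "(real \<Rightarrow> real) \<Rightarrow> real \<Rightarrow> ennreal" where
  "vbar0 v t = esssup (lebesgue_on {0<..<t}) (\<lambda>x. ennreal (v x))"

definition A_fun :: "real \<Rightarrow> real \<Rightarrow> real \<Rightarrow> (real \<Rightarrow> real) \<Rightarrow> real \<Rightarrow> ennreal" where
  "A_fun lam p q v t = ennreal (t powr (- lam / q)) * enn_powr (V0 p v t) (1 / conj_exp p)"

definition A_const :: "real \<Rightarrow> real \<Rightarrow> real \<Rightarrow> (real \<Rightarrow> real) \<Rightarrow> ennreal" where
  "A_const lam p q v = (SUP t\<in>{0<..}. A_fun lam p q v t)"

definition B_const :: "real \<Rightarrow> real \<Rightarrow> real \<Rightarrow> (real \<Rightarrow> real) \<Rightarrow> ennreal" where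
  "B_const lam p q v =
     (let r = p * q / (p - q) in
      enn_powr
        (\<integral>\<^sup>+ t. ennreal (t powr (- lam * r / q)) * enn_powr (V0 p v t) (r / conj_exp q)
                 * ennreal (v t powr conj_exp p) \<partial>lebesgue_on {0..})
        (1 / r))"

definition Bp_const :: "real \<Rightarrow> real \<Rightarrow> (real \<Rightarrow> real) \<Rightarrow> ennreal" where
  "Bp_const lam p v =
     enn_powr
       (\<integral>\<^sup>+ y. ennreal (y powr (- lam * conj_exp p)) * ennreal (v y powr conj_exp p)
          \<partial>lebesgue_on {0..})
       (1 / conj_exp p)"

definition Bq_fun :: "real \<Rightarrow> real \<Rightarrow> (real \<Rightarrow> real) \<Rightarrow> real \<Rightarrow> real" where
  "Bq_fun lam q v t = t powr (- lam / q) * v t"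

definition Bbarq_fun :: "real \<Rightarrow> real \<Rightarrow> (real \<Rightarrow> real) \<Rightarrow> real \<Rightarrow> ennreal" where
  "Bbarq_fun lam q v t = ennreal (t powr (- lam / q)) * vbar0 v t"

text \<open>The constant \<open>B\<^bsub>q'\<^esub>\<close>, for \<open>0 < q < 1\<close>.\<close>

definition Bq'_const :: "real \<Rightarrow> real \<Rightarrow> (real \<Rightarrow> real) \<Rightarrow> ennreal" where
  "Bq'_const lam q v =
     enn_powr
       (\<integral>\<^sup>+ t. ennreal (t powr (- lam / (1 - q) - 1)) * enn_powr (vbar0 v t) (q / (1 - q))
          \<partial>lebesgue_on {0..})
       ((1 - q) / q)"

end

theory Submission
  imports Defs "HOL-Complex_Analysis.Great_Picard" "HOL-Probability.Distribution_Functions"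
begin

text \<open>
  Cut the half-line into the dyadic blocks on which \<open>y\<^sup>\<lambda>\<close> lies in \<open>[2\<^sup>k, 2\<^bsup>k+1\<^esup>)\<close>, \<open>k\<close> an integer, and let \<open>bconst k\<close>
  be \<open>2\<^bsup>-k/q\<^esup>\<close> times the norm of \<open>v\<close> in \<open>L\<^bsup>p'\<^esup>\<close> of block \<open>k\<close>. Everything follows from one discrete criterion, valid for
  all \<open>p \<ge> 1\<close> and \<open>q > 0\<close>: for \<open>p \<le> q\<close> the operator is compact as soon as \<open>bconst k \<rightarrow> 0\<close> at both ends, and for \<open>q < p\<close>
  it is compact exactly if \<open>bconst\<close> is in \<open>l\<^sup>r\<close>.

  Sufficiency rests on \<open>Lmaj_estimate\<close>. For \<open>x\<close> about \<open>2\<^bsup>-j\<^esup>\<close> the kernel is at most \<open>exp (-2\<^bsup>k-j\<^esup>)\<close> on block \<open>k\<close>, and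
  after the normalisation by the lengths of the blocks this decays geometrically in \<open>\<bar>k - j\<bar>\<close>. Convolution with
  such a kernel is bounded on \<open>l\<^sup>q\<close> for every \<open>q > 0\<close> (\<open>convolution_geometric\<close>), so the \<open>L\<^sup>q\<close> size of the image is controlled by
  the \<open>l\<^sup>q\<close> size of the products of \<open>bconst k\<close> with the norm of \<open>f\<close> on block \<open>k\<close>. Hoelder's inequality, or the inclusion
  \<open>l\<^sup>p \<subseteq> l\<^sup>q\<close>, then shows that the far blocks contribute little, uniformly on bounded sets. The operator restricted to
  finitely many blocks produces equicontinuous functions of \<open>x\<close> with exponential decay, and a diagonal sequence with
  dominated convergence gives compactness (\<open>compact_if_tails_small\<close>).

  Necessity uses functions that norm \<open>v\<close> on a set. If \<open>f\<close> norms \<open>v\<close> on \<open>(0,t)\<close>, its image is large on the interval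
  \<open>[t\<^bsup>-\<lambda>\<^esup>/2, t\<^bsup>-\<lambda>\<^esup>]\<close>. This interval escapes from every point as \<open>t \<rightarrow> 0\<close> or \<open>t \<rightarrow> \<infinity>\<close>, while the images
  accumulate at a fixed function of \<open>L\<^sup>q\<close>; hence \<open>t\<^bsup>-\<lambda>/q\<^esup>\<close> times the norm of \<open>v\<close> on \<open>(0,t)\<close> tends to zero
  (\<open>char_fun_subsequence_zero\<close>). For \<open>q < p\<close> a superposition of norming functions of the blocks shows that boundedness alone forces
  \<open>bconst\<close> into \<open>l\<^sup>r\<close> (\<open>compact_imp_bconst_summable\<close>).

  It remains to compare \<open>bconst\<close> with the quantities of the theorem. The quantities with a limit at \<open>0\<close> and \<open>\<infinity>\<close> dominate \<open>bconst\<close>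
  directly. The constants \<open>B\<^sub>p\<close> and \<open>\<parallel>B\<^sub>q\<parallel>\<^bsub>p'\<^esub>\<close> are \<open>l\<^bsup>p'\<^esup>\<close> norms of \<open>bconst\<close> up to constants; for \<open>q < 1\<close> one has
  \<open>r < p'\<close>, so that \<open>\<parallel>B\<^sub>q\<parallel>\<^bsub>p'\<^esub>\<close> is only a necessary condition. For \<open>B\<^sub>\<L>\<close> one needs discrete Hardy inequalities, again
  instances of \<open>convolution_geometric\<close>, and for \<open>q > 1\<close> a bound for the integral over one block (\<open>B_integral_block_ge\<close>). A shift of the index treats \<open>B\<^bsub>q'\<^esub>\<close>.
\<close>

section \<open>Powers of extended nonnegative reals and sums over the integers\<close>

lemma enn_powr_ennreal:
  assumes "0 \<le> x" "a > 0" shows "enn_powr (ennreal x) a = ennreal (x powr a)"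
  using assms by (auto simp: enn_powr_def)

lemma enn_powr_ennreal_pos:
  assumes "0 < x" shows "enn_powr (ennreal x) a = ennreal (x powr a)"
  using assms by (auto simp: enn_powr_def)

lemma enn_powr_zero [simp]: "a > 0 \<Longrightarrow> enn_powr 0 a = 0"
  by (simp add: enn_powr_def)

lemma enn_powr_top [simp]: "a > 0 \<Longrightarrow> enn_powr top a = top"
  by (simp add: enn_powr_def)

lemma enn_powr_one [simp]: "enn_powr x 1 = x"
  by (cases x) (auto simp: enn_powr_def)

lemma enn_powr_mono: "a > 0 \<Longrightarrow> x \<le> y \<Longrightarrow> enn_powr x a \<le> enn_powr y a"
  by (cases x; cases y) (auto simp: enn_powr_ennreal powr_mono2 top_unique)

lemma enn_powr_antimono: "a < 0 \<Longrightarrow> x \<le> y \<Longrightarrow> enn_powr y a \<le> enn_powr x a"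
proof (cases "x = 0 \<or> y = top")
  case True
  then show "a < 0 \<Longrightarrow> x \<le> y \<Longrightarrow> enn_powr y a \<le> enn_powr x a"
    by (auto simp: enn_powr_def)
next
  case False
  then show "a < 0 \<Longrightarrow> x \<le> y \<Longrightarrow> enn_powr y a \<le> enn_powr x a"
    by (cases x; cases y) (auto simp: enn_powr_ennreal_pos enn_powr_def top_unique intro!: powr_mono2')
qed

lemma enn_powr_eq_0_iff: "a > 0 \<Longrightarrow> enn_powr x a = 0 \<longleftrightarrow> x = 0"
  by (cases x) (auto simp: enn_powr_ennreal)

lemma enn_powr_mult: "a > 0 \<Longrightarrow> enn_powr (x * y) a = enn_powr x a * enn_powr y a"
proof (cases x)
  case (real r)
  show "a > 0 \<Longrightarrow> ?thesis"
  proof (cases y)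
    case (real s)
    then show "a > 0 \<Longrightarrow> ?thesis"
      using \<open>x = ennreal r\<close> \<open>0 \<le> r\<close>
      by (simp add: enn_powr_ennreal powr_mult flip: ennreal_mult)
  next
    case top
    then show "a > 0 \<Longrightarrow> ?thesis"
      using \<open>x = ennreal r\<close> \<open>0 \<le> r\<close>
      by (cases "r = 0") (auto simp: enn_powr_ennreal ennreal_mult_top)
  qed
next
  case top
  show "a > 0 \<Longrightarrow> ?thesis"
    using top by (cases "y = 0") (auto simp: ennreal_top_mult enn_powr_eq_0_iff)
qed

lemma enn_powr_powr: "a > 0 \<Longrightarrow> b > 0 \<Longrightarrow> enn_powr (enn_powr x a) b = enn_powr x (a * b)"
  by (cases x) (auto simp: enn_powr_ennreal powr_powr)

lemma enn_powr_add: "a > 0 \<Longrightarrow> b > 0 \<Longrightarrow> enn_powr x a * enn_powr x b = enn_powr x (a + b)"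
  by (cases x) (auto simp: enn_powr_ennreal powr_add simp flip: ennreal_mult)

lemma enn_powr_inverse: "a > 0 \<Longrightarrow> enn_powr (enn_powr x a) (1 / a) = x"
  by (simp add: enn_powr_powr)

lemma enn_powr_inverse': "a > 0 \<Longrightarrow> enn_powr (enn_powr x (1 / a)) a = x"
  by (simp add: enn_powr_powr)

lemma enn_powr_less_top_iff: "a > 0 \<Longrightarrow> enn_powr x a < top \<longleftrightarrow> x < top"
  by (cases x) (auto simp: enn_powr_ennreal)

text \<open>
  Positive powers are order isomorphisms of \<open>[0,\<infinity>]\<close>, so a power can be moved to the other side of an
  inequality. This is how a bound on \<open>\<integral>F\<^sup>q\<close> becomes a bound on a quasi-norm and back.
\<close>

lemma enn_powr_le_iff: "a > 0 \<Longrightarrow> enn_powr x a \<le> y \<longleftrightarrow> x \<le> enn_powr y (1 / a)"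
  using enn_powr_mono[of a x "enn_powr y (1 / a)"] enn_powr_mono[of "1 / a" "enn_powr x a" y]
  by (auto simp: enn_powr_inverse enn_powr_inverse')

lemma enn_powr_less_iff: "a > 0 \<Longrightarrow> enn_powr x a < y \<longleftrightarrow> x < enn_powr y (1 / a)"
  using enn_powr_le_iff[of "1 / a" y x] by (auto simp: not_le[symmetric])

lemma borel_measurable_enn_powr [measurable]:
  assumes [measurable]: "F \<in> borel_measurable M"
  shows "(\<lambda>x. enn_powr (F x) a) \<in> borel_measurable M"
  unfolding enn_powr_def by measurable

lemma tendsto_enn_powr_zero:
  assumes "(f \<longlongrightarrow> 0) F" "a > 0" shows "((\<lambda>x. enn_powr (f x) a) \<longlongrightarrow> 0) F"
proof (rule order_tendstoI)
  fix e :: ennreal assume "0 < e"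
  then have "0 < enn_powr e (1 / a)"
    using assms(2) by (simp add: zero_less_iff_neq_zero enn_powr_eq_0_iff)
  from order_tendstoD(2)[OF assms(1) this]
  show "\<forall>\<^sub>F x in F. enn_powr (f x) a < e"
    by eventually_elim (use assms(2) in \<open>simp add: enn_powr_less_iff\<close>)
qed simp

lemma enn_powr_sum_le:
  assumes "a > 0"
  shows "enn_powr (x + y) a \<le> ennreal (2 powr a) * (enn_powr x a + enn_powr y a)"
proof -
  have "x + y \<le> ennreal 2 * max x y"
    by (simp add: mult_2 max_def add_mono)
  then have "enn_powr (x + y) a \<le> ennreal (2 powr a) * enn_powr (max x y) a"
    using enn_powr_mono[OF assms, of "x + y" "ennreal 2 * max x y"] assms
    by (simp add: enn_powr_mult enn_powr_ennreal del: ennreal_numeral)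
  also have "\<dots> \<le> ennreal (2 powr a) * (enn_powr x a + enn_powr y a)"
    by (intro mult_left_mono) (auto simp: max_def)
  finally show ?thesis .
qed

text \<open>
  Either \<open>x\<close> is at most the power of \<open>y\<close> for which \<open>(x y)\<^sup>q\<close> is bounded by \<open>y\<^sup>r\<close>, or \<open>y\<close> is at most the inverse
  power of \<open>x\<close>, and then \<open>(x y)\<^sup>q\<close> is bounded by \<open>x\<^sup>p\<close>. The sharp constants of Young's inequality are given
  up for a proof that works verbatim on \<open>[0,\<infinity>]\<close>.
\<close>

lemma Young_enn_powr:
  assumes "0 < q" "q < p" "r = p * q / (p - q)"
  shows "enn_powr (x * y) q \<le> enn_powr x p + enn_powr y r"
proof -
  define t where "t = q / (p - q)"
  have t: "t > 0" and r: "(t + 1) * q = r" and p: "(1 + 1 / t) * q = p"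
    using assms by (auto simp: t_def field_simps)
  show ?thesis
  proof (cases "x \<le> enn_powr y t")
    case True
    have "enn_powr (x * y) q \<le> enn_powr (enn_powr y t * enn_powr y 1) q"
      using True assms by (intro enn_powr_mono mult_mono) auto
    also have "\<dots> = enn_powr y r"
      using t assms r by (simp add: enn_powr_add enn_powr_powr del: enn_powr_one)
    finally show ?thesis by (rule order_trans) simp
  next
    case False
    then have "y \<le> enn_powr x (1 / t)"
      using t enn_powr_le_iff[of t y x] by auto
    then have "enn_powr (x * y) q \<le> enn_powr (enn_powr x 1 * enn_powr x (1 / t)) q"
      using assms by (intro enn_powr_mono mult_mono) auto
    also have "\<dots> = enn_powr x p"
      using t assms p by (simp add: enn_powr_add enn_powr_powr add_pos_pos del: enn_powr_one)
    finally show ?thesis by (rule order_trans) simp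
  qed
qed

text \<open>
  Hoelder's inequality with exponents \<open>p/q\<close> and \<open>r/q\<close>, for any \<open>0 < q < p\<close>, up to the factor \<open>2\<close> inherited from
  \<open>Young_enn_powr\<close>. The instance \<open>q = 1\<close> on the half-line is the usual inequality for \<open>p\<close> and \<open>p'\<close>; the general
  case on the counting measure of the integers treats the range \<open>q < p\<close>.
\<close>

lemma Holder_enn_powr:
  assumes q: "0 < q" "q < p" and r: "r = p * q / (p - q)"
    and [measurable]: "F \<in> borel_measurable M" "G \<in> borel_measurable M"
  shows "(\<integral>\<^sup>+x. enn_powr (F x * G x) q \<partial>M)
    \<le> 2 * (enn_powr (\<integral>\<^sup>+x. enn_powr (F x) p \<partial>M) (q / p) * enn_powr (\<integral>\<^sup>+x. enn_powr (G x) r \<partial>M) (q / r))"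
    (is "?L \<le> 2 * (enn_powr ?A _ * enn_powr ?B _)")
proof -
  have pos: "p > 0" "r > 0" "q / p > 0" "q / r > 0" using q r by auto
  have L0: "?L = 0" if "(AE x in M. F x = 0) \<or> (AE x in M. G x = 0)"
  proof -
    have "AE x in M. enn_powr (F x * G x) q = 0"
      using that q by auto
    then show ?thesis by (simp add: nn_integral_0_iff_AE)
  qed
  consider "?A = 0 \<or> ?B = 0" | "?A = top" "?B \<noteq> 0" | "?B = top" "?A \<noteq> 0"
    | "?A \<noteq> 0" "?B \<noteq> 0" "?A < top" "?B < top"
    by (metis less_top)
  then show ?thesis
  proof cases
    case 1
    then have "(AE x in M. F x = 0) \<or> (AE x in M. G x = 0)"
      using pos by (auto simp: nn_integral_0_iff_AE enn_powr_eq_0_iff)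
    then show ?thesis using L0 by simp
  next
    case 2 then show ?thesis
      using pos by (simp add: ennreal_top_mult enn_powr_eq_0_iff ennreal_mult_top)
  next
    case 3 then show ?thesis
      using pos by (simp add: enn_powr_eq_0_iff ennreal_mult_top)
  next
    case 4
    define a where "a = enn2real ?A"
    define b where "b = enn2real ?B"
    have ab: "?A = ennreal a" "?B = ennreal b" "a > 0" "b > 0"
      using 4 by (auto simp: a_def b_def enn2real_positive_iff zero_less_iff_neq_zero)
    define F' where "F' = (\<lambda>x. ennreal (a powr (- 1 / p)) * F x)"
    define G' where "G' = (\<lambda>x. ennreal (b powr (- 1 / r)) * G x)"
    have [measurable]: "F' \<in> borel_measurable M" "G' \<in> borel_measurable M"
      by (auto simp: F'_def G'_def)
    have 1: "(\<integral>\<^sup>+x. enn_powr (F' x) p \<partial>M) = 1"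
    proof -
      have "(a powr (- 1 / p)) powr p * a = 1"
        using pos ab by (simp add: powr_powr powr_neg_one field_simps)
      then show ?thesis
        using pos ab by (simp add: F'_def enn_powr_mult enn_powr_ennreal nn_integral_cmult flip: ennreal_mult')
    qed
    have 2: "(\<integral>\<^sup>+x. enn_powr (G' x) r \<partial>M) = 1"
    proof -
      have "(b powr (- 1 / r)) powr r * b = 1"
        using pos ab by (simp add: powr_powr powr_neg_one field_simps)
      then show ?thesis
        using pos ab by (simp add: G'_def enn_powr_mult enn_powr_ennreal nn_integral_cmult flip: ennreal_mult')
    qed
    have eq: "F x * G x = ennreal (a powr (1 / p) * b powr (1 / r)) * (F' x * G' x)" for x
    proof -
      have "ennreal (a powr (1 / p) * b powr (1 / r)) * (F' x * G' x)
        = ennreal (a powr (1 / p) * a powr (- 1 / p)) * ennreal (b powr (1 / r) * b powr (- 1 / r)) * (F x * G x)"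
        by (simp add: F'_def G'_def ennreal_mult mult_ac)
      then show ?thesis using ab by (simp flip: powr_add)
    qed
    have "?L = ennreal ((a powr (1 / p) * b powr (1 / r)) powr q) * (\<integral>\<^sup>+x. enn_powr (F' x * G' x) q \<partial>M)"
      unfolding eq using q by (subst nn_integral_cmult[symmetric]) (auto simp: enn_powr_mult[of q "ennreal _"] enn_powr_ennreal)
    also have "\<dots> \<le> ennreal ((a powr (1 / p) * b powr (1 / r)) powr q)
        * (\<integral>\<^sup>+x. enn_powr (F' x) p + enn_powr (G' x) r \<partial>M)"
      by (intro mult_left_mono nn_integral_mono Young_enn_powr q r) auto
    also have "\<dots> = ennreal ((a powr (1 / p) * b powr (1 / r)) powr q) * 2"
      by (simp add: nn_integral_add 1 2)
    also have "\<dots> = 2 * (enn_powr ?A (q / p) * enn_powr ?B (q / r))"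
      using ab pos by (simp add: enn_powr_ennreal powr_mult powr_powr ennreal_mult mult.commute)
    finally show ?thesis .
  qed
qed

abbreviation geom :: "real \<Rightarrow> int \<Rightarrow> ennreal" where
  "geom a m \<equiv> ennreal (2 powr (- a * \<bar>real_of_int m\<bar>))"
abbreviation idx :: "int measure" where "idx \<equiv> count_space UNIV"

text \<open>
  Sums over the indices of the dyadic blocks, with values in \<open>[0,\<infinity>]\<close>. As integrals they can be exchanged with
  integrals over the half-line, and dominated convergence and \<open>Holder_enn_powr\<close> apply to them.
\<close>

abbreviation isum :: "(int \<Rightarrow> ennreal) \<Rightarrow> ennreal" (binder "ISUM " 10)
  where "isum F \<equiv> integral\<^sup>N idx F"

text \<open>
  The bijection \<open>int_decode\<close> visits \<open>m\<close> at a time at most \<open>2\<bar>m\<bar>\<close>, which reduces the two-sided series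
  to an ordinary geometric one.
\<close>

lemma nn_integral_geometric_int:
  fixes be :: real
  assumes "be > 0"
  shows "(\<integral>\<^sup>+m. ennreal (2 powr (- be * \<bar>real_of_int m\<bar>)) \<partial>count_space UNIV) < top"
proof -
  have bij: "bij_betw int_decode UNIV UNIV" by (rule bij_int_decode)
  have "(\<integral>\<^sup>+m. ennreal (2 powr (- be * \<bar>real_of_int m\<bar>)) \<partial>count_space UNIV)
    = (\<integral>\<^sup>+n. ennreal (2 powr (- be * \<bar>real_of_int (int_decode n)\<bar>)) \<partial>count_space UNIV)"
    by (rule nn_integral_bij_count_space[OF bij, symmetric])
  also have "\<dots> \<le> (\<integral>\<^sup>+n. ennreal ((2 powr (- be / 2)) ^ n) \<partial>count_space UNIV)"
  proof (intro nn_integral_mono ennreal_leI)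
    fix n :: nat
    have "real n / 2 \<le> \<bar>real_of_int (int_decode n)\<bar>"
      by (auto simp: int_decode_def sum_decode_def elim!: evenE oddE)
    then have "2 powr (- be * \<bar>real_of_int (int_decode n)\<bar>) \<le> 2 powr (- be * (real n / 2))"
      using assms by (intro powr_mono) auto
    also have "\<dots> = (2 powr (- be / 2)) ^ n"
      by (simp add: powr_realpow[symmetric] powr_powr)
    finally show "2 powr (- be * \<bar>real_of_int (int_decode n)\<bar>) \<le> (2 powr (- be / 2)) ^ n" .
  qed
  also have "\<dots> = (\<Sum>n. ennreal ((2 powr (- be / 2)) ^ n))"
    by (rule nn_integral_count_space_nat)
  also have "\<dots> < top"
  proof -
    have "2 powr (- be / 2) < 2 powr 0"
      using assms by (intro powr_less_mono) auto
    then have "summable (\<lambda>n. (2 powr (- be / 2)) ^ n)"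
      by (intro summable_geometric) auto
    then show ?thesis by (simp add: suminf_ennreal2 less_top[symmetric])
  qed
  finally show ?thesis .
qed

lemma enn_powr_SUP_le:
  assumes "s > 0"
  shows "enn_powr (SUP k. g k) s \<le> (\<integral>\<^sup>+k. enn_powr (g k) s \<partial>count_space (UNIV :: 'a set))"
proof -
  have "(SUP k. g k) \<le> enn_powr (\<integral>\<^sup>+k. enn_powr (g k) s \<partial>count_space (UNIV :: 'a set)) (1 / s)"
  proof (rule SUP_least)
    fix k
    have "enn_powr (g k) s \<le> (\<integral>\<^sup>+k. enn_powr (g k) s \<partial>count_space UNIV)"
      by (rule nn_integral_ge_point) simp
    then show "g k \<le> enn_powr (\<integral>\<^sup>+k. enn_powr (g k) s \<partial>count_space UNIV) (1 / s)"
      using assms by (simp add: enn_powr_le_iff[symmetric])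
  qed
  then show ?thesis using assms by (simp add: enn_powr_le_iff)
qed

text \<open>
  Convolution with a two-sided geometric kernel is bounded on \<open>l\<^sup>s\<close> for every \<open>s > 0\<close>. Writing the kernel as
  \<open>psi \<cdot> psi\<close>, one factor is summed while the other one stays inside a supremum:
  \<open>\<Sum>\<^sub>k psi(k-j)\<^sup>2 b\<^sub>k \<le> (\<Sum> psi) \<cdot> sup\<^sub>k psi(k-j) b\<^sub>k\<close>. The \<open>s\<close>-th power of the supremum is at most the sum of the
  \<open>s\<close>-th powers, and summing over \<open>j\<close> gives the claim without separating \<open>s \<le> 1\<close> from \<open>s \<ge> 1\<close>.
\<close>

lemma convolution_geometric:
  fixes al s :: real
  assumes "al > 0" "s > 0"
  obtains K where "K < top" "\<And>b :: int \<Rightarrow> ennreal.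
    (ISUM j. enn_powr (ISUM k. geom al (k - j) * b k) s)
      \<le> K * (ISUM k. enn_powr (b k) s)"
proof
  \<comment> \<open>The kernel is the square of this sequence.\<close>
  define psi where "psi = (\<lambda>m :: int. geom (al / 2) m)"
  define P where "P = (ISUM m. psi m)"
  define Q where "Q = (ISUM m. enn_powr (psi m) s)"
  have P: "P < top"
    unfolding P_def psi_def using assms by (intro nn_integral_geometric_int) auto
  have "enn_powr (psi m) s = geom (al / 2 * s) m" for m
    using assms by (simp add: psi_def enn_powr_ennreal powr_powr mult_ac)
  then have Q: "Q < top"
    unfolding Q_def using nn_integral_geometric_int[of "al / 2 * s"] assms by simp
  show "enn_powr P s * Q < top"
    using P Q assms by (simp add: ennreal_mult_less_top enn_powr_less_top_iff)
  fix b :: "int \<Rightarrow> ennreal"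
  have shift: "(ISUM k. h (k - j)) = (ISUM m. h m)"
    for h :: "int \<Rightarrow> ennreal" and j
    by (rule nn_integral_bij_count_space) (rule bij_betwI[where g="\<lambda>m. m + j"], auto)
  have shift': "(ISUM j. h (k - j)) = (ISUM m. h m)"
    for h :: "int \<Rightarrow> ennreal" and k
    by (rule nn_integral_bij_count_space) (rule bij_betwI[where g="\<lambda>m. k - m"], auto)
  have "enn_powr (ISUM k. geom al (k - j) * b k) s
     \<le> enn_powr P s * (ISUM k. enn_powr (psi (k - j) * b k) s)" for j
  proof -
    have eq: "geom al m = psi m * psi m" for m
      by (simp add: psi_def powr_add[symmetric] flip: ennreal_mult)
    have "(ISUM k. geom al (k - j) * b k)
        \<le> (ISUM k. psi (k - j) * (SUP k. psi (k - j) * b k))"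
      unfolding eq mult.assoc by (intro nn_integral_mono mult_left_mono SUP_upper) auto
    also have "\<dots> = P * (SUP k. psi (k - j) * b k)"
      by (simp add: nn_integral_multc shift P_def)
    finally have "enn_powr (ISUM k. geom al (k - j) * b k) s
       \<le> enn_powr P s * enn_powr (SUP k. psi (k - j) * b k) s"
      using assms by (simp add: enn_powr_mono flip: enn_powr_mult)
    also have "\<dots> \<le> enn_powr P s * (ISUM k. enn_powr (psi (k - j) * b k) s)"
      using assms by (intro mult_left_mono enn_powr_SUP_le) auto
    finally show ?thesis .
  qed
  then have "(ISUM j. enn_powr (ISUM k. geom al (k - j) * b k) s)
    \<le> (ISUM j. enn_powr P s * (ISUM k. enn_powr (psi (k - j) * b k) s))"
    by (intro nn_integral_mono) auto
  also have "\<dots> = enn_powr P s * (ISUM j. (ISUM k. enn_powr (psi (k - j)) s * enn_powr (b k) s))"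
    using assms by (simp add: nn_integral_cmult enn_powr_mult)
  also have "(ISUM j. (ISUM k. enn_powr (psi (k - j)) s * enn_powr (b k) s))
    = (ISUM k. (ISUM j. enn_powr (psi (k - j)) s * enn_powr (b k) s))"
    by (rule nn_integral_count_space_nn_integral) auto
  also have "\<dots> = Q * (ISUM k. enn_powr (b k) s)"
    by (simp add: nn_integral_multc nn_integral_cmult shift'[of "\<lambda>m. enn_powr (psi m) s"] Q_def)
  finally show "(ISUM j. enn_powr (ISUM k. geom al (k - j) * b k) s)
    \<le> enn_powr P s * Q * (ISUM k. enn_powr (b k) s)"
    by (simp add: mult.assoc)
qed

section \<open>Dyadic blocks of the half-line\<close>

definition dyadic_block :: "real \<Rightarrow> int \<Rightarrow> real set" where
  "dyadic_block lam k = {y. 0 < y \<and> \<lfloor>lam * log 2 y\<rfloor> = k}"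

text \<open>
  On the block with index \<open>k\<close> the variable \<open>y\<^sup>\<lambda>\<close> is comparable to \<open>2\<^sup>k\<close>, hence \<open>e\<^bsup>-xy^\<lambda>\<^esup>\<close> is
  comparable to \<open>1\<close> as long as \<open>x \<lesssim> 2\<^bsup>-k\<^esup>\<close> and negligible for much larger \<open>x\<close>.
\<close>

lemma mem_dyadic_block_iff:
  "y \<in> dyadic_block lam k \<longleftrightarrow> 0 < y \<and> 2 powr k \<le> y powr lam \<and> y powr lam < 2 powr (k + 1)"
proof (cases "0 < y")
  case True
  then have "y powr lam = 2 powr (lam * log 2 y)"
    by (simp add: powr_def log_def)
  then show ?thesis using True
    by (simp add: dyadic_block_def floor_eq_iff)
qed (simp add: dyadic_block_def)

lemma measurable_halfline_id [measurable]: "(\<lambda>x. x) \<in> lebesgue_on {0::real..} \<rightarrow>\<^sub>M borel"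
  by (intro measurable_restrict_space1 measurable_completion) simp

lemma sets_halfline_borel: "S \<in> sets borel \<Longrightarrow> S \<subseteq> {0::real..} \<Longrightarrow> S \<in> sets (lebesgue_on {0..})"
  by (auto simp: sets_restrict_space_iff)

lemma sets_halfline_iff: "S \<in> sets (lebesgue_on {0::real..}) \<longleftrightarrow> S \<in> sets lebesgue \<and> S \<subseteq> {0..}"
  by (auto simp: sets_restrict_space_iff)

lemma dyadic_block_borel [measurable]: "dyadic_block lam k \<in> sets borel"
  unfolding dyadic_block_def by measurable

lemma dyadic_block_halfline [measurable]: "dyadic_block lam k \<in> sets (lebesgue_on {0..})"
  by (rule sets_halfline_borel) (auto simp: dyadic_block_def)

lemma AE_halfline_pos: "AE x in lebesgue_on {0::real..}. 0 < x"
proof -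
  have "AE x in lebesgue. x \<noteq> (0::real)"
    by (rule AE_completion) (rule AE_lborel_singleton)
  then show ?thesis
    by (auto simp: AE_restrict_space_iff elim!: eventually_mono)
qed

lemma sigma_finite_halfline: "sigma_finite_measure (lebesgue_on {0::real..})"
proof
  have "emeasure (lebesgue_on {0..}) {0..real n} \<noteq> \<infinity>" for n
    by (subst emeasure_restrict_space) auto
  then show "\<exists>A. countable A \<and> A \<subseteq> sets (lebesgue_on {0::real..}) \<and> \<Union>A = space (lebesgue_on {0..})
      \<and> (\<forall>a\<in>A. emeasure (lebesgue_on {0..}) a \<noteq> \<infinity>)"
    by (intro exI[of _ "range (\<lambda>n. {0..real n})"])
      (auto intro!: sets_halfline_borel simp: real_arch_simple)
qed

lemma nn_integral_lebesgue_on_subset: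
  assumes "S \<in> sets (lebesgue_on {0::real..})"
  shows "(\<integral>\<^sup>+y. F y \<partial>lebesgue_on S) = (\<integral>\<^sup>+y. F y * indicator S y \<partial>lebesgue_on {0..})"
proof -
  have S: "S \<in> sets lebesgue" "S \<subseteq> {0..}" using assms by (auto simp: sets_halfline_iff)
  have "F y * indicator S y * indicator {0..} y = F y * indicator S y" for y
    using S(2) by (auto split: split_indicator)
  then show ?thesis using S(1) by (simp add: nn_integral_restrict_space)
qed

lemma nn_integral_dyadic_blocks:
  assumes [measurable]: "F \<in> borel_measurable (lebesgue_on {0::real..})"
  shows "(\<integral>\<^sup>+y. F y \<partial>lebesgue_on {0..})
    = (\<integral>\<^sup>+k. (\<integral>\<^sup>+y. F y * indicator (dyadic_block lam k) y \<partial>lebesgue_on {0..}) \<partial>count_space UNIV)"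
proof -
  have "AE y in lebesgue_on {0..}. F y = (\<integral>\<^sup>+k. F y * indicator (dyadic_block lam k) y \<partial>count_space UNIV)"
    using AE_halfline_pos
  proof eventually_elim
    fix y :: real assume "0 < y"
    then have "(\<integral>\<^sup>+k. F y * indicator (dyadic_block lam k) y \<partial>count_space UNIV)
      = (\<Sum>k\<in>{\<lfloor>lam * log 2 y\<rfloor>}. F y * indicator (dyadic_block lam k) y)"
      by (intro nn_integral_count_space') (auto simp: dyadic_block_def)
    with \<open>0 < y\<close> show "F y = (\<integral>\<^sup>+k. F y * indicator (dyadic_block lam k) y \<partial>count_space UNIV)"
      by (simp add: dyadic_block_def)
  qed
  then have "(\<integral>\<^sup>+y. F y \<partial>lebesgue_on {0..})
    = (\<integral>\<^sup>+y. (\<integral>\<^sup>+k. F y * indicator (dyadic_block lam k) y \<partial>count_space UNIV) \<partial>lebesgue_on {0..})"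
    by (rule nn_integral_cong_AE)
  also have "\<dots> = (\<integral>\<^sup>+k. (\<integral>\<^sup>+y. F y * indicator (dyadic_block lam k) y \<partial>lebesgue_on {0..}) \<partial>count_space UNIV)"
    by (rule nn_integral_count_space_nn_integral) auto
  finally show ?thesis .
qed

lemma powr_mult_exp_minus_le:
  fixes u b :: real
  assumes "u > 0" "b > 0" shows "u powr b * exp (- u) \<le> b powr b"
proof -
  have "u / b \<le> exp (u / b)"
    using exp_ge_add_one_self[of "u / b"] by linarith
  then have "(u / b) powr b \<le> exp (u / b) powr b"
    using assms by (intro powr_mono2) auto
  also have "\<dots> = exp u" using assms by (simp add: powr_def)
  finally show ?thesis
    using assms by (simp add: powr_divide exp_minus field_simps)
qed

text \<open>
  For \<open>m \<le> 0\<close> the exponential is at most \<open>1\<close>; for \<open>m > 0\<close> it beats every power of \<open>2\<^sup>m\<close>.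
\<close>

lemma exp_kernel_le_geometric:
  fixes a :: real
  assumes "a > 0"
  obtains C :: real where "C > 0"
    "\<And>m :: int. 2 powr (a * m) * exp (- (2 powr m)) \<le> C * 2 powr (- a * \<bar>real_of_int m\<bar>)"
proof
  define C where "C = max 1 ((2 * a) powr (2 * a))"
  show "C > 0" by (simp add: C_def)
  fix m :: int
  show "2 powr (a * m) * exp (- (2 powr m)) \<le> C * 2 powr (- a * \<bar>real_of_int m\<bar>)"
  proof (cases "m \<le> 0")
    case True
    have "2 powr (a * m) * exp (- (2 powr m)) \<le> 2 powr (a * m) * 1"
      by (intro mult_left_mono) auto
    also have "\<dots> = 1 * 2 powr (- a * \<bar>real_of_int m\<bar>)"
      using True by simp
    also have "\<dots> \<le> C * 2 powr (- a * \<bar>real_of_int m\<bar>)"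
      by (intro mult_right_mono) (auto simp: C_def)
    finally show ?thesis .
  next
    case False
    have "2 powr (2 * a * m) * exp (- (2 powr m)) = (2 powr m) powr (2 * a) * exp (- (2 powr m))"
      by (simp add: powr_powr mult_ac)
    also have "\<dots> \<le> C"
      using powr_mult_exp_minus_le[of "2 powr m" "2 * a"] assms by (simp add: C_def)
    finally have le: "2 powr (2 * a * m) * exp (- (2 powr m)) \<le> C" .
    have "2 powr (a * m) = 2 powr (- a * m) * 2 powr (2 * a * m)"
      by (simp add: powr_add[symmetric] algebra_simps)
    then have "2 powr (a * m) * exp (- (2 powr m)) = 2 powr (- a * m) * (2 powr (2 * a * m) * exp (- (2 powr m)))"
      by (simp only: mult.assoc)
    also have "\<dots> \<le> 2 powr (- a * m) * C"
      using le by (intro mult_left_mono) auto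
    finally show ?thesis using False
      by (simp add: mult.commute)
  qed
qed

lemma borel_measurable_mono_ennreal:
  fixes f :: "real \<Rightarrow> ennreal"
  assumes "mono f" shows "f \<in> borel_measurable borel"
proof (rule borel_measurableI_greater)
  fix a :: ennreal
  have "is_interval {x. a < f x}"
    using assms by (auto simp: is_interval_1 mono_def intro: less_le_trans)
  then show "{x \<in> space borel. a < f x} \<in> sets borel"
    by (simp add: real_interval_borel_measurable)
qed

lemma esssup_le_iff:
  fixes F :: "'a \<Rightarrow> ennreal"
  assumes "F \<in> borel_measurable M" shows "esssup M F \<le> C \<longleftrightarrow> (AE x in M. F x \<le> C)"
proof
  assume "esssup M F \<le> C"
  then show "AE x in M. F x \<le> C"
    using esssup_AE[where M=M and f=F] by (auto elim!: eventually_mono)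
next
  assume "AE x in M. F x \<le> C" with assms show "esssup M F \<le> C" by (rule esssup_I)
qed

section \<open>The dyadic estimate of the operator\<close>

text \<open>
  The standing assumptions. For a set \<open>S\<close>, \<open>wnorm S\<close> is the norm of \<open>v\<close> in \<open>L\<^bsup>p'\<^esup>(S)\<close> for all \<open>p \<ge> 1\<close>
  (essential supremum if \<open>p = 1\<close>), so that \<open>p = 1\<close> and \<open>p > 1\<close> can be treated together. The sequence \<open>bconst\<close>
  is the norm of the operator restricted to a single block, up to constants: the functions \<open>e\<^bsup>-xy^\<lambda>\<^esup>\<close> with \<open>y\<close> in
  block \<open>k\<close> have \<open>L\<^sup>q\<close> norm about \<open>2\<^bsup>-k/q\<^esup>\<close>.
\<close>

locale laplace_weight =
  fixes lam p q :: real and v :: "real \<Rightarrow> real"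
  assumes lam_pos: "lam > 0" and p_ge_1: "p \<ge> 1" and q_pos: "q > 0"
    and v_nonneg: "\<And>x. x \<ge> 0 \<Longrightarrow> v x \<ge> 0"
    and v_loc: "v \<in> Lr_loc (conj_exp_ext p)"
begin

abbreviation HL :: "real measure" where "HL \<equiv> lebesgue_on {0..}"
abbreviation pow_int :: "real \<Rightarrow> (real \<Rightarrow> real) \<Rightarrow> ennreal" where
  "pow_int r f \<equiv> (\<integral>\<^sup>+y. ennreal (\<bar>f y\<bar> powr r) \<partial>HL)"
abbreviation blk :: "int \<Rightarrow> real set" where "blk \<equiv> dyadic_block lam"

definition wnorm :: "real set \<Rightarrow> ennreal" where "wnorm S = Lr_norm (conj_exp_ext p) S v"
definition bconst :: "int \<Rightarrow> ennreal" where "bconst k = ennreal (2 powr (- real_of_int k / q)) * wnorm (blk k)"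
definition local_norm :: "(real \<Rightarrow> real) \<Rightarrow> real set \<Rightarrow> ennreal" where
  "local_norm f S = enn_powr (\<integral>\<^sup>+y. ennreal (\<bar>f y\<bar> powr p) * indicator S y \<partial>HL) (1 / p)"

lemma v_measurable [measurable]: "v \<in> borel_measurable HL"
  using v_loc by (simp add: Lr_loc_def)

lemma conj_exp_gt_1: "1 < p \<Longrightarrow> conj_exp p > 1"
  by (simp add: conj_exp_def field_simps)

lemma wnorm_eq_integral:
  assumes "1 < p" "S \<in> sets HL"
  shows "wnorm S = enn_powr (\<integral>\<^sup>+y. ennreal (v y powr conj_exp p) * indicator S y \<partial>HL) (1 / conj_exp p)"
proof -
  have "(\<integral>\<^sup>+y. ennreal (\<bar>v y\<bar> powr conj_exp p) * indicator S y \<partial>HL)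
    = (\<integral>\<^sup>+y. ennreal (v y powr conj_exp p) * indicator S y \<partial>HL)"
    by (intro nn_integral_cong) (auto simp: v_nonneg)
  then show ?thesis
    using assms conj_exp_gt_1[OF assms(1)]
    by (simp add: wnorm_def Lr_norm_def conj_exp_ext_def nn_integral_lebesgue_on_subset[OF assms(2)])
qed

lemma measurable_lebesgue_on_subset:
  assumes "S \<in> sets HL" "F \<in> borel_measurable HL" shows "F \<in> borel_measurable (lebesgue_on S)"
proof -
  have "restrict_space HL S = lebesgue_on S"
    using assms by (subst restrict_restrict_space) (auto simp: sets_halfline_iff Int_absorb1)
  then show ?thesis using measurable_restrict_space1[OF assms(2), of S] by simp
qed

text \<open>
  The only access to the essential supremum: every later argument for \<open>p = 1\<close> goes through upper bounds.
\<close>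

lemma wnorm_le_iff_1:
  assumes "p = 1" "S \<in> sets HL"
  shows "wnorm S \<le> C \<longleftrightarrow> (AE y in HL. y \<in> S \<longrightarrow> ennreal (v y) \<le> C)"
proof -
  have S: "S \<in> sets lebesgue" "S \<subseteq> {0..}" using assms by (auto simp: sets_halfline_iff)
  have m: "(\<lambda>x. ennreal \<bar>v x\<bar>) \<in> borel_measurable (lebesgue_on S)"
    using assms by - (rule measurable_lebesgue_on_subset, auto)
  have "wnorm S \<le> C \<longleftrightarrow> (AE y in lebesgue. y \<in> S \<longrightarrow> ennreal \<bar>v y\<bar> \<le> C)"
  proof -
    have "conj_exp_ext p = \<infinity>" using assms by (simp add: conj_exp_ext_def)
    then show ?thesis
      using S by (simp add: wnorm_def Lr_norm_def esssup_le_iff[OF m] AE_restrict_space_iff)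
  qed
  also have "\<dots> \<longleftrightarrow> (AE y in lebesgue. y \<in> {0..} \<longrightarrow> y \<in> S \<longrightarrow> ennreal (v y) \<le> C)"
    by (rule eventually_subst, rule always_eventually) (use S v_nonneg in auto)
  also have "\<dots> \<longleftrightarrow> (AE y in HL. y \<in> S \<longrightarrow> ennreal (v y) \<le> C)"
    by (simp add: AE_restrict_space_iff)
  finally show ?thesis .
qed

lemma p_cases: obtains "p = 1" | "1 < p" using p_ge_1 by force

lemma wnorm_mono: assumes "S \<in> sets HL" "T \<in> sets HL" "S \<subseteq> T" shows "wnorm S \<le> wnorm T"
proof (cases rule: p_cases)
  case 1
  have "AE y in HL. y \<in> T \<longrightarrow> ennreal (v y) \<le> wnorm T"
    using wnorm_le_iff_1[OF 1 assms(2)] by blast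
  then have "AE y in HL. y \<in> S \<longrightarrow> ennreal (v y) \<le> wnorm T"
    by eventually_elim (use assms in auto)
  then show ?thesis using wnorm_le_iff_1[OF 1 assms(1)] by blast
next
  case 2
  have "(\<integral>\<^sup>+y. ennreal (v y powr conj_exp p) * indicator S y \<partial>HL)
      \<le> (\<integral>\<^sup>+y. ennreal (v y powr conj_exp p) * indicator T y \<partial>HL)"
    using assms(3) by (intro nn_integral_mono) (auto split: split_indicator)
  then show ?thesis
    using assms conj_exp_gt_1[OF 2] by (simp add: wnorm_eq_integral[OF 2] enn_powr_mono)
qed

lemma wnorm_finite: assumes "S \<in> sets HL" "S \<subseteq> {0..b}" shows "wnorm S < top"
proof -
  have "wnorm S \<le> wnorm {0..b}"
    using assms by (intro wnorm_mono sets_halfline_borel[of "{0..b}"]) auto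
  also have "\<dots> < top"
  proof -
    have "\<forall>K. compact K \<and> K \<subseteq> {0..} \<longrightarrow> Lr_norm (conj_exp_ext p) K v < \<infinity>"
      using v_loc by (simp add: Lr_loc_def)
    from this[rule_format, of "{0..b}"] show ?thesis by (simp add: wnorm_def)
  qed
  finally show ?thesis .
qed

lemma blk_subset: "blk k \<subseteq> {0<..<2 powr ((real_of_int k + 1) / lam)}"
proof
  fix y assume "y \<in> blk k"
  then have y: "0 < y" "y powr lam < 2 powr (k + 1)"
    by (auto simp: mem_dyadic_block_iff)
  then have "(y powr lam) powr (1 / lam) < (2 powr (k + 1)) powr (1 / lam)"
    using lam_pos by (intro powr_less_mono2) auto
  then show "y \<in> {0<..<2 powr ((real_of_int k + 1) / lam)}"
    using y lam_pos by (simp add: powr_powr)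
qed

lemma wnorm_blk_finite: "wnorm (blk k) < top"
  using blk_subset[of k] by (intro wnorm_finite[where b="2 powr ((real_of_int k + 1) / lam)"]) fastforce+

lemma bconst_finite: "bconst k < top"
  by (simp add: bconst_def ennreal_mult_less_top wnorm_blk_finite)

lemma Holder_wnorm:
  assumes [measurable]: "f \<in> borel_measurable HL" and S[measurable]: "S \<in> sets HL"
  shows "(\<integral>\<^sup>+y. ennreal \<bar>f y * v y\<bar> * indicator S y \<partial>HL) \<le> 2 * (local_norm f S * wnorm S)"
proof (cases rule: p_cases)
  case 1
  have "AE y in HL. y \<in> S \<longrightarrow> ennreal (v y) \<le> wnorm S"
    using wnorm_le_iff_1[OF 1 S] by blast
  then have ae: "AE y in HL. ennreal \<bar>f y * v y\<bar> * indicator S y \<le> ennreal (\<bar>f y\<bar> powr p) * indicator S y * wnorm S"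
    using AE_halfline_pos
  proof eventually_elim
    fix y :: real assume "y \<in> S \<longrightarrow> ennreal (v y) \<le> wnorm S" "0 < y"
    then show "ennreal \<bar>f y * v y\<bar> * indicator S y \<le> ennreal (\<bar>f y\<bar> powr p) * indicator S y * wnorm S"
      using 1 v_nonneg[of y] by (auto simp: abs_mult ennreal_mult mult_left_mono split: split_indicator)
  qed
  have "(\<integral>\<^sup>+y. ennreal \<bar>f y * v y\<bar> * indicator S y \<partial>HL) \<le> local_norm f S * wnorm S"
  proof -
    have inv: "1 / p = 1" using 1 by simp
    have "(\<integral>\<^sup>+y. ennreal \<bar>f y * v y\<bar> * indicator S y \<partial>HL)
        \<le> (\<integral>\<^sup>+y. ennreal (\<bar>f y\<bar> powr p) * indicator S y \<partial>HL) * wnorm S"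
      using nn_integral_mono_AE[OF ae] by (simp add: nn_integral_multc)
    then show ?thesis unfolding local_norm_def inv enn_powr_one .
  qed
  also have "\<dots> \<le> 2 * (local_norm f S * wnorm S)"
    using mult_right_mono[of 1 2 "local_norm f S * wnorm S"] by simp
  finally show ?thesis .
next
  case 2
  have eq: "enn_powr (ennreal \<bar>g\<bar> * indicator S y) a = ennreal (\<bar>g\<bar> powr a) * indicator S y"
    if "a > 0" for g a y
    using that by (auto simp: enn_powr_ennreal split: split_indicator)
  have "(\<integral>\<^sup>+y. ennreal \<bar>f y * v y\<bar> * indicator S y \<partial>HL)
    = (\<integral>\<^sup>+y. enn_powr ((ennreal \<bar>f y\<bar> * indicator S y) * (ennreal \<bar>v y\<bar> * indicator S y)) 1 \<partial>HL)"
    by (intro nn_integral_cong) (auto simp: abs_mult ennreal_mult split: split_indicator)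
  also have "\<dots> \<le> 2 * (enn_powr (\<integral>\<^sup>+y. enn_powr (ennreal \<bar>f y\<bar> * indicator S y) p \<partial>HL) (1 / p)
     * enn_powr (\<integral>\<^sup>+y. enn_powr (ennreal \<bar>v y\<bar> * indicator S y) (conj_exp p) \<partial>HL) (1 / conj_exp p))"
    using 2 by (intro Holder_enn_powr) (auto simp: conj_exp_def)
  also have "(\<integral>\<^sup>+y. enn_powr (ennreal \<bar>f y\<bar> * indicator S y) p \<partial>HL)
     = (\<integral>\<^sup>+y. ennreal (\<bar>f y\<bar> powr p) * indicator S y \<partial>HL)"
    using 2 by (simp add: eq)
  also have "(\<integral>\<^sup>+y. enn_powr (ennreal \<bar>v y\<bar> * indicator S y) (conj_exp p) \<partial>HL)
     = (\<integral>\<^sup>+y. ennreal (v y powr conj_exp p) * indicator S y \<partial>HL)"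
    using conj_exp_gt_1[OF 2]
    by (intro nn_integral_cong) (auto simp: v_nonneg enn_powr_ennreal split: split_indicator)
  finally show ?thesis
    using 2 S by (simp add: local_norm_def wnorm_eq_integral)
qed

lemma nn_integral_local_norm_blk:
  assumes [measurable]: "f \<in> borel_measurable HL"
  shows "(ISUM k. enn_powr (local_norm f (blk k)) p) = pow_int p f"
  using p_ge_1 by (subst nn_integral_dyadic_blocks[of _ lam]) (simp_all add: local_norm_def enn_powr_powr)

text \<open>
  The operator applied to \<open>\<bar>f\<bar>\<close>, restricted to the blocks of index in \<open>Z\<close>. Unlike the operator itself it is always
  defined and monotone in \<open>x\<close>.
\<close>

definition Lmaj :: "int set \<Rightarrow> (real \<Rightarrow> real) \<Rightarrow> real \<Rightarrow> ennreal" where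
  "Lmaj Z f x = (\<integral>\<^sup>+y. ennreal (exp (- (x * y powr lam)) * \<bar>f y * v y\<bar>) * indicator (\<Union>k\<in>Z. blk k) y \<partial>HL)"

lemma Lmaj_antimono: "x \<le> x' \<Longrightarrow> Lmaj Z f x' \<le> Lmaj Z f x"
  unfolding Lmaj_def by (intro nn_integral_mono mult_right_mono ennreal_leI) (auto intro!: mult_right_mono)

lemma Lmaj_measurable [measurable]: "Lmaj Z f \<in> borel_measurable HL"
proof -
  have "mono (\<lambda>x. Lmaj Z f (- x))" by (auto intro!: monoI Lmaj_antimono)
  then have [measurable]: "(\<lambda>x. Lmaj Z f (- x)) \<in> borel_measurable borel"
    by (rule borel_measurable_mono_ennreal)
  have "(\<lambda>x. Lmaj Z f (- (- x))) \<in> borel_measurable HL"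
    by measurable
  then show ?thesis by simp
qed

lemma Lmaj_le_sum:
  assumes [measurable]: "f \<in> borel_measurable HL" and x: "2 powr (- real_of_int j) \<le> x"
  shows "Lmaj Z f x \<le> (ISUM k. ennreal (exp (- (2 powr (real_of_int (k - j))))) * (2 * (local_norm f (blk k) * wnorm (blk k) * indicator Z k)))"
proof -
  have "Lmaj Z f x = (ISUM k. (\<integral>\<^sup>+y. ennreal (exp (- (x * y powr lam)) * \<bar>f y * v y\<bar>) * indicator (\<Union>k\<in>Z. blk k) y * indicator (blk k) y \<partial>HL))"
    unfolding Lmaj_def by (intro nn_integral_dyadic_blocks) auto
  also have "\<dots> \<le> (ISUM k. ennreal (exp (- (2 powr (real_of_int (k - j))))) * (2 * (local_norm f (blk k) * wnorm (blk k) * indicator Z k)))"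
  proof (rule nn_integral_mono)
    fix k :: int
    have "(\<integral>\<^sup>+y. ennreal (exp (- (x * y powr lam)) * \<bar>f y * v y\<bar>) * indicator (\<Union>k\<in>Z. blk k) y * indicator (blk k) y \<partial>HL)
      \<le> (\<integral>\<^sup>+y. ennreal (exp (- (2 powr (real_of_int (k - j))))) * ((ennreal \<bar>f y * v y\<bar> * indicator (blk k) y) * indicator Z k) \<partial>HL)"
    proof (rule nn_integral_mono)
      fix y
      show "ennreal (exp (- (x * y powr lam)) * \<bar>f y * v y\<bar>) * indicator (\<Union>k\<in>Z. blk k) y * indicator (blk k) y
        \<le> ennreal (exp (- (2 powr (real_of_int (k - j))))) * ((ennreal \<bar>f y * v y\<bar> * indicator (blk k) y) * indicator Z k)"
      proof (cases "y \<in> blk k \<and> k \<in> Z")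
        case True
        then have "2 powr k \<le> y powr lam" by (simp add: mem_dyadic_block_iff)
        then have "2 powr (- real_of_int j) * 2 powr k \<le> x * y powr lam"
          using x by (intro mult_mono) (auto intro: order_trans[of 0 "2 powr (- real_of_int j)" x])
        then have "2 powr (real_of_int (k - j)) \<le> x * y powr lam"
          by (simp add: powr_add[symmetric])
        then have "exp (- (x * y powr lam)) * \<bar>f y * v y\<bar> \<le> exp (- (2 powr (real_of_int (k - j)))) * \<bar>f y * v y\<bar>"
          by (intro mult_right_mono) auto
        moreover have "y \<in> (\<Union>k\<in>Z. blk k)" using True by blast
        ultimately show ?thesis using True
          by (simp add: ennreal_leI flip: ennreal_mult)
      next
        case False
        then show ?thesis by (auto simp: dyadic_block_def split: split_indicator)
      qed
    qed
    also have "\<dots> = ennreal (exp (- (2 powr (real_of_int (k - j))))) * ((\<integral>\<^sup>+y. ennreal \<bar>f y * v y\<bar> * indicator (blk k) y \<partial>HL) * indicator Z k)"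
      by (simp add: nn_integral_cmult nn_integral_multc)
    also have "\<dots> \<le> ennreal (exp (- (2 powr (real_of_int (k - j))))) * ((2 * (local_norm f (blk k) * wnorm (blk k))) * indicator Z k)"
      by (intro mult_left_mono mult_right_mono Holder_wnorm) auto
    finally show "(\<integral>\<^sup>+y. ennreal (exp (- (x * y powr lam)) * \<bar>f y * v y\<bar>) * indicator (\<Union>k\<in>Z. blk k) y * indicator (blk k) y \<partial>HL)
      \<le> ennreal (exp (- (2 powr (real_of_int (k - j))))) * (2 * (local_norm f (blk k) * wnorm (blk k) * indicator Z k))"
      by (simp add: mult_ac)
  qed
  finally show ?thesis .
qed

lemma emeasure_dyadic_block_1: "emeasure HL (dyadic_block 1 j) = ennreal (2 powr j)"
proof -
  have "dyadic_block 1 j = {2 powr j..<2 powr (real_of_int j + 1)}"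
  proof -
    have "0 < x" if "2 powr j \<le> x" for x by (rule less_le_trans[OF _ that]) simp
    then show ?thesis by (force simp: mem_dyadic_block_iff)
  qed
  moreover have "emeasure HL {2 powr j..<2 powr (real_of_int j + 1)} = emeasure lborel {2 powr j..<2 powr (real_of_int j + 1)}"
    by (subst emeasure_restrict_space) (auto intro: order_trans[of 0 "2 powr _"])
  ultimately show ?thesis by (simp add: powr_add)
qed

text \<open>
  The basic estimate. For \<open>x\<close> about \<open>2\<^bsup>-j\<^esup>\<close>, \<open>Lmaj_le_sum\<close> bounds the majorant by a sum over \<open>k\<close> with weights
  \<open>exp (-2\<^bsup>k-j\<^esup>)\<close>. After multiplication by \<open>2\<^bsup>-j/q\<^esup>\<close>, the \<open>q\<close>-th root of the length of the \<open>x\<close>-block, this is a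
  convolution in \<open>k - j\<close> of \<open>local_norm f (blk k) * bconst k\<close> with \<open>2\<^bsup>m/q\<^esup> exp (-2\<^sup>m)\<close>, a kernel of geometric decay.
\<close>

lemma Lmaj_estimate:
  obtains K where "K < top" "\<And>(f :: real \<Rightarrow> real) Z. f \<in> borel_measurable HL \<Longrightarrow>
    (\<integral>\<^sup>+x. enn_powr (Lmaj Z f x) q \<partial>HL)
      \<le> K * (ISUM k. enn_powr (local_norm f (blk k) * bconst k * indicator Z k) q)"
proof -
  have q1: "1 / q > 0" using q_pos by simp
  obtain C where C: "C > 0"
    "\<And>m :: int. 2 powr (1 / q * m) * exp (- (2 powr m)) \<le> C * 2 powr (- (1 / q) * \<bar>real_of_int m\<bar>)"
    using exp_kernel_le_geometric[OF q1] by blast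
  obtain K0 where K0: "K0 < top" "\<And>b :: int \<Rightarrow> ennreal.
    (ISUM j. enn_powr (ISUM k. geom (1 / q) (k - j) * b k) q)
      \<le> K0 * (ISUM k. enn_powr (b k) q)"
    using convolution_geometric[OF q1 q_pos] by blast
  show ?thesis
  proof (rule that)
    show "K0 * ennreal ((2 * C) powr q) < top"
      using K0 by (simp add: ennreal_mult_less_top)
    fix f :: "real \<Rightarrow> real" and Z assume f[measurable]: "f \<in> borel_measurable HL"
    define b where "b = (\<lambda>k. 2 * (local_norm f (blk k) * wnorm (blk k) * indicator Z k))"
    have "(\<integral>\<^sup>+x. enn_powr (Lmaj Z f x) q \<partial>HL)
      = (ISUM j. (\<integral>\<^sup>+x. enn_powr (Lmaj Z f x) q * indicator (dyadic_block 1 j) x \<partial>HL))"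
      by (intro nn_integral_dyadic_blocks) auto
    also have "\<dots> = (ISUM j. (\<integral>\<^sup>+x. enn_powr (Lmaj Z f x) q * indicator (dyadic_block 1 (- j)) x \<partial>HL))"
      by (rule nn_integral_bij_count_space[symmetric]) (rule bij_betwI[where g="\<lambda>m. - m"], auto)
    also have "\<dots> \<le> (ISUM j. enn_powr (ISUM k. geom (1 / q) (k - j) * (ennreal (C * 2 powr (- real_of_int k / q)) * b k)) q)"
    proof (rule nn_integral_mono)
      fix j :: int
      define B where "B = (ISUM k. ennreal (exp (- (2 powr (real_of_int (k - j))))) * b k)"
      have "(\<integral>\<^sup>+x. enn_powr (Lmaj Z f x) q * indicator (dyadic_block 1 (- j)) x \<partial>HL)
        \<le> (\<integral>\<^sup>+x. enn_powr B q * indicator (dyadic_block 1 (- j)) x \<partial>HL)"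
      proof (rule nn_integral_mono)
        fix x
        show "enn_powr (Lmaj Z f x) q * indicator (dyadic_block 1 (- j)) x \<le> enn_powr B q * indicator (dyadic_block 1 (- j)) x"
          using Lmaj_le_sum[OF f, of j x Z] q_pos
          by (auto simp: B_def b_def mem_dyadic_block_iff intro!: enn_powr_mono split: split_indicator)
      qed
      also have "\<dots> = enn_powr B q * emeasure HL (dyadic_block 1 (- j))"
        by (simp add: nn_integral_cmult)
      also have "\<dots> = enn_powr B q * ennreal (2 powr (- real_of_int j))"
        by (simp add: emeasure_dyadic_block_1)
      also have "ennreal (2 powr (- real_of_int j)) = enn_powr (ennreal (2 powr (- real_of_int j / q))) q"
        using q_pos by (simp add: enn_powr_ennreal powr_powr)
      also have "enn_powr B q * \<dots> = enn_powr (ennreal (2 powr (- real_of_int j / q)) * B) q"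
        using q_pos by (simp add: enn_powr_mult mult.commute)
      also have "ennreal (2 powr (- real_of_int j / q)) * B = (ISUM k. ennreal (2 powr (- real_of_int j / q)) * (ennreal (exp (- (2 powr (real_of_int (k - j))))) * b k))"
        by (simp add: B_def nn_integral_cmult)
      also have "enn_powr \<dots> q \<le> enn_powr (ISUM k. geom (1 / q) (k - j) * (ennreal (C * 2 powr (- real_of_int k / q)) * b k)) q"
      proof (intro enn_powr_mono nn_integral_mono q_pos)
        fix k :: int
        have "2 powr (- real_of_int j / q) * exp (- (2 powr (real_of_int (k - j)))) = 2 powr (- real_of_int k / q) * (2 powr (1 / q * real_of_int (k - j)) * exp (- (2 powr (real_of_int (k - j)))))"
        proof -
          have "- real_of_int j / q = - real_of_int k / q + 1 / q * real_of_int (k - j)" by (simp add: diff_divide_distrib)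
          then have "2 powr (- real_of_int j / q) = 2 powr (- real_of_int k / q) * 2 powr (1 / q * real_of_int (k - j))"
            by (simp only: powr_add)
          then show ?thesis by (simp only: mult.assoc)
        qed
        also have "\<dots> \<le> 2 powr (- real_of_int k / q) * (C * 2 powr (- (1 / q) * \<bar>real_of_int (k - j)\<bar>))"
          using C(2)[of "k - j"] by (intro mult_left_mono) auto
        finally have le: "2 powr (- real_of_int j / q) * exp (- (2 powr (real_of_int (k - j)))) \<le> 2 powr (- (1 / q) * \<bar>real_of_int (k - j)\<bar>) * (C * 2 powr (- real_of_int k / q))"
          by (simp add: mult_ac)
        have "ennreal (2 powr (- real_of_int j / q) * exp (- (2 powr (real_of_int (k - j))))) * b k \<le> ennreal (2 powr (- (1 / q) * \<bar>real_of_int (k - j)\<bar>) * (C * 2 powr (- real_of_int k / q))) * b k"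
          by (intro mult_right_mono ennreal_leI le) auto
        then show "ennreal (2 powr (- real_of_int j / q)) * (ennreal (exp (- (2 powr (real_of_int (k - j))))) * b k)
          \<le> geom (1 / q) (k - j) * (ennreal (C * 2 powr (- real_of_int k / q)) * b k)"
          using C(1) by (simp add: ennreal_mult mult.assoc)
      qed
      finally show "(\<integral>\<^sup>+x. enn_powr (Lmaj Z f x) q * indicator (dyadic_block 1 (- j)) x \<partial>HL)
        \<le> enn_powr (ISUM k. geom (1 / q) (k - j) * (ennreal (C * 2 powr (- real_of_int k / q)) * b k)) q" .
    qed
    also have "\<dots> \<le> K0 * (ISUM k. enn_powr (ennreal (C * 2 powr (- real_of_int k / q)) * b k) q)"
      by (rule K0(2))
    also have "\<dots> = K0 * (ISUM k. ennreal ((2 * C) powr q) * enn_powr (local_norm f (blk k) * bconst k * indicator Z k) q)"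
    proof -
      have "ennreal (C * 2 powr (- real_of_int k / q)) * b k = ennreal (2 * C) * (local_norm f (blk k) * bconst k * indicator Z k)" for k
        using C(1) by (simp add: b_def bconst_def ennreal_mult mult_ac)
      then show ?thesis using q_pos C(1) by (simp add: enn_powr_mult[of q "ennreal (2 * C)"] enn_powr_ennreal)
    qed
    also have "\<dots> = K0 * ennreal ((2 * C) powr q) * (ISUM k. enn_powr (local_norm f (blk k) * bconst k * indicator Z k) q)"
      by (simp add: nn_integral_cmult mult.assoc)
    finally show "(\<integral>\<^sup>+x. enn_powr (Lmaj Z f x) q \<partial>HL)
      \<le> K0 * ennreal ((2 * C) powr q) * (ISUM k. enn_powr (local_norm f (blk k) * bconst k * indicator Z k) q)" .
  qed
qed

end

section \<open>Convergence in \<open>L\<^sup>q\<close> from truncations\<close>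

lemma abs_powr_add_le:
  fixes a b q :: real
  assumes "q > 0"
  shows "ennreal (\<bar>a + b\<bar> powr q) \<le> ennreal (2 powr q) * (ennreal (\<bar>a\<bar> powr q) + ennreal (\<bar>b\<bar> powr q))"
proof -
  have "ennreal (\<bar>a + b\<bar> powr q) \<le> enn_powr (ennreal \<bar>a\<bar> + ennreal \<bar>b\<bar>) q"
    using assms by (simp add: enn_powr_ennreal powr_mono2 flip: ennreal_plus)
  also have "\<dots> \<le> ennreal (2 powr q) * (ennreal (\<bar>a\<bar> powr q) + ennreal (\<bar>b\<bar> powr q))"
    using enn_powr_sum_le[OF assms, of "ennreal \<bar>a\<bar>" "ennreal \<bar>b\<bar>"] assms by (simp add: enn_powr_ennreal)
  finally show ?thesis .
qed

lemma Fatou_AE_bound: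
  fixes u :: "nat \<Rightarrow> 'a \<Rightarrow> ennreal"
  assumes [measurable]: "\<And>n. u n \<in> borel_measurable M" "u' \<in> borel_measurable M"
    and lim: "AE x in M. (\<lambda>n. u n x) \<longlonglongrightarrow> u' x" and bound: "\<And>n. (\<integral>\<^sup>+x. u n x \<partial>M) \<le> C"
  shows "(\<integral>\<^sup>+x. u' x \<partial>M) \<le> C"
proof -
  have "AE x in M. u' x = liminf (\<lambda>n. u n x)"
    using lim by eventually_elim (metis lim_imp_Liminf sequentially_bot)
  then have "(\<integral>\<^sup>+x. u' x \<partial>M) = (\<integral>\<^sup>+x. liminf (\<lambda>n. u n x) \<partial>M)"
    by (rule nn_integral_cong_AE)
  also have "\<dots> \<le> liminf (\<lambda>n. \<integral>\<^sup>+x. u n x \<partial>M)"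
    by (rule nn_integral_liminf) simp
  also have "\<dots> \<le> C"
    by (rule Liminf_le) (auto intro!: always_eventually bound)
  finally show ?thesis .
qed

lemma tendsto_zero_ennreal_iterated:
  fixes F :: "nat \<Rightarrow> ennreal"
  assumes le: "\<And>N n. F n \<le> a N + B N n" and a: "a \<longlonglongrightarrow> 0" and B: "\<And>N. B N \<longlonglongrightarrow> 0"
  shows "F \<longlonglongrightarrow> 0"
proof (rule order_tendstoI)
  fix e :: ennreal assume "0 < e"
  from order_tendstoD(2)[OF a this] obtain N where N: "a N < e"
    by (auto simp: eventually_sequentially)
  have "(\<lambda>n. a N + B N n) \<longlonglongrightarrow> a N + 0"
    by (intro tendsto_add tendsto_const B)
  with N have "\<forall>\<^sub>F n in sequentially. a N + B N n < e"
    by (intro order_tendstoD(2)) auto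
  then show "\<forall>\<^sub>F n in sequentially. F n < e"
    by eventually_elim (use le[of _ N] in \<open>auto intro: le_less_trans\<close>)
qed simp

lemma tendsto_abs_powr:
  fixes f :: "'a \<Rightarrow> real"
  assumes "(f \<longlongrightarrow> l) F" "q > 0"
  shows "((\<lambda>n. ennreal (\<bar>f n\<bar> powr q)) \<longlongrightarrow> ennreal (\<bar>l\<bar> powr q)) F"
  using assms by (intro tendsto_ennrealI tendsto_powr2 tendsto_rabs) auto

text \<open>
  A sequence converges in \<open>L\<^sup>q\<close>, also for \<open>q < 1\<close>, if it is uniformly close to truncations that converge
  pointwise under a dominating function. The pointwise limit is built from the pointwise closeness \<open>unif\<close>,
  and its distance to the truncated limits is controlled by Fatou's lemma.
\<close>

lemma convergence_from_truncations:
  fixes h :: "nat \<Rightarrow> 'a \<Rightarrow> real" and hN :: "nat \<Rightarrow> nat \<Rightarrow> 'a \<Rightarrow> real" and D :: "nat \<Rightarrow> 'a \<Rightarrow> real"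
  assumes q: "q > 0"
    and [measurable]: "\<And>n. h n \<in> borel_measurable M" "\<And>N n. hN N n \<in> borel_measurable M" "\<And>N. D N \<in> borel_measurable M"
    and conv: "\<And>N. AE x in M. convergent (\<lambda>n. hN N n x)"
    and dom: "\<And>N n. AE x in M. \<bar>hN N n x\<bar> \<le> D N x" "\<And>N. (\<integral>\<^sup>+x. ennreal (D N x powr q) \<partial>M) < top"
    and unif: "AE x in M. \<exists>d. d \<longlonglongrightarrow> 0 \<and> (\<forall>N n. ennreal \<bar>h n x - hN N n x\<bar> \<le> d N)"
    and tail: "\<And>N n. (\<integral>\<^sup>+x. ennreal (\<bar>h n x - hN N n x\<bar> powr q) \<partial>M) \<le> eps N" "eps \<longlonglongrightarrow> 0"
    and bound: "\<And>n. (\<integral>\<^sup>+x. ennreal (\<bar>h n x\<bar> powr q) \<partial>M) \<le> C" "C < top"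
  obtains g where "g \<in> borel_measurable M" "(\<integral>\<^sup>+x. ennreal (\<bar>g x\<bar> powr q) \<partial>M) < top"
    "(\<lambda>n. \<integral>\<^sup>+x. ennreal (\<bar>h n x - g x\<bar> powr q) \<partial>M) \<longlonglongrightarrow> 0"
proof -
  define g where "g = (\<lambda>x. lim (\<lambda>n. h n x))"
  define gN where "gN = (\<lambda>N x. lim (\<lambda>n. hN N n x))"
  have [measurable]: "g \<in> borel_measurable M" "gN N \<in> borel_measurable M" for N
    unfolding g_def gN_def by (rule borel_measurable_lim_metric; simp)+
  have limN: "AE x in M. (\<lambda>n. hN N n x) \<longlonglongrightarrow> gN N x" for N
    using conv[of N] by eventually_elim (simp add: gN_def convergent_LIMSEQ_iff)
  have lim: "AE x in M. (\<lambda>n. h n x) \<longlonglongrightarrow> g x"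
  proof -
    have "AE x in M. \<forall>N. convergent (\<lambda>n. hN N n x)"
      using conv by (simp add: AE_all_countable)
    with unif show ?thesis
    proof eventually_elim
      fix x assume "\<exists>d. d \<longlonglongrightarrow> 0 \<and> (\<forall>N n. ennreal \<bar>h n x - hN N n x\<bar> \<le> d N)"
        and cv: "\<forall>N. convergent (\<lambda>n. hN N n x)"
      then obtain d where d: "d \<longlonglongrightarrow> 0" "\<And>N n. ennreal \<bar>h n x - hN N n x\<bar> \<le> d N" by blast
      have "Cauchy (\<lambda>n. h n x)"
      proof (rule metric_CauchyI)
        fix e :: real assume "0 < e"
        then have "0 < ennreal (e / 3)" by simp
        from order_tendstoD(2)[OF d(1) this] obtain N where N: "d N < ennreal (e / 3)"
          by (auto simp: eventually_sequentially)
        have close: "\<bar>h n x - hN N n x\<bar> < e / 3" for n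
          using le_less_trans[OF d(2) N, of n] by (simp add: ennreal_less_iff)
        have "Cauchy (\<lambda>n. hN N n x)" using cv by (simp add: Cauchy_convergent_iff)
        then obtain k where k: "\<And>m n. m \<ge> k \<Longrightarrow> n \<ge> k \<Longrightarrow> dist (hN N m x) (hN N n x) < e / 3"
          using \<open>0 < e\<close> by (metis Cauchy_def divide_pos_pos zero_less_numeral)
        have "dist (h m x) (h n x) < e" if "m \<ge> k" "n \<ge> k" for m n
          using k[OF that] close[of m] close[of n] unfolding dist_real_def by linarith
        then show "\<exists>k. \<forall>m\<ge>k. \<forall>n\<ge>k. dist (h m x) (h n x) < e" by blast
      qed
      then show "(\<lambda>n. h n x) \<longlonglongrightarrow> g x"
        by (simp add: g_def Cauchy_convergent_iff convergent_LIMSEQ_iff)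
    qed
  qed
  have gb: "(\<integral>\<^sup>+x. ennreal (\<bar>g x\<bar> powr q) \<partial>M) \<le> C"
  proof (rule Fatou_AE_bound[where u="\<lambda>n x. ennreal (\<bar>h n x\<bar> powr q)"])
    show "AE x in M. (\<lambda>n. ennreal (\<bar>h n x\<bar> powr q)) \<longlonglongrightarrow> ennreal (\<bar>g x\<bar> powr q)"
      using lim by eventually_elim (rule tendsto_abs_powr[OF _ q])
  qed (use bound in auto)
  have gt: "(\<integral>\<^sup>+x. ennreal (\<bar>gN N x - g x\<bar> powr q) \<partial>M) \<le> eps N" for N
  proof (rule Fatou_AE_bound[where u="\<lambda>n x. ennreal (\<bar>h n x - hN N n x\<bar> powr q)"])
    show "AE x in M. (\<lambda>n. ennreal (\<bar>h n x - hN N n x\<bar> powr q)) \<longlonglongrightarrow> ennreal (\<bar>gN N x - g x\<bar> powr q)"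
      using lim limN[of N]
      by eventually_elim (subst abs_minus_commute, intro tendsto_abs_powr tendsto_diff q)
  qed (use tail in auto)
  have mid: "(\<lambda>n. \<integral>\<^sup>+x. ennreal (\<bar>hN N n x - gN N x\<bar> powr q) \<partial>M) \<longlonglongrightarrow> 0" for N
  proof -
    have "(\<lambda>n. \<integral>\<^sup>+x. ennreal (\<bar>hN N n x - gN N x\<bar> powr q) \<partial>M) \<longlonglongrightarrow> (\<integral>\<^sup>+x. 0 \<partial>M)"
    proof (rule nn_integral_dominated_convergence[where w="\<lambda>x. ennreal (2 powr q) * ennreal (D N x powr q)"])
      show "(\<integral>\<^sup>+x. ennreal (2 powr q) * ennreal (D N x powr q) \<partial>M) < \<infinity>"
        using dom(2)[of N] by (simp add: nn_integral_cmult ennreal_mult_less_top)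
      show "AE x in M. (\<lambda>n. ennreal (\<bar>hN N n x - gN N x\<bar> powr q)) \<longlonglongrightarrow> 0"
        using limN[of N]
      proof eventually_elim
        fix x assume "(\<lambda>n. hN N n x) \<longlonglongrightarrow> gN N x"
        then have "(\<lambda>n. hN N n x - gN N x) \<longlonglongrightarrow> 0" by (simp add: LIM_zero)
        from tendsto_abs_powr[OF this q] show "(\<lambda>n. ennreal (\<bar>hN N n x - gN N x\<bar> powr q)) \<longlonglongrightarrow> 0"
          using q by simp
      qed
      fix n
      have "AE x in M. \<forall>n. \<bar>hN N n x\<bar> \<le> D N x" using dom(1) by (simp add: AE_all_countable)
      with limN[of N] show "AE x in M. ennreal (\<bar>hN N n x - gN N x\<bar> powr q) \<le> ennreal (2 powr q) * ennreal (D N x powr q)"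
      proof eventually_elim
        fix x assume "(\<lambda>n. hN N n x) \<longlonglongrightarrow> gN N x" and *: "\<forall>n. \<bar>hN N n x\<bar> \<le> D N x"
        then have "\<bar>gN N x\<bar> \<le> D N x"
          by (intro tendsto_upperbound[OF tendsto_rabs]) auto
        with *[rule_format, of n] have "\<bar>hN N n x - gN N x\<bar> \<le> 2 * D N x"
          by linarith
        then have "\<bar>hN N n x - gN N x\<bar> powr q \<le> (2 * D N x) powr q"
          using q by (intro powr_mono2) auto
        then show "ennreal (\<bar>hN N n x - gN N x\<bar> powr q) \<le> ennreal (2 powr q) * ennreal (D N x powr q)"
          by (simp add: powr_mult ennreal_leI flip: ennreal_mult)
      qed
    qed auto
    then show ?thesis by simp
  qed
  define K where "K = ennreal (2 powr q)"
  have "(\<lambda>n. \<integral>\<^sup>+x. ennreal (\<bar>h n x - g x\<bar> powr q) \<partial>M) \<longlonglongrightarrow> 0"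
  proof (rule tendsto_zero_ennreal_iterated)
    show "(\<lambda>N. (K + K * K) * eps N) \<longlonglongrightarrow> 0"
      using ennreal_tendsto_cmult[OF _ tail(2), of "K + K * K"] by (simp add: K_def ennreal_mult_less_top)
    show "(\<lambda>n. K * K * (\<integral>\<^sup>+x. ennreal (\<bar>hN N n x - gN N x\<bar> powr q) \<partial>M)) \<longlonglongrightarrow> 0" for N
      using ennreal_tendsto_cmult[OF _ mid, of "K * K" N] by (simp add: K_def ennreal_mult_less_top)
    fix N n
    have "(\<integral>\<^sup>+x. ennreal (\<bar>h n x - g x\<bar> powr q) \<partial>M)
      \<le> (\<integral>\<^sup>+x. K * (ennreal (\<bar>h n x - hN N n x\<bar> powr q)
          + K * (ennreal (\<bar>hN N n x - gN N x\<bar> powr q) + ennreal (\<bar>gN N x - g x\<bar> powr q))) \<partial>M)"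
    proof (rule nn_integral_mono)
      fix x
      have "ennreal (\<bar>h n x - g x\<bar> powr q) \<le> K * (ennreal (\<bar>h n x - hN N n x\<bar> powr q) + ennreal (\<bar>hN N n x - g x\<bar> powr q))"
        using abs_powr_add_le[OF q, of "h n x - hN N n x" "hN N n x - g x"] by (simp add: K_def)
      also have "\<dots> \<le> K * (ennreal (\<bar>h n x - hN N n x\<bar> powr q)
          + K * (ennreal (\<bar>hN N n x - gN N x\<bar> powr q) + ennreal (\<bar>gN N x - g x\<bar> powr q)))"
        using abs_powr_add_le[OF q, of "hN N n x - gN N x" "gN N x - g x"]
        by (intro mult_left_mono add_left_mono) (simp_all add: K_def)
      finally show "ennreal (\<bar>h n x - g x\<bar> powr q) \<le> K * (ennreal (\<bar>h n x - hN N n x\<bar> powr q)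
          + K * (ennreal (\<bar>hN N n x - gN N x\<bar> powr q) + ennreal (\<bar>gN N x - g x\<bar> powr q)))" .
    qed
    also have "\<dots> = K * ((\<integral>\<^sup>+x. ennreal (\<bar>h n x - hN N n x\<bar> powr q) \<partial>M)
          + K * ((\<integral>\<^sup>+x. ennreal (\<bar>hN N n x - gN N x\<bar> powr q) \<partial>M) + (\<integral>\<^sup>+x. ennreal (\<bar>gN N x - g x\<bar> powr q) \<partial>M)))"
      by (simp add: nn_integral_cmult nn_integral_add)
    also have "\<dots> \<le> K * (eps N + K * ((\<integral>\<^sup>+x. ennreal (\<bar>hN N n x - gN N x\<bar> powr q) \<partial>M) + eps N))"
      by (intro mult_left_mono add_mono tail gt order_refl) auto
    also have "\<dots> = (K + K * K) * eps N + K * K * (\<integral>\<^sup>+x. ennreal (\<bar>hN N n x - gN N x\<bar> powr q) \<partial>M)"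
      by (simp add: algebra_simps)
    finally show "(\<integral>\<^sup>+x. ennreal (\<bar>h n x - g x\<bar> powr q) \<partial>M)
      \<le> (K + K * K) * eps N + K * K * (\<integral>\<^sup>+x. ennreal (\<bar>hN N n x - gN N x\<bar> powr q) \<partial>M)" .
  qed
  with gb bound(2) show ?thesis by (intro that[of g]) (auto intro: le_less_trans)
qed

lemma nn_integral_exp_halfline:
  assumes "b > 0"
  shows "(\<integral>\<^sup>+x. ennreal (exp (- (x * b))) \<partial>lebesgue_on {0..}) = ennreal (1 / b)"
proof -
  have "(\<integral>\<^sup>+x. ennreal (exp (- (x * b))) \<partial>lebesgue_on {0..}) = (\<integral>\<^sup>+x. ennreal (exp (- (x * b))) * indicator {0..} x \<partial>lborel)"
    by (simp add: nn_integral_restrict_space nn_integral_completion)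
  also have "\<dots> = ennreal (0 - (- exp (- (0 * b)) / b))"
  proof (rule nn_integral_FTC_atLeast)
    show "((\<lambda>x. - exp (- (x * b)) / b) has_real_derivative exp (- (x * b))) (at x)" for x
      using assms by (auto intro!: derivative_eq_intros)
    have lim: "LIM x at_top. x * b :> at_top"
      by (subst mult.commute) (rule filterlim_tendsto_pos_mult_at_top[OF tendsto_const assms filterlim_ident])
    have "((\<lambda>x. - exp (- (x * b)) / b) \<longlongrightarrow> - 0 / b) at_top"
      using assms lim
      by (intro tendsto_intros filterlim_compose[OF exp_at_bot]) (auto simp: filterlim_uminus_at_bot)
    then show "((\<lambda>x. - exp (- (x * b)) / b) \<longlongrightarrow> 0) at_top" by simp
  qed auto
  finally show ?thesis by simp
qed

section \<open>Truncated operators\<close>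

text \<open>
  Lipschitz continuity of \<open>e\<^bsup>-a\<^esup>\<close> on the half-line, used for equicontinuity in \<open>x\<close> of the truncated operators.
\<close>

lemma abs_exp_minus_diff_le:
  fixes a b :: real
  assumes "a \<ge> 0" "b \<ge> 0" shows "\<bar>exp (- a) - exp (- b)\<bar> \<le> \<bar>a - b\<bar>"
proof -
  have *: "exp (- x) - exp (- y) \<le> y - x" if "0 \<le> x" "x \<le> y" for x y :: real
  proof -
    have "exp (- x) * (1 - exp (- (y - x))) \<le> 1 * (y - x)"
      using that exp_ge_add_one_self[of "- (y - x)"] by (intro mult_mono) (auto simp del: minus_diff_eq)
    then show ?thesis by (simp add: algebra_simps flip: exp_add)
  qed
  show ?thesis
    using *[of a b] *[of b a] assms by (cases "a \<le> b") (auto simp: abs_if)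
qed

lemma emeasure_halfline_Icc: "0 \<le> a \<Longrightarrow> a \<le> b \<Longrightarrow> emeasure (lebesgue_on {0::real..}) {a..b} = ennreal (b - a)"
  by (subst emeasure_restrict_space) auto

context laplace_weight
begin

text \<open>
  \<open>Lmid N\<close> is the operator with the integral restricted to the finitely many blocks of index \<open>\<bar>k\<bar> < N\<close>. It is
  compact for every weight under consideration, and what is cut off is bounded by \<open>Lmaj (tail_indices N)\<close>.
\<close>

definition tail_indices :: "nat \<Rightarrow> int set" where "tail_indices N = {k. int N \<le> \<bar>k\<bar>}"
definition mid_set :: "nat \<Rightarrow> real set" where "mid_set N = (\<Union>k\<in>- tail_indices N. blk k)"
definition Lmid :: "nat \<Rightarrow> (real \<Rightarrow> real) \<Rightarrow> real \<Rightarrow> real" where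
  "Lmid N f x = (\<integral>y. laplace_integrand lam v f x y * indicator (mid_set N) y \<partial>HL)"

lemma indicator_blocks: "0 < y \<Longrightarrow> indicator (\<Union>k\<in>Z. blk k) y = indicator Z \<lfloor>lam * log 2 y\<rfloor>"
  by (auto simp: dyadic_block_def split: split_indicator)

lemma sets_blocks [measurable]: "(\<Union>k\<in>Z. blk k) \<in> sets HL"
  by (intro sets.countable_UN') auto

lemma sets_mid_set [measurable]: "mid_set N \<in> sets HL"
  unfolding mid_set_def by (rule sets_blocks)

lemma mem_mid_setD:
  assumes "y \<in> mid_set N"
  shows "0 < y" "2 powr - real N \<le> y powr lam" "y powr lam \<le> 2 powr real N"
proof -
  obtain k where "y \<in> blk k" "k \<in> - tail_indices N"
    using assms unfolding mid_set_def by blast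
  then have k: "y \<in> blk k" "\<bar>k\<bar> < int N" by (auto simp: tail_indices_def)
  then have y: "0 < y" "2 powr k \<le> y powr lam" "y powr lam < 2 powr (k + 1)"
    by (auto simp: mem_dyadic_block_iff)
  have "2 powr - real N \<le> 2 powr k" "2 powr (k + 1) \<le> 2 powr real N"
    using k by (auto intro!: powr_mono)
  with y show "0 < y" "2 powr - real N \<le> y powr lam" "y powr lam \<le> 2 powr real N" by linarith+
qed

lemma wnorm_mid_set_finite: "wnorm (mid_set N) < top"
proof (rule wnorm_finite[OF sets_mid_set])
  show "mid_set N \<subseteq> {0..2 powr (real N / lam)}"
  proof
    fix y assume y: "y \<in> mid_set N"
    have "(y powr lam) powr (1 / lam) \<le> (2 powr real N) powr (1 / lam)"
      using mem_mid_setD[OF y] lam_pos by (intro powr_mono2) auto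
    then show "y \<in> {0..2 powr (real N / lam)}"
      using mem_mid_setD[OF y] lam_pos by (simp add: powr_powr)
  qed
qed

text \<open>
  Since the majorant decreases in \<open>x\<close>, its value at \<open>x\<close> is bounded by its average over \<open>[0,x]\<close>. An \<open>L\<^sup>q\<close> bound thus
  becomes a pointwise bound, uniform in \<open>f\<close>; it also yields convergence of the integral for each \<open>x > 0\<close>.
\<close>

lemma Lmaj_pointwise:
  assumes x: "0 < x"
  shows "ennreal x * enn_powr (Lmaj Z f x) q \<le> (\<integral>\<^sup>+x. enn_powr (Lmaj Z f x) q \<partial>HL)"
proof -
  have [measurable]: "{0..x} \<in> sets HL" by (rule sets_halfline_borel) auto
  have "ennreal x * enn_powr (Lmaj Z f x) q = (\<integral>\<^sup>+x'. enn_powr (Lmaj Z f x) q * indicator {0..x} x' \<partial>HL)"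
    using x by (simp add: nn_integral_cmult emeasure_halfline_Icc mult.commute[of "ennreal x"])
  also have "\<dots> \<le> (\<integral>\<^sup>+x. enn_powr (Lmaj Z f x) q \<partial>HL)"
    using q_pos by (intro nn_integral_mono) (auto intro!: enn_powr_mono Lmaj_antimono split: split_indicator)
  finally show ?thesis .
qed

lemma laplace_integrand_pair_measurable:
  assumes [measurable]: "f \<in> borel_measurable HL"
  shows "case_prod (laplace_integrand lam v f) \<in> borel_measurable (HL \<Otimes>\<^sub>M HL)"
proof -
  have [measurable]: "(\<lambda>z. fst z) \<in> borel_measurable (HL \<Otimes>\<^sub>M HL)" "(\<lambda>z. snd z) \<in> borel_measurable (HL \<Otimes>\<^sub>M HL)"
    using measurable_compose[OF measurable_fst measurable_halfline_id]
      measurable_compose[OF measurable_snd measurable_halfline_id] by auto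
  have [measurable]: "(\<lambda>z. f (snd z)) \<in> borel_measurable (HL \<Otimes>\<^sub>M HL)" "(\<lambda>z. v (snd z)) \<in> borel_measurable (HL \<Otimes>\<^sub>M HL)"
    using measurable_compose[OF measurable_snd assms] measurable_compose[OF measurable_snd v_measurable] by auto
  show ?thesis
    unfolding laplace_integrand_def case_prod_beta by measurable
qed

lemma laplace_op_measurable:
  assumes [measurable]: "f \<in> borel_measurable HL"
  shows "laplace_op lam v f \<in> borel_measurable HL"
  unfolding laplace_op_def[abs_def]
  by (rule sigma_finite_measure.borel_measurable_lebesgue_integral[OF sigma_finite_halfline
        laplace_integrand_pair_measurable[OF assms]])

lemma Lmid_measurable:
  assumes [measurable]: "f \<in> borel_measurable HL"
  shows "Lmid N f \<in> borel_measurable HL"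
proof -
  have [measurable]: "case_prod (laplace_integrand lam v f) \<in> borel_measurable (HL \<Otimes>\<^sub>M HL)"
    by (rule laplace_integrand_pair_measurable) fact
  have [measurable]: "(\<lambda>z. indicator (mid_set N) (snd z) :: real) \<in> borel_measurable (HL \<Otimes>\<^sub>M HL)"
    by (rule measurable_compose[OF measurable_snd]) simp
  have "case_prod (\<lambda>x y. laplace_integrand lam v f x y * indicator (mid_set N) y) \<in> borel_measurable (HL \<Otimes>\<^sub>M HL)"
    unfolding case_prod_beta
    by (intro borel_measurable_times) (auto simp flip: case_prod_beta)
  then show ?thesis
    unfolding Lmid_def[abs_def]
    by (rule sigma_finite_measure.borel_measurable_lebesgue_integral[OF sigma_finite_halfline])
qed

lemma laplace_integrand_measurable [measurable]:
  assumes [measurable]: "f \<in> borel_measurable HL"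
  shows "laplace_integrand lam v f x \<in> borel_measurable HL"
  unfolding laplace_integrand_def[abs_def] by measurable

lemma laplace_integrand_integrable:
  assumes [measurable]: "f \<in> borel_measurable HL" and fin: "Lmaj UNIV f x < top"
  shows "integrable HL (laplace_integrand lam v f x)"
proof (rule integrableI_bounded)
  have "AE y in HL. ennreal (norm (laplace_integrand lam v f x y))
      = ennreal (exp (- (x * y powr lam)) * \<bar>f y * v y\<bar>) * indicator (\<Union>k\<in>UNIV. blk k) y"
    using AE_halfline_pos
    by eventually_elim (subst indicator_blocks, auto simp: laplace_integrand_def abs_mult mult.assoc)
  then have "(\<integral>\<^sup>+y. ennreal (norm (laplace_integrand lam v f x y)) \<partial>HL) = Lmaj UNIV f x"
    unfolding Lmaj_def by (rule nn_integral_cong_AE)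
  with fin show "(\<integral>\<^sup>+y. ennreal (norm (laplace_integrand lam v f x y)) \<partial>HL) < \<infinity>" by simp
qed simp

lemma laplace_op_diff_Lmid:
  assumes [measurable]: "f \<in> borel_measurable HL" and fin: "Lmaj UNIV f x < top"
  shows "ennreal \<bar>laplace_op lam v f x - Lmid N f x\<bar> \<le> Lmaj (tail_indices N) f x"
proof -
  note i = laplace_integrand_integrable[OF assms]
  have i': "integrable HL (\<lambda>y. laplace_integrand lam v f x y * indicator (mid_set N) y)"
    using i by (intro integrable_real_mult_indicator sets_mid_set)
  have "ennreal \<bar>laplace_op lam v f x - Lmid N f x\<bar>
    = ennreal (norm (\<integral>y. laplace_integrand lam v f x y - laplace_integrand lam v f x y * indicator (mid_set N) y \<partial>HL))"
    unfolding laplace_op_def Lmid_def by (subst Bochner_Integration.integral_diff[OF i i']) simp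
  also have "\<dots> \<le> (\<integral>\<^sup>+y. ennreal (norm (laplace_integrand lam v f x y - laplace_integrand lam v f x y * indicator (mid_set N) y)) \<partial>HL)"
    by (rule integral_norm_bound_ennreal) (use i i' in auto)
  also have "\<dots> = Lmaj (tail_indices N) f x"
    unfolding Lmaj_def
  proof (rule nn_integral_cong_AE)
    show "AE y in HL. ennreal (norm (laplace_integrand lam v f x y - laplace_integrand lam v f x y * indicator (mid_set N) y))
      = ennreal (exp (- (x * y powr lam)) * \<bar>f y * v y\<bar>) * indicator (\<Union>k\<in>tail_indices N. blk k) y"
      using AE_halfline_pos
      by eventually_elim
        (simp add: indicator_blocks mid_set_def laplace_integrand_def abs_mult mult.assoc split: split_indicator)
  qed
  finally show ?thesis .
qed

lemma abs_laplace_op_le_Lmaj: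
  assumes "f \<in> borel_measurable HL" "Lmaj UNIV f x < top"
  shows "ennreal \<bar>laplace_op lam v f x\<bar> \<le> Lmaj UNIV f x"
proof -
  have *: "tail_indices 0 = UNIV" "mid_set 0 = {}" by (auto simp: tail_indices_def mid_set_def)
  show ?thesis using laplace_op_diff_Lmid[OF assms, of 0] by (simp add: * Lmid_def)
qed

text \<open>
  A bound for \<open>\<integral>\<bar>f v\<bar>\<close> over the middle blocks whenever \<open>\<integral>\<bar>f\<bar>\<^sup>p \<le> C\<close>, as a real number.
\<close>

definition mid_bound :: "nat \<Rightarrow> real \<Rightarrow> real" where
  "mid_bound N C = enn2real (2 * (enn_powr (ennreal C) (1 / p) * wnorm (mid_set N)))"

lemma mid_bound_nonneg: "mid_bound N C \<ge> 0" by (simp add: mid_bound_def)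

lemma mid_set_mass:
  assumes [measurable]: "f \<in> borel_measurable HL" and C: "pow_int p f \<le> ennreal C"
  shows "integrable HL (\<lambda>y. \<bar>f y * v y\<bar> * indicator (mid_set N) y)" "(\<integral>y. \<bar>f y * v y\<bar> * indicator (mid_set N) y \<partial>HL) \<le> mid_bound N C"
proof -
  have p1: "1 / p > 0" using p_ge_1 by simp
  have "local_norm f (mid_set N) \<le> enn_powr (pow_int p f) (1 / p)"
    unfolding local_norm_def using p1
    by (intro enn_powr_mono nn_integral_mono) (auto split: split_indicator)
  also have "\<dots> \<le> enn_powr (ennreal C) (1 / p)"
    using C p1 by (intro enn_powr_mono) auto
  finally have l: "local_norm f (mid_set N) \<le> enn_powr (ennreal C) (1 / p)" .
  have fin: "2 * (enn_powr (ennreal C) (1 / p) * wnorm (mid_set N)) < top"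
    using p1 by (simp add: ennreal_mult_less_top enn_powr_less_top_iff wnorm_mid_set_finite)
  have "(\<integral>\<^sup>+y. ennreal (\<bar>f y * v y\<bar> * indicator (mid_set N) y) \<partial>HL) = (\<integral>\<^sup>+y. ennreal \<bar>f y * v y\<bar> * indicator (mid_set N) y \<partial>HL)"
    by (intro nn_integral_cong) (auto split: split_indicator)
  also have "\<dots> \<le> 2 * (local_norm f (mid_set N) * wnorm (mid_set N))"
    by (rule Holder_wnorm) auto
  also have "\<dots> \<le> 2 * (enn_powr (ennreal C) (1 / p) * wnorm (mid_set N))"
    by (intro mult_left_mono mult_right_mono l) auto
  also have "\<dots> = ennreal (mid_bound N C)"
    using fin by (simp add: mid_bound_def)
  finally have nn: "(\<integral>\<^sup>+y. ennreal (\<bar>f y * v y\<bar> * indicator (mid_set N) y) \<partial>HL) \<le> ennreal (mid_bound N C)" .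
  show i: "integrable HL (\<lambda>y. \<bar>f y * v y\<bar> * indicator (mid_set N) y)"
    by (rule integrableI_bounded) (use nn in \<open>auto intro: le_less_trans\<close>)
  have "ennreal (\<integral>y. \<bar>f y * v y\<bar> * indicator (mid_set N) y \<partial>HL) \<le> ennreal (mid_bound N C)"
    using nn by (subst nn_integral_eq_integral[OF i, symmetric]) auto
  then show "(\<integral>y. \<bar>f y * v y\<bar> * indicator (mid_set N) y \<partial>HL) \<le> mid_bound N C"
    by (simp add: mid_bound_nonneg)
qed

lemma Lmid_integrable:
  assumes [measurable]: "f \<in> borel_measurable HL" and C: "pow_int p f \<le> ennreal C" and x: "x \<ge> 0"
  shows "integrable HL (\<lambda>y. laplace_integrand lam v f x y * indicator (mid_set N) y)"
proof (rule Bochner_Integration.integrable_bound[OF mid_set_mass(1)[OF assms(1,2), of N]])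
  show "AE y in HL. norm (laplace_integrand lam v f x y * indicator (mid_set N) y) \<le> norm (\<bar>f y * v y\<bar> * indicator (mid_set N) y)"
    using x by (intro AE_I2) (auto simp: laplace_integrand_def abs_mult mult_left_le_one_le mult.assoc split: split_indicator)
qed simp

lemma Lmid_bound:
  assumes [measurable]: "f \<in> borel_measurable HL" and C: "pow_int p f \<le> ennreal C" and x: "x \<ge> 0"
  shows "\<bar>Lmid N f x\<bar> \<le> mid_bound N C * exp (- (x * 2 powr (- real N)))"
proof -
  let ?e = "exp (- (x * 2 powr (- real N)))"
  have "norm (Lmid N f x) \<le> (\<integral>y. ?e * (\<bar>f y * v y\<bar> * indicator (mid_set N) y) \<partial>HL)"
    unfolding Lmid_def
  proof (rule Bochner_Integration.integral_norm_bound_integral[OF Lmid_integrable[OF assms]])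
    show "integrable HL (\<lambda>y. ?e * (\<bar>f y * v y\<bar> * indicator (mid_set N) y))"
      by (intro integrable_mult_right mid_set_mass(1)[OF assms(1,2)])
    fix y
    have "exp (- (x * y powr lam)) \<le> ?e" if "y \<in> mid_set N"
      using mem_mid_setD[OF that] x by (auto intro!: mult_left_mono)
    then show "norm (laplace_integrand lam v f x y * indicator (mid_set N) y) \<le> ?e * (\<bar>f y * v y\<bar> * indicator (mid_set N) y)"
      by (auto simp: laplace_integrand_def abs_mult mult.assoc intro!: mult_right_mono split: split_indicator)
  qed
  also have "\<dots> = ?e * (\<integral>y. \<bar>f y * v y\<bar> * indicator (mid_set N) y \<partial>HL)" by simp
  also have "\<dots> \<le> ?e * mid_bound N C"
    by (intro mult_left_mono mid_set_mass(2)[OF assms(1,2)]) auto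
  finally show ?thesis by (simp add: mult.commute)
qed

lemma Lmid_Lipschitz:
  assumes [measurable]: "f \<in> borel_measurable HL" and C: "pow_int p f \<le> ennreal C"
    and x: "x \<ge> 0" "x' \<ge> 0"
  shows "\<bar>Lmid N f x - Lmid N f x'\<bar> \<le> \<bar>x - x'\<bar> * (2 powr real N * mid_bound N C)"
proof -
  note i = Lmid_integrable[OF assms(1,2) x(1), of N] Lmid_integrable[OF assms(1,2) x(2), of N]
  have "norm (Lmid N f x - Lmid N f x') = norm (\<integral>y. laplace_integrand lam v f x y * indicator (mid_set N) y - laplace_integrand lam v f x' y * indicator (mid_set N) y \<partial>HL)"
    unfolding Lmid_def by (simp add: Bochner_Integration.integral_diff[OF i])
  also have "\<dots> \<le> (\<integral>y. \<bar>x - x'\<bar> * 2 powr real N * (\<bar>f y * v y\<bar> * indicator (mid_set N) y) \<partial>HL)"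
  proof (rule Bochner_Integration.integral_norm_bound_integral)
    show "integrable HL (\<lambda>y. \<bar>x - x'\<bar> * 2 powr real N * (\<bar>f y * v y\<bar> * indicator (mid_set N) y))"
      by (intro integrable_mult_right mid_set_mass(1)[OF assms(1,2)])
    show "integrable HL (\<lambda>y. laplace_integrand lam v f x y * indicator (mid_set N) y - laplace_integrand lam v f x' y * indicator (mid_set N) y)"
      by (intro Bochner_Integration.integrable_diff i)
    fix y
    show "norm (laplace_integrand lam v f x y * indicator (mid_set N) y - laplace_integrand lam v f x' y * indicator (mid_set N) y)
      \<le> \<bar>x - x'\<bar> * 2 powr real N * (\<bar>f y * v y\<bar> * indicator (mid_set N) y)"
    proof (cases "y \<in> mid_set N")
      case True
      have "\<bar>exp (- (x * y powr lam)) - exp (- (x' * y powr lam))\<bar> \<le> \<bar>x * y powr lam - x' * y powr lam\<bar>"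
        using x by (intro abs_exp_minus_diff_le) auto
      also have "\<dots> = \<bar>x - x'\<bar> * y powr lam"
        by (simp add: abs_mult flip: left_diff_distrib)
      also have "\<dots> \<le> \<bar>x - x'\<bar> * 2 powr real N"
        using mem_mid_setD[OF True] by (intro mult_left_mono) auto
      finally have "\<bar>exp (- (x * y powr lam)) - exp (- (x' * y powr lam))\<bar> * \<bar>f y * v y\<bar> \<le> \<bar>x - x'\<bar> * 2 powr real N * \<bar>f y * v y\<bar>"
        by (intro mult_right_mono) auto
      moreover have "laplace_integrand lam v f x y - laplace_integrand lam v f x' y = (exp (- (x * y powr lam)) - exp (- (x' * y powr lam))) * (f y * v y)"
        by (simp add: laplace_integrand_def algebra_simps)
      ultimately show ?thesis using True by (simp add: abs_mult)
    qed simp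
  qed
  also have "\<dots> = \<bar>x - x'\<bar> * 2 powr real N * (\<integral>y. \<bar>f y * v y\<bar> * indicator (mid_set N) y \<partial>HL)" by simp
  also have "\<dots> \<le> \<bar>x - x'\<bar> * 2 powr real N * mid_bound N C"
    by (intro mult_left_mono mid_set_mass(2)[OF assms(1,2)]) auto
  finally show ?thesis by (simp add: mult.assoc)
qed

text \<open>
  A diagonal sequence converges at all pairs of a cut-off \<open>N\<close> and a rational \<open>x\<close>; equicontinuity in \<open>x\<close> extends
  the convergence to all \<open>x\<close>. Pointwise convergence on a countable dense set thus replaces weak compactness
  of balls in \<open>L\<^sup>p\<close>, which would fail for \<open>p = 1\<close>.
\<close>

lemma Lmid_convergent_subsequence:
  assumes f: "\<And>n :: nat. f n \<in> borel_measurable HL" and C: "\<And>n. (pow_int p (f n)) \<le> ennreal C"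
  obtains s :: "nat \<Rightarrow> nat" where "strict_mono s" "\<And>N x. x \<ge> 0 \<Longrightarrow> convergent (\<lambda>n. Lmid N (f (s n)) x)"
proof -
  define S :: "(nat \<times> real) set" where "S = UNIV \<times> (\<rat> \<inter> {0..})"
  \<comment> \<open>Normalised to a bound that does not depend on the cut-off.\<close>
  define F where "F = (\<lambda>n (z :: nat \<times> real). Lmid (fst z) (f n) (snd z) / (mid_bound (fst z) C + 1))"
  have "countable S" unfolding S_def by (intro countable_SIGMA countable_Int1 countable_rat) auto
  moreover have "norm (F n z) \<le> 1" if "z \<in> S" for n z
  proof -
    have "\<bar>Lmid (fst z) (f n) (snd z)\<bar> \<le> mid_bound (fst z) C * exp (- (snd z * 2 powr (- real (fst z))))"
      using that by (intro Lmid_bound f C) (auto simp: S_def)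
    also have "\<dots> \<le> mid_bound (fst z) C * 1"
      using that mid_bound_nonneg by (intro mult_left_mono) (auto simp: S_def)
    finally show ?thesis
      using mid_bound_nonneg[of "fst z" C] by (simp add: F_def)
  qed
  ultimately obtain s where s: "strict_mono (s :: nat \<Rightarrow> nat)" "\<And>z. z \<in> S \<Longrightarrow> \<exists>l. (\<lambda>n. F (s n) z) \<longlonglongrightarrow> l"
    using function_convergent_subsequence[of S F 1] by blast
  show ?thesis
  proof (rule that[OF s(1)])
    fix N and x :: real assume x: "x \<ge> 0"
    \<comment> \<open>A Lipschitz constant, increased by \<open>1\<close> to be positive.\<close>
    define B where "B = 2 powr real N * mid_bound N C + 1"
    have B: "B > 0" using mid_bound_nonneg[of N C] by (simp add: B_def add_nonneg_pos)
    have lip: "\<bar>Lmid N (f n) x - Lmid N (f n) x'\<bar> \<le> \<bar>x - x'\<bar> * B" if "x' \<ge> 0" for n x'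
    proof -
      have "\<bar>Lmid N (f n) x - Lmid N (f n) x'\<bar> \<le> \<bar>x - x'\<bar> * (2 powr real N * mid_bound N C)"
        using Lmid_Lipschitz[OF f C x that] .
      also have "\<dots> \<le> \<bar>x - x'\<bar> * B" by (intro mult_left_mono) (auto simp: B_def)
      finally show ?thesis .
    qed
    have "Cauchy (\<lambda>n. Lmid N (f (s n)) x)"
    proof (rule metric_CauchyI)
      fix e :: real assume e: "0 < e"
      then have "x < x + e / (3 * B)" using B by simp
      then obtain x' where x': "x' \<in> \<rat>" "x < x'" "x' < x + e / (3 * B)" using Rats_dense_in_real by blast
      have "\<bar>x - x'\<bar> * B < e / (3 * B) * B" using x' B by (intro mult_strict_right_mono) auto
      then have close: "\<bar>Lmid N (f n) x - Lmid N (f n) x'\<bar> < e / 3" for n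
        using lip[of x' n] x x' B by simp
      have "(N, x') \<in> S" using x x' by (auto simp: S_def)
      from s(2)[OF this] obtain l where "(\<lambda>n. F (s n) (N, x')) \<longlonglongrightarrow> l" ..
      then have "(\<lambda>n. (mid_bound N C + 1) * F (s n) (N, x')) \<longlonglongrightarrow> (mid_bound N C + 1) * l"
        by (rule tendsto_mult_left)
      moreover have "(mid_bound N C + 1) * F (s n) (N, x') = Lmid N (f (s n)) x'" for n
        using mid_bound_nonneg[of N C] by (simp add: F_def add_nonneg_pos)
      ultimately have "Cauchy (\<lambda>n. Lmid N (f (s n)) x')"
        by (simp add: LIMSEQ_imp_Cauchy)
      then obtain k where k: "\<And>m n. m \<ge> k \<Longrightarrow> n \<ge> k \<Longrightarrow> dist (Lmid N (f (s m)) x') (Lmid N (f (s n)) x') < e / 3"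
        using e by (metis Cauchy_def divide_pos_pos zero_less_numeral)
      have "dist (Lmid N (f (s m)) x) (Lmid N (f (s n)) x) < e" if "m \<ge> k" "n \<ge> k" for m n
        using k[OF that] close[of "s m"] close[of "s n"] unfolding dist_real_def by linarith
      then show "\<exists>k. \<forall>m\<ge>k. \<forall>n\<ge>k. dist (Lmid N (f (s m)) x) (Lmid N (f (s n)) x) < e" by blast
    qed
    then show "convergent (\<lambda>n. Lmid N (f (s n)) x)" by (simp add: Cauchy_convergent_iff)
  qed
qed

end

section \<open>Sufficient conditions\<close>

context laplace_weight
begin

lemma Lr_norm_p_eq: "Lr_norm (ennreal p) {0..} f = enn_powr (pow_int p f) (1 / p)"
  using p_ge_1 by (simp add: Lr_norm_def)

lemma Lr_norm_q_eq: "Lr_norm (ennreal q) {0..} f = enn_powr (pow_int q f) (1 / q)"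
  using q_pos by (simp add: Lr_norm_def)

lemma Lr_space_p_iff: "f \<in> Lr_space (ennreal p) \<longleftrightarrow> f \<in> borel_measurable HL \<and> pow_int p f < top"
  using p_ge_1 by (simp add: Lr_space_def Lr_norm_p_eq enn_powr_less_top_iff)

lemma Lr_space_q_iff: "f \<in> Lr_space (ennreal q) \<longleftrightarrow> f \<in> borel_measurable HL \<and> pow_int q f < top"
  using q_pos by (simp add: Lr_space_def Lr_norm_q_eq enn_powr_less_top_iff)

lemma Lr_norm_p_le_iff:
  "Lr_norm (ennreal p) {0..} f \<le> ennreal C \<longleftrightarrow> (pow_int p f) \<le> ennreal (max 0 C powr p)"
proof -
  have "ennreal C = ennreal (max 0 C)" by (simp add: max_def ennreal_neg)
  then show ?thesis
    using p_ge_1 by (simp add: Lr_norm_p_eq enn_powr_le_iff enn_powr_ennreal)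
qed

text \<open>
  The sum in \<open>Lmaj_estimate\<close> that measures what the truncation at \<open>N\<close> neglects.
\<close>

definition tail_energy :: "(real \<Rightarrow> real) \<Rightarrow> nat \<Rightarrow> ennreal" where
  "tail_energy f N = (ISUM k. enn_powr (local_norm f (blk k) * bconst k * indicator (tail_indices N) k) q)"

text \<open>
  Sufficiency is reduced to sequences here: if the blocks far out contribute little, uniformly on bounded sets,
  the middle parts converge along a subsequence and \<open>convergence_from_truncations\<close> applies. Each truncated
  image is dominated by a multiple of \<open>exp (- 2\<^bsup>-N\<^esup> x)\<close>.
\<close>

lemma compact_if_tails_small:
  assumes tails: "\<And>C :: real. \<exists>eps. eps \<longlonglongrightarrow> 0 \<and> eps 0 < top \<and>
      (\<forall>f N. f \<in> borel_measurable HL \<longrightarrow> pow_int p f \<le> ennreal C \<longrightarrow> tail_energy f N \<le> eps N)"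
  shows "laplace_compact lam v (ennreal p) (ennreal q)"
proof -
  obtain K where K: "K < top" "\<And>(f :: real \<Rightarrow> real) Z. f \<in> borel_measurable HL \<Longrightarrow>
    (\<integral>\<^sup>+x. enn_powr (Lmaj Z f x) q \<partial>HL)
      \<le> K * (ISUM k. enn_powr (local_norm f (blk k) * bconst k * indicator Z k) q)"
    using Lmaj_estimate by blast
  have tails': "\<exists>eps. eps \<longlonglongrightarrow> 0 \<and> eps 0 < top \<and>
      (\<forall>f N. f \<in> borel_measurable HL \<longrightarrow> pow_int p f \<le> ennreal C \<longrightarrow>
        (\<integral>\<^sup>+x. enn_powr (Lmaj (tail_indices N) f x) q \<partial>HL) \<le> eps N)" for C :: real
  proof -
    from tails[of C] obtain eps where eps: "eps \<longlonglongrightarrow> 0" "eps 0 < top"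
      "\<And>f N. f \<in> borel_measurable HL \<Longrightarrow> pow_int p f \<le> ennreal C \<Longrightarrow> tail_energy f N \<le> eps N"
      by blast
    have "(\<lambda>N. K * eps N) \<longlonglongrightarrow> 0" using ennreal_tendsto_cmult[OF K(1) eps(1)] by simp
    moreover have "K * eps 0 < top" using K(1) eps(2) by (simp add: ennreal_mult_less_top)
    moreover have "(\<integral>\<^sup>+x. enn_powr (Lmaj (tail_indices N) f x) q \<partial>HL) \<le> K * eps N"
      if "f \<in> borel_measurable HL" "pow_int p f \<le> ennreal C" for f N
      using K(2)[OF that(1), of "tail_indices N"] mult_left_mono[OF eps(3)[OF that, of N], of K]
      unfolding tail_energy_def by (meson order_trans zero_le)
    ultimately show ?thesis by (intro exI[of _ "\<lambda>N. K * eps N"]) blast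
  qed
  have tail0: "tail_indices 0 = UNIV" by (auto simp: tail_indices_def)
  have Tfin: "Lmaj UNIV f x < top" and Lq: "pow_int q (laplace_op lam v f) \<le> (\<integral>\<^sup>+x. enn_powr (Lmaj UNIV f x) q \<partial>HL)"
    if f: "f \<in> borel_measurable HL" "pow_int p f < top" and x: "0 < x" for f x
  proof -
    have fin: "Lmaj UNIV f x < top" if x: "0 < x" for x
    proof -
      obtain C where C: "pow_int p f = ennreal C" using f(2) by (auto simp: less_top_ennreal)
      obtain eps where eps: "eps 0 < top" "\<And>N. (\<integral>\<^sup>+x. enn_powr (Lmaj (tail_indices N) f x) q \<partial>HL) \<le> eps N"
        using tails'[of C] f(1) C by auto
      have "ennreal x * enn_powr (Lmaj UNIV f x) q \<le> (\<integral>\<^sup>+x. enn_powr (Lmaj UNIV f x) q \<partial>HL)"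
        by (rule Lmaj_pointwise[OF x])
      also have "\<dots> < top" using eps(2)[of 0] eps(1) by (simp add: tail0 le_less_trans)
      finally show ?thesis using x q_pos by (auto simp: ennreal_mult_less_top enn_powr_less_top_iff enn_powr_eq_0_iff)
    qed
    show "Lmaj UNIV f x < top" using fin[OF x] .
    show "pow_int q (laplace_op lam v f) \<le> (\<integral>\<^sup>+x. enn_powr (Lmaj UNIV f x) q \<partial>HL)"
    proof (rule nn_integral_mono_AE)
      show "AE x in HL. ennreal (\<bar>laplace_op lam v f x\<bar> powr q) \<le> enn_powr (Lmaj UNIV f x) q"
        using AE_halfline_pos
      proof eventually_elim
        fix x :: real assume "0 < x"
        from enn_powr_mono[OF q_pos abs_laplace_op_le_Lmaj[OF f(1) fin[OF this]]]
        show "ennreal (\<bar>laplace_op lam v f x\<bar> powr q) \<le> enn_powr (Lmaj UNIV f x) q"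
          using q_pos by (simp add: enn_powr_ennreal)
      qed
    qed
  qed
  have in_Lq: "laplace_op lam v f \<in> Lr_space (ennreal q)" if "f \<in> Lr_space (ennreal p)" for f
  proof -
    from that have f: "f \<in> borel_measurable HL" "pow_int p f < top"
      by (auto simp: Lr_space_p_iff)
    then obtain C where C: "pow_int p f = ennreal C" by (auto simp: less_top_ennreal)
    obtain eps where eps: "eps 0 < top" "\<And>N. (\<integral>\<^sup>+x. enn_powr (Lmaj (tail_indices N) f x) q \<partial>HL) \<le> eps N"
      using tails'[of C] f(1) C by auto
    have "pow_int q (laplace_op lam v f) \<le> (\<integral>\<^sup>+x. enn_powr (Lmaj UNIV f x) q \<partial>HL)"
      by (rule Lq[OF f, of 1]) simp
    also have "\<dots> < top" using eps(2)[of 0] eps(1) by (simp add: tail0 le_less_trans)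
    finally show ?thesis using laplace_op_measurable[OF f(1)] by (simp add: Lr_space_q_iff)
  qed
  have maps: "laplace_maps lam v (ennreal p) (ennreal q)"
    unfolding laplace_maps_def
  proof (intro ballI conjI in_Lq)
    fix f assume "f \<in> Lr_space (ennreal p)"
    then have f: "f \<in> borel_measurable HL" "pow_int p f < top"
      by (auto simp: Lr_space_p_iff)
    show "AE x in HL. integrable HL (laplace_integrand lam v f x)"
      using AE_halfline_pos by eventually_elim (intro laplace_integrand_integrable f Tfin)
  qed
  have "Lr_relatively_compact (ennreal q) (laplace_op lam v ` F)" if F: "Lr_bounded (ennreal p) F" for F
    unfolding Lr_relatively_compact_def
  proof (intro conjI allI impI)
    show "laplace_op lam v ` F \<subseteq> Lr_space (ennreal q)"
      using F in_Lq by (auto simp: Lr_bounded_def)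
    fix h :: "nat \<Rightarrow> real \<Rightarrow> real" assume h: "range h \<subseteq> laplace_op lam v ` F"
    then have "\<forall>n. \<exists>f\<in>F. h n = laplace_op lam v f" by (auto simp: image_subset_iff)
    then obtain f where f: "\<And>n. f n \<in> F" "\<And>n. h n = laplace_op lam v (f n)" by metis
    from F obtain C0 where "\<And>f. f \<in> F \<Longrightarrow> Lr_norm (ennreal p) {0..} f \<le> ennreal C0" and FS: "F \<subseteq> Lr_space (ennreal p)"
      by (auto simp: Lr_bounded_def)
    define C where "C = max 0 C0 powr p"
    have fC: "pow_int p (f n) \<le> ennreal C" for n
      using \<open>\<And>f. f \<in> F \<Longrightarrow> _ f \<le> ennreal C0\<close>[OF f(1)] by (simp add: Lr_norm_p_le_iff C_def)
    have fm[measurable]: "f n \<in> borel_measurable HL" for n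
      using f(1)[of n] FS by (auto simp: Lr_space_p_iff)
    have ft: "pow_int p (f n) < top" for n
      using fC[of n] by (auto intro: le_less_trans)
    obtain eps where eps: "eps \<longlonglongrightarrow> 0" "eps 0 < top" "\<And>n N. (\<integral>\<^sup>+x. enn_powr (Lmaj (tail_indices N) (f n) x) q \<partial>HL) \<le> eps N"
      using tails'[of C] fm fC by blast
    obtain s :: "nat \<Rightarrow> nat" where s: "strict_mono s" "\<And>N x. x \<ge> 0 \<Longrightarrow> convergent (\<lambda>n. Lmid N (f (s n)) x)"
      using Lmid_convergent_subsequence[of f C, OF fm fC] by blast
    have diff: "ennreal \<bar>h n x - Lmid N (f n) x\<bar> \<le> Lmaj (tail_indices N) (f n) x" if "0 < x" for n N x
      unfolding f(2) by (intro laplace_op_diff_Lmid fm Tfin ft that)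
    obtain g where g: "g \<in> borel_measurable HL" "pow_int q g < top"
      "(\<lambda>n. pow_int q (\<lambda>x. h (s n) x - g x)) \<longlonglongrightarrow> 0"
    proof (rule convergence_from_truncations[where h="\<lambda>n. h (s n)" and hN="\<lambda>N n. Lmid N (f (s n))"
          and D="\<lambda>N x. mid_bound N C * exp (- (x * 2 powr - real N))" and eps=eps and C="eps 0" and M=HL, OF q_pos])
      show "h (s n) \<in> borel_measurable HL" for n
        unfolding f(2) by (rule laplace_op_measurable) simp
      show "Lmid N (f (s n)) \<in> borel_measurable HL" for N n
        by (rule Lmid_measurable) simp
      show "(\<lambda>x. mid_bound N C * exp (- (x * 2 powr - real N))) \<in> borel_measurable HL" for N
        by measurable
      show "AE x in HL. convergent (\<lambda>n. Lmid N (f (s n)) x)" for N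
        using AE_halfline_pos by eventually_elim (simp add: s)
      show "AE x in HL. \<bar>Lmid N (f (s n)) x\<bar> \<le> mid_bound N C * exp (- (x * 2 powr - real N))" for N n
        using AE_halfline_pos by eventually_elim (intro Lmid_bound fm fC, simp)
      show "(\<integral>\<^sup>+x. ennreal ((mid_bound N C * exp (- (x * 2 powr - real N))) powr q) \<partial>HL) < top" for N
      proof -
        have "(mid_bound N C * exp (- (x * 2 powr - real N))) powr q = mid_bound N C powr q * exp (- (x * (2 powr - real N * q)))" for x
          using mid_bound_nonneg[of N C] by (simp add: powr_mult exp_powr_real mult_ac)
        then show ?thesis
          using q_pos by (simp add: ennreal_mult nn_integral_cmult nn_integral_exp_halfline ennreal_mult_less_top)
      qed
      show "AE x in HL. \<exists>d. d \<longlonglongrightarrow> 0 \<and> (\<forall>N n. ennreal \<bar>h (s n) x - Lmid N (f (s n)) x\<bar> \<le> d N)"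
        using AE_halfline_pos
      proof eventually_elim
        fix x :: real assume x: "0 < x"
        \<comment> \<open>The pointwise bound of the majorant makes the truncation error uniform in the sequence index.\<close>
        define d where "d = (\<lambda>N. enn_powr (ennreal (1 / x) * eps N) (1 / q))"
        have "d \<longlonglongrightarrow> 0"
          unfolding d_def using ennreal_tendsto_cmult[OF _ eps(1), of "ennreal (1 / x)"] q_pos
          by (intro tendsto_enn_powr_zero) auto
        moreover have "ennreal \<bar>h (s n) x - Lmid N (f (s n)) x\<bar> \<le> d N" for N n
        proof -
          have "ennreal x * enn_powr (Lmaj (tail_indices N) (f (s n)) x) q \<le> eps N"
            using Lmaj_pointwise[OF x] eps(3) by (rule order_trans)
          then have "ennreal (1 / x) * (ennreal x * enn_powr (Lmaj (tail_indices N) (f (s n)) x) q) \<le> ennreal (1 / x) * eps N"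
            by (intro mult_left_mono) auto
          then have "enn_powr (Lmaj (tail_indices N) (f (s n)) x) q \<le> ennreal (1 / x) * eps N"
            using x by (simp add: mult.assoc[symmetric] flip: ennreal_mult)
          then have "Lmaj (tail_indices N) (f (s n)) x \<le> d N"
            using q_pos by (simp add: d_def enn_powr_le_iff)
          with diff[OF x] show ?thesis by (rule order_trans)
        qed
        ultimately show "\<exists>d. d \<longlonglongrightarrow> 0 \<and> (\<forall>N n. ennreal \<bar>h (s n) x - Lmid N (f (s n)) x\<bar> \<le> d N)" by blast
      qed
      show "(pow_int q (\<lambda>x. h (s n) x - Lmid N (f (s n)) x)) \<le> eps N" for N n
      proof -
        have "AE x in HL. ennreal (\<bar>h (s n) x - Lmid N (f (s n)) x\<bar> powr q) \<le> enn_powr (Lmaj (tail_indices N) (f (s n)) x) q"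
          using AE_halfline_pos
        proof eventually_elim
          fix x :: real assume "0 < x"
          from enn_powr_mono[OF q_pos diff[OF this]]
          show "ennreal (\<bar>h (s n) x - Lmid N (f (s n)) x\<bar> powr q) \<le> enn_powr (Lmaj (tail_indices N) (f (s n)) x) q"
            using q_pos by (simp add: enn_powr_ennreal)
        qed
        from nn_integral_mono_AE[OF this] eps(3) show ?thesis by (rule order_trans)
      qed
      show "pow_int q (h (s n)) \<le> eps 0" for n
        using Lq[OF fm ft, of 1 "s n"] eps(3)[of 0 "s n"] by (simp add: f(2) tail0 order_trans)
    qed (use eps in auto)
    show "\<exists>g\<in>Lr_space (ennreal q). \<exists>s. strict_mono s \<and> (\<lambda>n. Lr_norm (ennreal q) {0..} (\<lambda>x. h (s n) x - g x)) \<longlonglongrightarrow> 0"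
    proof (intro bexI exI conjI)
      show "g \<in> Lr_space (ennreal q)" using g by (simp add: Lr_space_q_iff)
      show "(\<lambda>n. Lr_norm (ennreal q) {0..} (\<lambda>x. h (s n) x - g x)) \<longlonglongrightarrow> 0"
        unfolding Lr_norm_q_eq using g(3) q_pos by (intro tendsto_enn_powr_zero) auto
    qed (rule s)
  qed
  with maps show ?thesis by (simp add: laplace_compact_def)
qed

lemma finite_compl_tail_indices: "finite (- tail_indices N)"
  by (rule finite_subset[of _ "{- int N..int N}"]) (auto simp: tail_indices_def)

lemma tendsto_tail_sum:
  fixes b :: "int \<Rightarrow> ennreal"
  assumes "(ISUM k. b k) < top"
  shows "(\<lambda>N. ISUM k. b k * indicator (tail_indices N) k) \<longlonglongrightarrow> 0"
proof -
  have "(\<lambda>N. ISUM k. b k * indicator (tail_indices N) k) \<longlonglongrightarrow> (ISUM k. 0)"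
  proof (rule nn_integral_dominated_convergence[where w=b])
    show "AE k in idx. b k * indicator (tail_indices N) k \<le> b k" for N
      by (simp add: AE_count_space split: split_indicator)
    have "(\<lambda>N. b k * indicator (tail_indices N) k) \<longlonglongrightarrow> 0" for k
    proof (rule tendsto_eventually)
      show "\<forall>\<^sub>F N in sequentially. b k * indicator (tail_indices N) k = 0"
        unfolding eventually_sequentially
        by (intro exI[of _ "nat (\<bar>k\<bar> + 1)"]) (auto simp: tail_indices_def split: split_indicator)
    qed
    then show "AE k in idx. (\<lambda>N. b k * indicator (tail_indices N) k) \<longlonglongrightarrow> 0" by simp
  qed (use assms in auto)
  then show ?thesis by simp
qed

text \<open>
  For \<open>p \<le> q\<close> the \<open>l\<^sup>q\<close> norm of the sequence of local norms is controlled by its \<open>l\<^sup>p\<close> norm, so the supremum of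
  \<open>bconst\<close> over the tail decides.
\<close>

lemma compact_if_p_le_q:
  assumes pq: "p \<le> q" and c0: "\<And>e. e > 0 \<Longrightarrow> \<exists>N. \<forall>k\<in>tail_indices N. bconst k \<le> e"
  shows "laplace_compact lam v (ennreal p) (ennreal q)"
proof (rule compact_if_tails_small)
  fix C :: real
  \<comment> \<open>The given bound may be negative; then only functions vanishing almost everywhere are concerned.\<close>
  define C' where "C' = max 0 C"
  define sup_tail where "sup_tail = (\<lambda>N. SUP k\<in>tail_indices N. bconst k)"
  define eps where "eps = (\<lambda>N. enn_powr (sup_tail N) q * enn_powr (ennreal C') (q / p))"
  have q_p: "q / p > 0" using p_ge_1 q_pos by simp
  have mono: "sup_tail M \<le> sup_tail N" if "N \<le> M" for M N
    unfolding sup_tail_def using that by (intro SUP_subset_mono) (auto simp: tail_indices_def)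
  have lim: "sup_tail \<longlonglongrightarrow> 0"
  proof (rule order_tendstoI)
    fix e :: ennreal assume "0 < e"
    then obtain e' where e': "0 < e'" "e' < e" using dense by blast
    from c0[OF e'(1)] obtain N where "\<forall>k\<in>tail_indices N. bconst k \<le> e'" by blast
    then have "sup_tail N \<le> e'" unfolding sup_tail_def by (auto intro: SUP_least)
    then show "\<forall>\<^sub>F N in sequentially. sup_tail N < e"
      unfolding eventually_sequentially using mono e' by (meson le_less_trans order_trans)
  qed simp
  have sup0: "sup_tail 0 < top"
  proof -
    obtain N where N: "\<forall>k\<in>tail_indices N. bconst k \<le> 1" using c0[of 1] by auto
    note fin = finite_compl_tail_indices[of N]
    have "sup_tail 0 \<le> 1 + (\<Sum>k\<in>- tail_indices N. bconst k)"
      unfolding sup_tail_def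
    proof (rule SUP_least)
      fix k
      show "bconst k \<le> 1 + (\<Sum>k\<in>- tail_indices N. bconst k)"
      proof (cases "k \<in> tail_indices N")
        case True then show ?thesis using N by (auto intro: order_trans add_increasing2)
      next
        case False then show ?thesis
          using fin by (intro add_increasing member_le_sum) auto
      qed
    qed
    also have "\<dots> < top" using bconst_finite fin by simp
    finally show ?thesis .
  qed
  have "eps \<longlonglongrightarrow> 0"
    unfolding eps_def using ennreal_tendsto_cmult[OF _ tendsto_enn_powr_zero[OF lim q_pos], of "enn_powr (ennreal C') (q / p)"] q_p
    by (simp add: mult.commute enn_powr_less_top_iff)
  moreover have "eps 0 < top"
    unfolding eps_def using sup0 q_p q_pos by (simp add: ennreal_mult_less_top enn_powr_less_top_iff)
  moreover have "tail_energy f N \<le> eps N"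
    if [measurable]: "f \<in> borel_measurable HL" and C: "pow_int p f \<le> ennreal C" for f N
  proof -
    define A where "A = (ISUM k. enn_powr (local_norm f (blk k)) p)"
    have A: "A \<le> ennreal C'"
      using order_trans[OF C, of "ennreal C'"] by (simp add: A_def nn_integral_local_norm_blk C'_def ennreal_leI)
    have aq: "enn_powr (local_norm f (blk k)) q \<le> enn_powr (ennreal C') (q / p - 1) * enn_powr (local_norm f (blk k)) p" for k
    proof (cases "p = q")
      case True then show ?thesis using p_ge_1 by (simp add: enn_powr_def)
    next
      case False
      have "enn_powr (local_norm f (blk k)) p \<le> A"
        unfolding A_def by (rule nn_integral_ge_point) simp
      then have le: "enn_powr (local_norm f (blk k)) p \<le> ennreal C'" using A by (rule order_trans)
      have pos: "q / p - 1 > 0" using False pq p_ge_1 by (simp add: field_simps)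
      have "enn_powr (local_norm f (blk k)) q = enn_powr (enn_powr (local_norm f (blk k)) p) (q / p - 1) * enn_powr (local_norm f (blk k)) p"
        using pos p_ge_1 False pq by (simp add: enn_powr_powr enn_powr_add algebra_simps)
      also have "\<dots> \<le> enn_powr (ennreal C') (q / p - 1) * enn_powr (local_norm f (blk k)) p"
        by (intro mult_right_mono enn_powr_mono le pos) auto
      finally show ?thesis .
    qed
    have "tail_energy f N \<le> (ISUM k. enn_powr (sup_tail N) q * (enn_powr (ennreal C') (q / p - 1) * enn_powr (local_norm f (blk k)) p))"
      unfolding tail_energy_def
    proof (rule nn_integral_mono)
      fix k
      show "enn_powr (local_norm f (blk k) * bconst k * indicator (tail_indices N) k) q \<le> enn_powr (sup_tail N) q * (enn_powr (ennreal C') (q / p - 1) * enn_powr (local_norm f (blk k)) p)"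
      proof (cases "k \<in> tail_indices N")
        case True
        then have "bconst k \<le> sup_tail N" unfolding sup_tail_def by (rule SUP_upper)
        then have "enn_powr (bconst k) q * enn_powr (local_norm f (blk k)) q \<le> enn_powr (sup_tail N) q * (enn_powr (ennreal C') (q / p - 1) * enn_powr (local_norm f (blk k)) p)"
          by (intro mult_mono aq enn_powr_mono q_pos) auto
        then show ?thesis using True q_pos by (simp add: enn_powr_mult mult.commute)
      qed (use q_pos in simp)
    qed
    also have "\<dots> = enn_powr (sup_tail N) q * (enn_powr (ennreal C') (q / p - 1) * A)"
      by (simp add: nn_integral_cmult A_def)
    also have "\<dots> \<le> enn_powr (sup_tail N) q * (enn_powr (ennreal C') (q / p - 1) * ennreal C')"
      by (intro mult_left_mono A) auto
    also have "enn_powr (ennreal C') (q / p - 1) * ennreal C' = enn_powr (ennreal C') (q / p)"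
    proof (cases "p = q")
      case True then show ?thesis using p_ge_1 by (simp add: enn_powr_def[of _ 0])
    next
      case False
      then have "q / p - 1 > 0" using pq p_ge_1 by (simp add: field_simps)
      from enn_powr_add[OF this, of 1 "ennreal C'"] show ?thesis by simp
    qed
    finally show ?thesis by (simp add: eps_def)
  qed
  ultimately show "\<exists>eps. eps \<longlonglongrightarrow> 0 \<and> eps 0 < top \<and>
      (\<forall>f N. f \<in> borel_measurable HL \<longrightarrow> pow_int p f \<le> ennreal C \<longrightarrow> tail_energy f N \<le> eps N)"
    by blast
qed

text \<open>
  For \<open>q < p\<close> Hoelder's inequality for sequences pairs the \<open>l\<^sup>p\<close> sequence of local norms with the \<open>l\<^sup>r\<close> sequence
  \<open>bconst\<close>, whose tails are small as soon as it is summable.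
\<close>

lemma compact_if_q_less_p:
  assumes qp: "q < p" and cr: "(ISUM k. enn_powr (bconst k) (p * q / (p - q))) < top"
  shows "laplace_compact lam v (ennreal p) (ennreal q)"
proof (rule compact_if_tails_small)
  fix C :: real
  define r where "r = p * q / (p - q)"
  have pos: "p > 0" "r > 0" "q / p > 0" "q / r > 0" using qp q_pos by (auto simp: r_def)
  define R where "R = (\<lambda>N. ISUM k. enn_powr (bconst k) r * indicator (tail_indices N) k)"
  define eps where "eps = (\<lambda>N. 2 * enn_powr (ennreal C) (q / p) * enn_powr (R N) (q / r))"
  have R: "R \<longlonglongrightarrow> 0" unfolding R_def using cr by (intro tendsto_tail_sum) (simp add: r_def)
  have fin: "2 * enn_powr (ennreal C) (q / p) < top"
    using pos by (simp add: ennreal_mult_less_top enn_powr_less_top_iff)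
  have "eps \<longlonglongrightarrow> 0"
    unfolding eps_def using ennreal_tendsto_cmult[OF fin tendsto_enn_powr_zero[OF R pos(4)]] by simp
  moreover have "R 0 < top"
    using cr by (simp add: R_def tail_indices_def r_def)
  then have "eps 0 < top"
    unfolding eps_def using fin pos by (simp add: ennreal_mult_less_top[of _ "enn_powr (R 0) _"] enn_powr_less_top_iff)
  moreover have "tail_energy f N \<le> eps N"
    if [measurable]: "f \<in> borel_measurable HL" and C: "pow_int p f \<le> ennreal C" for f N
  proof -
    have "tail_energy f N = (ISUM k. enn_powr (local_norm f (blk k) * (bconst k * indicator (tail_indices N) k)) q)"
      by (simp add: tail_energy_def mult.assoc)
    also have "\<dots> \<le> 2 * (enn_powr (ISUM k. enn_powr (local_norm f (blk k)) p) (q / p)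
      * enn_powr (ISUM k. enn_powr (bconst k * indicator (tail_indices N) k) r) (q / r))"
      by (rule Holder_enn_powr[OF q_pos qp r_def]) auto
    also have "(ISUM k. enn_powr (bconst k * indicator (tail_indices N) k) r) = R N"
      unfolding R_def using pos by (intro nn_integral_cong) (auto split: split_indicator)
    also have "2 * (enn_powr (ISUM k. enn_powr (local_norm f (blk k)) p) (q / p) * enn_powr (R N) (q / r)) \<le> eps N"
      unfolding eps_def mult.assoc using C pos
      by (intro mult_left_mono mult_right_mono enn_powr_mono) (auto simp: nn_integral_local_norm_blk)
    finally show ?thesis .
  qed
  ultimately show "\<exists>eps. eps \<longlonglongrightarrow> 0 \<and> eps 0 < top \<and>
      (\<forall>f N. f \<in> borel_measurable HL \<longrightarrow> pow_int p f \<le> ennreal C \<longrightarrow> tail_energy f N \<le> eps N)"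
    by blast
qed

end

section \<open>Necessary conditions\<close>

lemma tendsto_zero_if_subsubsequences:
  fixes X :: "nat \<Rightarrow> ennreal"
  assumes "\<And>s :: nat \<Rightarrow> nat. strict_mono s \<Longrightarrow> \<exists>s'. strict_mono s' \<and> (\<lambda>n. X (s (s' n))) \<longlonglongrightarrow> 0"
  shows "X \<longlonglongrightarrow> 0"
proof (rule order_tendstoI)
  fix e :: ennreal assume e: "0 < e"
  show "\<forall>\<^sub>F n in sequentially. X n < e"
  proof (rule ccontr)
    assume "\<not> (\<forall>\<^sub>F n in sequentially. X n < e)"
    then have inf: "infinite {n. \<not> X n < e}"
      by (simp add: not_eventually frequently_cofinite cofinite_eq_sequentially[symmetric])
    define s where "s = enumerate {n. \<not> X n < e}"
    have s: "strict_mono s" "\<not> X (s n) < e" for n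
      using strict_mono_enumerate[OF inf] enumerate_in_set[OF inf, of n] by (auto simp: s_def)
    from assms[OF s(1)] obtain s' where "(\<lambda>n. X (s (s' n))) \<longlonglongrightarrow> 0" by blast
    from order_tendstoD(2)[OF this e] show False using s(2) by (auto simp: eventually_sequentially)
  qed
qed simp

context laplace_weight
begin

text \<open>
  Test functions that attain the norm of \<open>v\<close> on \<open>S\<close> up to a factor \<open>2\<close>. For \<open>p = 1\<close> some loss
  is needed, because the essential supremum need not be attained.
\<close>

definition norming :: "real set \<Rightarrow> (real \<Rightarrow> real) \<Rightarrow> bool" where
  "norming S g \<longleftrightarrow> g \<in> borel_measurable HL \<and> (\<forall>y. 0 \<le> g y) \<and> (\<forall>y. y \<notin> S \<longrightarrow> g y = 0) \<and>
    (\<integral>\<^sup>+y. ennreal (g y powr p) \<partial>HL) \<le> 1 \<and> wnorm S \<le> 2 * (\<integral>\<^sup>+y. ennreal (g y * v y) \<partial>HL)"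

text \<open>
  For \<open>p = 1\<close>, the normalised indicator of the part of \<open>S\<close> where \<open>v\<close> exceeds half its essential supremum; for
  \<open>p > 1\<close>, the extremal function \<open>v\<^bsup>p'-1\<^esup>\<close> of Hoelder's inequality on \<open>S\<close>, normalised.
\<close>

lemma norming_exists:
  assumes S[measurable]: "S \<in> sets HL" and b: "S \<subseteq> {0..b}"
  shows "\<exists>g. norming S g"
proof -
  have that: "\<exists>g. norming S g"
    if "g \<in> borel_measurable HL" "\<And>y. 0 \<le> g y" "\<And>y. y \<notin> S \<Longrightarrow> g y = 0"
      "(\<integral>\<^sup>+y. ennreal (g y powr p) \<partial>HL) \<le> 1" "wnorm S \<le> 2 * (\<integral>\<^sup>+y. ennreal (g y * v y) \<partial>HL)" for g
    using that unfolding norming_def by blast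
  show ?thesis
  proof (cases "wnorm S = 0")
    case True
    then show ?thesis using p_ge_1 by (intro that[of "\<lambda>_. 0"]) auto
  next
    case False
    have wfin: "wnorm S < top" by (rule wnorm_finite[OF S b])
    define W where "W = enn2real (wnorm S)"
    have W: "wnorm S = ennreal W" "W > 0"
      using wfin False by (auto simp: W_def enn2real_positive_iff zero_less_iff_neq_zero)
    show ?thesis
    proof (cases rule: p_cases)
      case 1
      \<comment> \<open>The essential supremum exceeds half of itself on a set of positive measure, finite because \<open>S\<close> is bounded.\<close>
    define E where "E = {y \<in> space HL. y \<in> S \<and> W / 2 < v y}"
      have E[measurable]: "E \<in> sets HL" unfolding E_def by measurable
      have ES: "E \<subseteq> S" by (auto simp: E_def)
      have "emeasure HL E \<noteq> 0"
      proof
        assume "emeasure HL E = 0"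
        then have "AE y in HL. y \<notin> E" by (intro AE_not_in) (auto simp: null_sets_def)
        then have "AE y in HL. y \<in> S \<longrightarrow> ennreal (v y) \<le> ennreal (W / 2)"
          using AE_space by eventually_elim (auto simp: E_def not_less intro: ennreal_leI)
        then have "wnorm S \<le> ennreal (W / 2)" using wnorm_le_iff_1[OF 1 S] by blast
        then show False using W by simp
      qed
      moreover have "emeasure HL E < top"
      proof -
        have "emeasure HL E \<le> emeasure HL {0..max 0 b}"
          using ES b by (intro emeasure_mono sets_halfline_borel) auto
        also have "\<dots> < top" by (subst emeasure_halfline_Icc) auto
        finally show ?thesis .
      qed
      ultimately have m: "emeasure HL E = ennreal (measure HL E)" "measure HL E > 0"
        by (simp_all add: emeasure_eq_ennreal_measure)
          (metis less_eq_real_def measure_nonneg)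
      show ?thesis
      proof (rule that[of "\<lambda>y. indicator E y / measure HL E"])
        have "(\<integral>\<^sup>+y. ennreal ((indicator E y / measure HL E) powr p) \<partial>HL) = (\<integral>\<^sup>+y. ennreal (1 / measure HL E) * indicator E y \<partial>HL)"
          using 1 m by (intro nn_integral_cong) (auto split: split_indicator)
        also have "\<dots> = 1"
          using m by (simp add: nn_integral_cmult flip: ennreal_mult)
        finally show "(\<integral>\<^sup>+y. ennreal ((indicator E y / measure HL E) powr p) \<partial>HL) \<le> 1" by simp
        have "wnorm S = 2 * (ennreal (W / 2 / measure HL E) * emeasure HL E)"
          using m W by (simp add: ennreal_numeral[symmetric] del: ennreal_numeral flip: ennreal_mult)
        also have "\<dots> = 2 * (\<integral>\<^sup>+y. ennreal (W / 2 / measure HL E) * indicator E y \<partial>HL)"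
          by (simp add: nn_integral_cmult)
        also have "\<dots> \<le> 2 * (\<integral>\<^sup>+y. ennreal (indicator E y / measure HL E * v y) \<partial>HL)"
          using m by (intro mult_left_mono nn_integral_mono)
            (auto simp: E_def field_simps intro!: ennreal_leI split: split_indicator)
        finally show "wnorm S \<le> 2 * (\<integral>\<^sup>+y. ennreal (indicator E y / measure HL E * v y) \<partial>HL)" .
      qed (use m ES in \<open>auto split: split_indicator\<close>)
    next
      case 2
      define p' where "p' = conj_exp p"
      have p': "p' > 1" using conj_exp_gt_1[OF 2] by (simp add: p'_def)
      have eqs: "(p' - 1) * p = p'" "1 - 1 / p = 1 / p'"
        using 2 by (simp_all add: p'_def conj_exp_def field_simps)
      define U where "U = (\<integral>\<^sup>+y. ennreal (v y powr p') * indicator S y \<partial>HL)"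
      have wU: "wnorm S = enn_powr U (1 / p')"
        using wnorm_eq_integral[OF 2 S] by (simp add: U_def p'_def)
      define u where "u = enn2real U"
      have u: "U = ennreal u" "u > 0"
        using wfin False p' unfolding wU
        by (auto simp: u_def enn2real_positive_iff zero_less_iff_neq_zero enn_powr_less_top_iff enn_powr_eq_0_iff)
      define g where "g = (\<lambda>y. u powr (- 1 / p) * (v y powr (p' - 1) * indicator S y))"
      show ?thesis
      proof (rule that[of g])
        have "(\<integral>\<^sup>+y. ennreal (g y powr p) \<partial>HL) = (\<integral>\<^sup>+y. ennreal (1 / u) * (ennreal (v y powr p') * indicator S y) \<partial>HL)"
        proof (intro nn_integral_cong)
          fix y
          have "(u powr (- 1 / p) * v y powr (p' - 1)) powr p = (1 / u) * v y powr p'"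
            using u 2 by (simp add: powr_mult powr_powr eqs powr_neg_one)
          then show "ennreal (g y powr p) = ennreal (1 / u) * (ennreal (v y powr p') * indicator S y)"
            using u by (auto simp: g_def simp flip: ennreal_mult split: split_indicator)
        qed
        also have "\<dots> = 1"
          using u by (simp add: nn_integral_cmult U_def[symmetric] flip: ennreal_mult)
        finally show "(\<integral>\<^sup>+y. ennreal (g y powr p) \<partial>HL) \<le> 1" by simp
        have "(\<integral>\<^sup>+y. ennreal (g y * v y) \<partial>HL) = (\<integral>\<^sup>+y. ennreal (u powr (- 1 / p)) * (ennreal (v y powr p') * indicator S y) \<partial>HL)"
        proof (intro nn_integral_cong)
          fix y assume "y \<in> space HL"
          then have "v y powr (p' - 1) * v y = v y powr p'"
            using v_nonneg[of y] by (cases "v y = 0") (auto simp: powr_diff)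
          then show "ennreal (g y * v y) = ennreal (u powr (- 1 / p)) * (ennreal (v y powr p') * indicator S y)"
            by (auto simp: g_def mult.assoc simp flip: ennreal_mult split: split_indicator)
        qed
        also have "\<dots> = ennreal (u powr (- 1 / p)) * ennreal u"
          by (simp add: nn_integral_cmult U_def[symmetric] u)
        also have "\<dots> = ennreal (u powr (- 1 / p + 1))"
          using u powr_add[of u "- 1 / p" 1] by (simp flip: ennreal_mult)
        also have "\<dots> = wnorm S"
          using u p' eqs by (simp add: wU enn_powr_ennreal)
        finally have "(\<integral>\<^sup>+y. ennreal (g y * v y) \<partial>HL) = wnorm S" .
        then show "wnorm S \<le> 2 * (\<integral>\<^sup>+y. ennreal (g y * v y) \<partial>HL)"
          using mult_right_mono[of 1 2 "wnorm S"] by simp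
      qed (auto simp: g_def)
    qed
  qed
qed

lemma normingD:
  assumes "norming S g"
  shows "g \<in> borel_measurable HL" "0 \<le> g y" "y \<notin> S \<Longrightarrow> g y = 0"
    "(\<integral>\<^sup>+y. ennreal (g y powr p) \<partial>HL) \<le> 1" "wnorm S \<le> 2 * (\<integral>\<^sup>+y. ennreal (g y * v y) \<partial>HL)"
  using assms by (auto simp: norming_def)

lemma laplace_op_lower_bound:
  assumes i: "integrable HL (laplace_integrand lam v f x)" and [measurable]: "g \<in> borel_measurable HL"
    and g: "\<And>y. 0 \<le> y \<Longrightarrow> 0 \<le> g y \<and> g y \<le> f y"
    and x: "\<And>y. 0 \<le> y \<Longrightarrow> g y \<noteq> 0 \<Longrightarrow> x * y powr lam \<le> 1"
  shows "ennreal (exp (- 1)) * (\<integral>\<^sup>+y. ennreal (g y * v y) \<partial>HL) \<le> ennreal (laplace_op lam v f x)"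
proof -
  have f0: "0 \<le> f y" if "0 \<le> y" for y using g[OF that] by linarith
  have "ennreal (exp (- 1)) * (\<integral>\<^sup>+y. ennreal (g y * v y) \<partial>HL) = (\<integral>\<^sup>+y. ennreal (exp (- 1)) * ennreal (g y * v y) \<partial>HL)"
    by (simp add: nn_integral_cmult)
  also have "\<dots> \<le> (\<integral>\<^sup>+y. ennreal (laplace_integrand lam v f x y) \<partial>HL)"
  proof (rule nn_integral_mono)
    fix y assume "y \<in> space HL"
    then have y: "0 \<le> y" by simp
    have "exp (- 1) * (g y * v y) \<le> exp (- (x * y powr lam)) * (f y * v y)"
    proof (cases "g y = 0")
      case False
      then show ?thesis
        using x[OF y] g[OF y] v_nonneg[OF y] by (intro mult_mono) auto
    qed (use f0[OF y] v_nonneg[OF y] in simp)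
    then show "ennreal (exp (- 1)) * ennreal (g y * v y) \<le> ennreal (laplace_integrand lam v f x y)"
      using g[OF y] v_nonneg[OF y] by (simp add: laplace_integrand_def mult.assoc ennreal_leI flip: ennreal_mult)
  qed
  also have "\<dots> = ennreal (laplace_op lam v f x)"
    unfolding laplace_op_def
    using f0 v_nonneg by (intro nn_integral_eq_integral i AE_I2) (auto simp: laplace_integrand_def)
  finally show ?thesis .
qed

lemma compact_subsequence:
  assumes comp: "laplace_compact lam v (ennreal p) (ennreal q)"
    and f: "\<And>n :: nat. f n \<in> borel_measurable HL" "\<And>n. (pow_int p (f n)) \<le> 1"
  obtains g s where "g \<in> borel_measurable HL" "pow_int q g < top" "strict_mono (s :: nat \<Rightarrow> nat)"
    "(\<lambda>n. pow_int q (\<lambda>x. laplace_op lam v (f (s n)) x - g x)) \<longlonglongrightarrow> 0"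
proof -
  have "Lr_bounded (ennreal p) (range f)"
    unfolding Lr_bounded_def
  proof (intro conjI exI ballI)
    have "pow_int p (f n) < top" for n
      using f(2)[of n] by (auto intro: le_less_trans)
    then show "range f \<subseteq> Lr_space (ennreal p)" using f(1) by (auto simp: Lr_space_p_iff)
    show "Lr_norm (ennreal p) {0..} g \<le> ennreal 1" if "g \<in> range f" for g
      using that f(2) unfolding Lr_norm_p_le_iff by auto
  qed
  with comp have "Lr_relatively_compact (ennreal q) (laplace_op lam v ` range f)"
    unfolding laplace_compact_def by blast
  moreover have "range (\<lambda>n. laplace_op lam v (f n)) \<subseteq> laplace_op lam v ` range f" by auto
  ultimately obtain g and s :: "nat \<Rightarrow> nat" where g: "g \<in> Lr_space (ennreal q)" and s: "strict_mono s"
    and lim: "(\<lambda>n. Lr_norm (ennreal q) {0..} (\<lambda>x. laplace_op lam v (f (s n)) x - g x)) \<longlonglongrightarrow> 0"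
    unfolding Lr_relatively_compact_def by meson
  have "(\<lambda>n. enn_powr (Lr_norm (ennreal q) {0..} (\<lambda>x. laplace_op lam v (f (s n)) x - g x)) q) \<longlonglongrightarrow> 0"
    by (rule tendsto_enn_powr_zero[OF lim q_pos])
  then have "(\<lambda>n. pow_int q (\<lambda>x. laplace_op lam v (f (s n)) x - g x)) \<longlonglongrightarrow> 0"
    using q_pos by (simp add: Lr_norm_q_eq enn_powr_inverse')
  with s show ?thesis using g[unfolded Lr_space_q_iff] by (elim conjE) (rule that)
qed

text \<open>
  Images of a bounded sequence under a compact operator have a subsequence close to one fixed function \<open>g\<close> of
  \<open>L\<^sup>q\<close>, and \<open>g\<close> has little mass on sets \<open>E n\<close> that escape from every point \<open>x > 0\<close>. This takes the place of the
  usual argument with weakly null test functions, and it works for every \<open>p \<ge> 1\<close> and \<open>q > 0\<close>.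
\<close>

lemma compact_vanishing:
  assumes comp: "laplace_compact lam v (ennreal p) (ennreal q)"
    and f: "\<And>n :: nat. f n \<in> borel_measurable HL" "\<And>n. (pow_int p (f n)) \<le> 1"
    and E[measurable]: "\<And>n. E n \<in> sets HL" and esc: "\<And>x. 0 < x \<Longrightarrow> \<forall>\<^sub>F n in sequentially. x \<notin> E n"
  obtains s :: "nat \<Rightarrow> nat" where "strict_mono s"
    "(\<lambda>n. \<integral>\<^sup>+x. ennreal (\<bar>laplace_op lam v (f (s n)) x\<bar> powr q) * indicator (E (s n)) x \<partial>HL) \<longlonglongrightarrow> 0"
proof -
  obtain g and s :: "nat \<Rightarrow> nat" where g[measurable]: "g \<in> borel_measurable HL" and gfin: "pow_int q g < top"
    and s: "strict_mono s"
    and lim: "(\<lambda>n. pow_int q (\<lambda>x. laplace_op lam v (f (s n)) x - g x)) \<longlonglongrightarrow> 0"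
    by (rule compact_subsequence[OF comp f])
  have [measurable]: "laplace_op lam v (f n) \<in> borel_measurable HL" for n
    by (rule laplace_op_measurable[OF f(1)])
  have glim: "(\<lambda>n. \<integral>\<^sup>+x. ennreal (\<bar>g x\<bar> powr q) * indicator (E (s n)) x \<partial>HL) \<longlonglongrightarrow> (\<integral>\<^sup>+x. 0 \<partial>HL)"
  proof (rule nn_integral_dominated_convergence[where w="\<lambda>x. ennreal (\<bar>g x\<bar> powr q)"])
    show "AE x in HL. ennreal (\<bar>g x\<bar> powr q) * indicator (E (s n)) x \<le> ennreal (\<bar>g x\<bar> powr q)" for n
      by (intro AE_I2) (simp split: split_indicator)
    show "AE x in HL. (\<lambda>n. ennreal (\<bar>g x\<bar> powr q) * indicator (E (s n)) x) \<longlonglongrightarrow> 0"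
      using AE_halfline_pos
    proof eventually_elim
      fix x :: real assume "0 < x"
      from eventually_compose_filterlim[OF esc[OF this] filterlim_subseq[OF s]]
      have "\<forall>\<^sub>F n in sequentially. ennreal (\<bar>g x\<bar> powr q) * indicator (E (s n)) x = 0"
        by eventually_elim simp
      then show "(\<lambda>n. ennreal (\<bar>g x\<bar> powr q) * indicator (E (s n)) x) \<longlonglongrightarrow> 0"
        by (rule tendsto_eventually)
    qed
  qed (use gfin in auto)
  let ?D = "\<lambda>n. pow_int q (\<lambda>x. laplace_op lam v (f (s n)) x - g x)"
  let ?R = "\<lambda>n. \<integral>\<^sup>+x. ennreal (\<bar>g x\<bar> powr q) * indicator (E (s n)) x \<partial>HL"
  let ?H = "\<lambda>n. \<integral>\<^sup>+x. ennreal (\<bar>laplace_op lam v (f (s n)) x\<bar> powr q) * indicator (E (s n)) x \<partial>HL"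
  define K where "K = ennreal (2 powr q)"
  have "(\<lambda>n. K * (?D n
      + ?R n)) \<longlonglongrightarrow> K * (0 + 0)"
    using glim by (intro ennreal_tendsto_cmult tendsto_add lim) (simp_all add: K_def)
  then have lim2: "(\<lambda>n. K * (?D n
      + ?R n)) \<longlonglongrightarrow> 0" by simp
  have "(\<lambda>n. \<integral>\<^sup>+x. ennreal (\<bar>laplace_op lam v (f (s n)) x\<bar> powr q) * indicator (E (s n)) x \<partial>HL) \<longlonglongrightarrow> 0"
  proof (rule tendsto_sandwich[OF _ _ tendsto_const lim2])
    show "\<forall>\<^sub>F n in sequentially. ?H n
      \<le> K * (?D n
      + ?R n)"
    proof (rule always_eventually, rule allI)
      fix n
      have "?H n
        \<le> (\<integral>\<^sup>+x. K * (ennreal (\<bar>laplace_op lam v (f (s n)) x - g x\<bar> powr q) + ennreal (\<bar>g x\<bar> powr q) * indicator (E (s n)) x) \<partial>HL)"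
      proof (rule nn_integral_mono)
        fix x
        show "ennreal (\<bar>laplace_op lam v (f (s n)) x\<bar> powr q) * indicator (E (s n)) x
          \<le> K * (ennreal (\<bar>laplace_op lam v (f (s n)) x - g x\<bar> powr q) + ennreal (\<bar>g x\<bar> powr q) * indicator (E (s n)) x)"
          using abs_powr_add_le[OF q_pos, of "laplace_op lam v (f (s n)) x - g x" "g x"]
          by (simp add: K_def split: split_indicator)
      qed
      also have "\<dots> = K * (?D n
      + ?R n)"
        by (simp add: nn_integral_cmult nn_integral_add)
      finally show "?H n
        \<le> K * (?D n
      + ?R n)" .
    qed
  qed simp
  with s show ?thesis by (rule that)
qed

lemma compact_integrable_AE:
  assumes "laplace_compact lam v (ennreal p) (ennreal q)" "f \<in> borel_measurable HL"
    "pow_int p f < top"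
  shows "AE x in HL. integrable HL (laplace_integrand lam v f x)"
  using assms unfolding laplace_compact_def laplace_maps_def by (simp add: Lr_space_p_iff)

text \<open>
  Images of unboundedly growing size cannot have a subsequence that converges in \<open>L\<^sup>q\<close>.
\<close>

lemma compact_imp_bounded:
  assumes comp: "laplace_compact lam v (ennreal p) (ennreal q)"
  obtains B where "B < top" "\<And>f. f \<in> borel_measurable HL \<Longrightarrow> pow_int p f \<le> 1 \<Longrightarrow>
    (pow_int q (laplace_op lam v f)) \<le> B"
proof (rule ccontr)
  assume "\<not> thesis"
  then have "\<forall>n :: nat. \<exists>f. f \<in> borel_measurable HL \<and> pow_int p f \<le> 1 \<and>
    \<not> (pow_int q (laplace_op lam v f)) \<le> of_nat n"
    using that[of "of_nat _"] by (auto simp: of_nat_less_top)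
  from choice[OF this] obtain f where f: "\<And>n. f n \<in> borel_measurable HL" "\<And>n. (pow_int p (f n)) \<le> 1"
    and big: "\<And>n. \<not> (pow_int q (laplace_op lam v (f n))) \<le> of_nat n" by (elim exE) auto
  obtain g and s :: "nat \<Rightarrow> nat" where g[measurable]: "g \<in> borel_measurable HL" and gfin: "pow_int q g < top"
    and s: "strict_mono s"
    and lim: "(\<lambda>n. pow_int q (\<lambda>x. laplace_op lam v (f (s n)) x - g x)) \<longlonglongrightarrow> 0"
    by (rule compact_subsequence[OF comp f])
  have [measurable]: "laplace_op lam v (f n) \<in> borel_measurable HL" for n
    by (rule laplace_op_measurable[OF f(1)])
  define D where "D = ennreal (2 powr q) * (1 + (pow_int q g))"
  have "D < top" using gfin by (simp add: D_def ennreal_mult_less_top)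
  then obtain d where "D = ennreal d" by (auto simp: less_top_ennreal)
  then have "\<exists>m :: nat. D \<le> of_nat m"
    using real_arch_simple[of d] by (metis ennreal_leI ennreal_of_nat_eq_real_of_nat)
  then obtain m :: nat where m: "D \<le> of_nat m" by blast
  from order_tendstoD(2)[OF lim, of 1] obtain k where
    k: "\<And>n. n \<ge> k \<Longrightarrow> (pow_int q (\<lambda>x. laplace_op lam v (f (s n)) x - g x)) < 1"
    by (auto simp: eventually_sequentially)
  define n where "n = max k m"
  have "(pow_int q (laplace_op lam v (f (s n))))
     \<le> (\<integral>\<^sup>+x. ennreal (2 powr q) * (ennreal (\<bar>laplace_op lam v (f (s n)) x - g x\<bar> powr q) + ennreal (\<bar>g x\<bar> powr q)) \<partial>HL)"
  proof (rule nn_integral_mono)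
    show "ennreal (\<bar>laplace_op lam v (f (s n)) x\<bar> powr q)
      \<le> ennreal (2 powr q) * (ennreal (\<bar>laplace_op lam v (f (s n)) x - g x\<bar> powr q) + ennreal (\<bar>g x\<bar> powr q))" for x
      using abs_powr_add_le[OF q_pos, of "laplace_op lam v (f (s n)) x - g x" "g x"] by simp
  qed
  also have "\<dots> = ennreal (2 powr q) * ((pow_int q (\<lambda>x. laplace_op lam v (f (s n)) x - g x)) + (pow_int q g))"
    by (simp add: nn_integral_cmult nn_integral_add)
  also have "\<dots> \<le> D"
    unfolding D_def using k[of n] by (intro mult_left_mono add_right_mono) (auto simp: n_def)
  also have "\<dots> \<le> of_nat m" by (rule m)
  also have "\<dots> \<le> of_nat (s n)"
    using seq_suble[OF s, of n] by (simp add: n_def)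
  finally show False using big[of "s n"] by blast
qed

text \<open>
  The common form of \<open>A\<^sub>\<L>(t)\<close> for \<open>p > 1\<close> and of \<open>t\<^bsup>-\<lambda>/q\<^esup>\<close> times the essential supremum of \<open>v\<close> over \<open>(0,t)\<close> for \<open>p = 1\<close>.
\<close>

definition char_fun :: "real \<Rightarrow> ennreal" where "char_fun t = ennreal (t powr (- lam / q)) * wnorm {0<..<t}"

lemma Ioo_halfline [measurable]: "{0<..<t} \<in> sets HL"
  by (rule sets_halfline_borel) auto

text \<open>
  Take a norming function of \<open>(0,t)\<close>. On \<open>[t\<^bsup>-\<lambda>\<^esup>/2, t\<^bsup>-\<lambda>\<^esup>]\<close> the kernel is at least \<open>e\<^bsup>-1\<^esup>\<close> on its support, so
  the image has \<open>L\<^sup>q\<close> norm at least a constant times \<open>char_fun t\<close> there. These intervals escape both when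
  \<open>t \<rightarrow> 0\<close> and when \<open>t \<rightarrow> \<infinity>\<close>, and \<open>compact_vanishing\<close> applies.
\<close>

lemma char_fun_subsequence_zero:
  assumes comp: "laplace_compact lam v (ennreal p) (ennreal q)" and t: "\<And>n :: nat. t n > 0"
    and esc: "\<And>x. 0 < x \<Longrightarrow> \<forall>\<^sub>F n in sequentially. x \<notin> {t n powr - lam / 2..t n powr - lam}"
  shows "\<exists>s. strict_mono (s :: nat \<Rightarrow> nat) \<and> (\<lambda>n. char_fun (t (s n))) \<longlonglongrightarrow> 0"
proof -
  define E where "E = (\<lambda>n. {t n powr - lam / 2..t n powr - lam})"
  have E[measurable]: "E n \<in> sets HL" for n
    unfolding E_def by (rule sets_halfline_borel) (auto intro: order_trans[rotated])
  have esc': "\<forall>\<^sub>F n in sequentially. x \<notin> E n" if "0 < x" for x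
    using esc[OF that] unfolding E_def .
  have "\<forall>n. \<exists>g. norming {0<..<t n} g"
  proof
    fix n show "\<exists>g. norming {0<..<t n} g" by (rule norming_exists[where b="t n"]) auto
  qed
  from choice[OF this] obtain f where fn: "\<And>n. norming {0<..<t n} (f n)" by blast
  note f = normingD[OF fn]
  have f4: "pow_int p (f n) \<le> 1" for n using f(2,4) by simp
  have f4': "pow_int p (f n) < top" for n
    using f4[of n] by (auto intro: le_less_trans)
  obtain s :: "nat \<Rightarrow> nat" where s: "strict_mono s"
    "(\<lambda>n. \<integral>\<^sup>+x. ennreal (\<bar>laplace_op lam v (f (s n)) x\<bar> powr q) * indicator (E (s n)) x \<partial>HL) \<longlonglongrightarrow> 0"
    by (rule compact_vanishing[OF comp f(1) f4 E esc'])
  define ka where "ka = exp (- 1) / 2 * (1 / 2) powr (1 / q)"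
  have ka: "ka > 0" by (simp add: ka_def)
  have lower: "enn_powr (ennreal ka * char_fun (t n)) q \<le> (\<integral>\<^sup>+x. ennreal (\<bar>laplace_op lam v (f n) x\<bar> powr q) * indicator (E n) x \<partial>HL)" for n
  proof -
    have "AE x in HL. enn_powr (ennreal (exp (- 1) / 2) * wnorm {0<..<t n}) q * indicator (E n) x
        \<le> ennreal (\<bar>laplace_op lam v (f n) x\<bar> powr q) * indicator (E n) x"
      using compact_integrable_AE[OF comp f(1) f4']
    proof (eventually_elim)
      fix x assume i: "integrable HL (laplace_integrand lam v (f n) x)"
      show "enn_powr (ennreal (exp (- 1) / 2) * wnorm {0<..<t n}) q * indicator (E n) x
        \<le> ennreal (\<bar>laplace_op lam v (f n) x\<bar> powr q) * indicator (E n) x"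
      proof (cases "x \<in> E n")
        case True
        have "ennreal (exp (- 1)) * (\<integral>\<^sup>+y. ennreal (f n y * v y) \<partial>HL) \<le> ennreal (laplace_op lam v (f n) x)"
        proof (rule laplace_op_lower_bound[OF i f(1)])
          fix y :: real assume "f n y \<noteq> 0"
          then have "y \<in> {0<..<t n}" using f(3) by blast
          then have "0 < y" "y < t n" by auto
          then have "y powr lam \<le> t n powr lam" using lam_pos by (intro powr_mono2) auto
          then have "x * y powr lam \<le> t n powr - lam * t n powr lam"
            using True by (intro mult_mono) (auto simp: E_def)
          also have "\<dots> = 1" using t[of n] by (simp flip: powr_add)
          finally show "x * y powr lam \<le> 1" .
        qed (use f(2) in auto)
        then have "ennreal (exp (- 1) / 2) * (2 * (\<integral>\<^sup>+y. ennreal (f n y * v y) \<partial>HL)) \<le> ennreal (laplace_op lam v (f n) x)"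
          by (simp add: ennreal_numeral[symmetric] mult.assoc[symmetric] del: ennreal_numeral flip: ennreal_mult)
        then have "ennreal (exp (- 1) / 2) * wnorm {0<..<t n} \<le> ennreal \<bar>laplace_op lam v (f n) x\<bar>"
          using mult_left_mono[OF f(5)[of n], of "ennreal (exp (- 1) / 2)"]
          by (meson abs_ge_self ennreal_leI order_trans zero_le)
        then show ?thesis using True q_pos enn_powr_mono[OF q_pos] by (fastforce simp: enn_powr_ennreal)
      qed simp
    qed
    then have "(\<integral>\<^sup>+x. enn_powr (ennreal (exp (- 1) / 2) * wnorm {0<..<t n}) q * indicator (E n) x \<partial>HL)
       \<le> (\<integral>\<^sup>+x. ennreal (\<bar>laplace_op lam v (f n) x\<bar> powr q) * indicator (E n) x \<partial>HL)"
      by (rule nn_integral_mono_AE)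
    also have "(\<integral>\<^sup>+x. enn_powr (ennreal (exp (- 1) / 2) * wnorm {0<..<t n}) q * indicator (E n) x \<partial>HL)
      = enn_powr (ennreal (exp (- 1) / 2) * wnorm {0<..<t n}) q * emeasure HL (E n)"
      by (simp add: nn_integral_cmult)
    also have "emeasure HL (E n) = ennreal (1 / 2 * t n powr - lam)"
      unfolding E_def by (subst emeasure_halfline_Icc) auto
    also have "\<dots> = enn_powr (ennreal ((1 / 2) powr (1 / q) * t n powr (- lam / q))) q"
      using q_pos by (simp add: enn_powr_ennreal powr_mult powr_powr)
    also have "enn_powr (ennreal (exp (- 1) / 2) * wnorm {0<..<t n}) q * \<dots> = enn_powr (ennreal ka * char_fun (t n)) q"
    proof -
      have "ennreal ka = ennreal (exp (- 1) / 2) * ennreal ((1 / 2) powr (1 / q))"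
        unfolding ka_def by (intro ennreal_mult) auto
      then show ?thesis
        using q_pos by (simp add: enn_powr_mult[symmetric] char_fun_def ennreal_mult mult_ac)
    qed
    finally show ?thesis .
  qed
  have "(\<lambda>n. enn_powr (ennreal ka * char_fun (t (s n))) q) \<longlonglongrightarrow> 0"
    by (rule tendsto_sandwich[OF _ _ tendsto_const s(2)]) (auto intro: always_eventually lower)
  then have "(\<lambda>n. enn_powr (enn_powr (ennreal ka * char_fun (t (s n))) q) (1 / q)) \<longlonglongrightarrow> 0"
    by (rule tendsto_enn_powr_zero) (use q_pos in simp)
  then have "(\<lambda>n. ennreal (1 / ka) * (ennreal ka * char_fun (t (s n)))) \<longlonglongrightarrow> ennreal (1 / ka) * 0"
    using q_pos by (intro ennreal_tendsto_cmult) (auto simp: enn_powr_inverse)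
  then have "(\<lambda>n. char_fun (t (s n))) \<longlonglongrightarrow> 0"
    using ka by (simp add: mult.assoc[symmetric] flip: ennreal_mult)
  with s(1) show ?thesis by blast
qed

lemma compact_imp_char_fun_at_top:
  assumes comp: "laplace_compact lam v (ennreal p) (ennreal q)"
  shows "(char_fun \<longlongrightarrow> 0) at_top"
proof (rule tendsto_at_topI_sequentially)
  fix X :: "nat \<Rightarrow> real" assume X: "filterlim X at_top sequentially"
  show "(\<lambda>n. char_fun (X n)) \<longlonglongrightarrow> 0"
  proof (rule tendsto_zero_if_subsubsequences)
    fix s :: "nat \<Rightarrow> nat" assume s: "strict_mono s"
    have Xs: "filterlim (\<lambda>n. X (s n)) at_top sequentially"
      by (rule filterlim_compose[OF X filterlim_subseq[OF s]])
    \<comment> \<open>Modifying finitely many terms makes the sequence positive.\<close>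
    define t where "t = (\<lambda>n. max 1 (X (s n)))"
    have tlim: "filterlim t at_top sequentially"
      unfolding t_def by (rule filterlim_at_top_mono[OF Xs]) auto
    have "((\<lambda>n. t n powr - lam) \<longlongrightarrow> 0) sequentially"
      by (rule tendsto_neg_powr[OF _ tlim]) (use lam_pos in auto)
    then have "\<forall>\<^sub>F n in sequentially. x \<notin> {t n powr - lam / 2..t n powr - lam}" if "0 < x" for x
      using order_tendstoD(2)[of "\<lambda>n. t n powr - lam" 0 sequentially x] that
      by (auto elim: eventually_mono)
    from char_fun_subsequence_zero[OF comp _ this] obtain s' where s': "strict_mono (s' :: nat \<Rightarrow> nat)" "(\<lambda>n. char_fun (t (s' n))) \<longlonglongrightarrow> 0"
      unfolding t_def by (metis less_max_iff_disj zero_less_one)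
    have "\<forall>\<^sub>F n in sequentially. 1 \<le> X (s n)"
      using Xs by (simp add: filterlim_at_top)
    then have "\<forall>\<^sub>F n in sequentially. 1 \<le> X (s (s' n))"
      using eventually_compose_filterlim filterlim_subseq[OF s'(1)] by blast
    then have "\<forall>\<^sub>F n in sequentially. char_fun (t (s' n)) = char_fun (X (s (s' n)))"
      by eventually_elim (simp add: t_def)
    with s'(2) have "(\<lambda>n. char_fun (X (s (s' n)))) \<longlonglongrightarrow> 0" by (rule Lim_transform_eventually)
    with s'(1) show "\<exists>s'. strict_mono s' \<and> (\<lambda>n. char_fun (X (s (s' n)))) \<longlonglongrightarrow> 0" by blast
  qed
qed

lemma compact_imp_char_fun_at_right_0:
  assumes comp: "laplace_compact lam v (ennreal p) (ennreal q)"
  shows "(char_fun \<longlongrightarrow> 0) (at_right 0)"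
proof (rule tendsto_at_right_sequentially[where b=1])
  fix X :: "nat \<Rightarrow> real" assume X: "\<And>n. 0 < X n" "X \<longlonglongrightarrow> 0"
  show "(\<lambda>n. char_fun (X n)) \<longlonglongrightarrow> 0"
  proof (rule tendsto_zero_if_subsubsequences)
    fix s :: "nat \<Rightarrow> nat" assume s: "strict_mono s"
    have "(X \<circ> s) \<longlonglongrightarrow> 0" by (rule LIMSEQ_subseq_LIMSEQ[OF X(2) s])
    then have lim: "(\<lambda>n. X (s n) powr lam) \<longlonglongrightarrow> 0"
      using tendsto_powr2[of "X \<circ> s" 0 sequentially "\<lambda>_. lam" lam] lam_pos X(1)
      by (auto simp: o_def intro!: always_eventually less_imp_le)
    have "\<forall>\<^sub>F n in sequentially. x \<notin> {X (s n) powr - lam / 2..X (s n) powr - lam}" if "0 < x" for x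
    proof -
      have "\<forall>\<^sub>F n in sequentially. X (s n) powr lam < 1 / (2 * x)"
        using order_tendstoD(2)[OF lim, of "1 / (2 * x)"] that by simp
      then show ?thesis
      proof eventually_elim
        fix n assume "X (s n) powr lam < 1 / (2 * x)"
        moreover have "X (s n) powr lam > 0" using X(1)[of "s n"] by simp
        ultimately have "x < X (s n) powr - lam / 2"
          using that by (simp add: powr_minus field_simps)
        then show "x \<notin> {X (s n) powr - lam / 2..X (s n) powr - lam}" by auto
      qed
    qed
    from char_fun_subsequence_zero[OF comp _ this] X(1)
    show "\<exists>s'. strict_mono s' \<and> (\<lambda>n. char_fun (X (s (s' n)))) \<longlonglongrightarrow> 0" by simp
  qed
qed simp

text \<open>
  Between the two ends the local integrability of \<open>v\<close> suffices, by monotonicity of both factors.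
\<close>

lemma char_fun_bounded:
  assumes "(char_fun \<longlongrightarrow> 0) (at_right 0)" "(char_fun \<longlongrightarrow> 0) at_top"
  obtains B where "B < top" "\<And>t. 0 < t \<Longrightarrow> char_fun t \<le> B"
proof -
  from order_tendstoD(2)[OF assms(1), of 1] obtain a where a: "a > 0" "\<And>t. 0 < t \<Longrightarrow> t < a \<Longrightarrow> char_fun t < 1"
    by (auto simp: eventually_at_right[of 0 1])
  from order_tendstoD(2)[OF assms(2), of 1] obtain b where b: "\<And>t. b \<le> t \<Longrightarrow> char_fun t < 1"
    by (auto simp: eventually_at_top_linorder)
  define B where "B = 1 + ennreal (a powr (- lam / q)) * wnorm {0<..<b}"
  show ?thesis
  proof (rule that)
    have "wnorm {0<..<b} < top" by (rule wnorm_finite[where b=b]) auto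
    then show "B < top" by (simp add: B_def ennreal_mult_less_top)
    fix t :: real assume t: "0 < t"
    consider "t < a" | "b \<le> t" | "a \<le> t" "t < b" by linarith
    then show "char_fun t \<le> B"
    proof cases
      case 1 then have "char_fun t \<le> 1" using a(2)[OF t] by simp
      then show ?thesis unfolding B_def by (rule order_trans) simp
    next
      case 2 then have "char_fun t \<le> 1" using b[of t] by simp
      then show ?thesis unfolding B_def by (rule order_trans) simp
    next
      case 3
      have "t powr (- lam / q) \<le> a powr (- lam / q)"
        using 3 a(1) lam_pos q_pos by (intro powr_mono2') auto
      then have "char_fun t \<le> ennreal (a powr (- lam / q)) * wnorm {0<..<b}"
        unfolding char_fun_def using 3 by (intro mult_mono wnorm_mono ennreal_leI) auto
      then show ?thesis unfolding B_def by (rule order_trans) simp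
    qed
  qed
qed

lemma bconst_le_char_fun: "bconst k \<le> ennreal (2 powr (1 / q)) * char_fun (2 powr ((real_of_int k + 1) / lam))"
proof -
  have "2 powr (1 / q) * (2 powr ((real_of_int k + 1) / lam)) powr (- lam / q) = 2 powr (- real_of_int k / q)"
    using lam_pos q_pos by (simp add: powr_powr powr_add[symmetric]) (simp add: field_simps)
  then have "ennreal (2 powr (1 / q)) * char_fun (2 powr ((real_of_int k + 1) / lam))
      = ennreal (2 powr (- real_of_int k / q)) * wnorm {0<..<2 powr ((real_of_int k + 1) / lam)}"
    by (simp add: char_fun_def mult.assoc[symmetric] flip: ennreal_mult)
  moreover have "wnorm (blk k) \<le> wnorm {0<..<2 powr ((real_of_int k + 1) / lam)}"
    by (intro wnorm_mono blk_subset) auto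
  ultimately show ?thesis by (simp add: bconst_def mult_left_mono)
qed

lemma bconst_tends_zero_if_char_fun:
  assumes "(char_fun \<longlongrightarrow> 0) (at_right 0)" "(char_fun \<longlongrightarrow> 0) at_top" "e > 0"
  shows "\<exists>N. \<forall>k\<in>tail_indices N. bconst k \<le> e"
proof -
  define ka where "ka = ennreal (2 powr (1 / q))"
  have ka: "ka < top" by (simp add: ka_def)
  have lim: "((\<lambda>t. ka * char_fun t) \<longlongrightarrow> 0) (at_right 0)" "((\<lambda>t. ka * char_fun t) \<longlongrightarrow> 0) at_top"
    using ennreal_tendsto_cmult[OF ka assms(1)] ennreal_tendsto_cmult[OF ka assms(2)] by auto
  from order_tendstoD(2)[OF lim(1) assms(3)] obtain a where a: "a > 0" "\<And>t. 0 < t \<Longrightarrow> t < a \<Longrightarrow> ka * char_fun t < e"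
    by (auto simp: eventually_at_right[of 0 1])
  from order_tendstoD(2)[OF lim(2) assms(3)] obtain b where b: "\<And>t. b \<le> t \<Longrightarrow> ka * char_fun t < e"
    by (auto simp: eventually_at_top_linorder)
  define b' where "b' = max 1 b"
  obtain N1 :: nat where N1: "lam * log 2 b' \<le> real N1" using real_arch_simple by blast
  obtain N2 :: nat where N2: "2 - lam * log 2 a \<le> real N2" using real_arch_simple by blast
  show ?thesis
  proof (intro exI ballI)
    fix k assume "k \<in> tail_indices (max N1 N2)"
    then have k: "int (max N1 N2) \<le> \<bar>k\<bar>" by (simp add: tail_indices_def)
    define t where "t = 2 powr ((real_of_int k + 1) / lam)"
    have "t \<ge> b \<or> t < a"
    proof (cases "k \<ge> 0")
      case True
      then have "real N1 \<le> real_of_int k" using k by linarith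
      then have "log 2 b' \<le> (real_of_int k + 1) / lam" using N1 lam_pos by (simp add: field_simps)
      then have "2 powr log 2 b' \<le> t" unfolding t_def by (intro powr_mono) auto
      then show ?thesis by (simp add: b'_def)
    next
      case False
      then have "real N2 \<le> - real_of_int k" using k by linarith
      then have "(real_of_int k + 1) / lam < log 2 a" using N2 lam_pos by (simp add: field_simps)
      then have "t < 2 powr log 2 a" unfolding t_def by (intro powr_less_mono) auto
      then show ?thesis using a(1) by simp
    qed
    moreover have "t > 0" by (simp add: t_def)
    ultimately have "ka * char_fun t < e" using a b by auto
    then show "bconst k \<le> e" using bconst_le_char_fun[of k] by (simp add: ka_def t_def)
  qed
qed

lemma compact_iff_char_fun:
  assumes "p \<le> q"
  shows "laplace_compact lam v (ennreal p) (ennreal q) \<longleftrightarrow> (char_fun \<longlongrightarrow> 0) (at_right 0) \<and> (char_fun \<longlongrightarrow> 0) at_top"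
  using compact_imp_char_fun_at_right_0 compact_imp_char_fun_at_top compact_if_p_le_q[OF assms] bconst_tends_zero_if_char_fun by blast

text \<open>
  Superpose norming functions \<open>g k\<close> of the blocks with coefficients proportional to \<open>bconst k\<close> to the power
  \<open>q/(p-q)\<close>, the extremal choice in Hoelder's inequality between \<open>l\<^sup>p\<close> and \<open>l\<^sup>r\<close>. On \<open>x\<close> about \<open>2\<^bsup>-k-2\<^esup>\<close> the
  \<open>k\<close>-th summand alone gives a lower bound for the image. With \<open>R\<close> the sum of \<open>bconst k\<close> to the power \<open>r\<close>
  over finitely many \<open>k\<close>, boundedness yields that \<open>R\<^bsup>1-q/p\<^esup>\<close> is bounded independently of the chosen range.
\<close>

lemma compact_imp_bconst_summable:
  assumes comp: "laplace_compact lam v (ennreal p) (ennreal q)" and qp: "q < p"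
  shows "(ISUM k. enn_powr (bconst k) (p * q / (p - q))) < top"
proof -
  define r where "r = p * q / (p - q)"
  have r: "r > 0" using qp q_pos by (simp add: r_def)
  obtain B where B: "B < top" "\<And>f. f \<in> borel_measurable HL \<Longrightarrow> pow_int p f \<le> 1 \<Longrightarrow>
    (pow_int q (laplace_op lam v f)) \<le> B"
    using compact_imp_bounded[OF comp] by blast
  have "\<exists>g. norming (blk k) g" for k
    by (rule norming_exists[of "blk k" "2 powr ((real_of_int k + 1) / lam)"]) (use blk_subset[of k] in auto)
  then have "\<forall>k. \<exists>g. norming (blk k) g" by blast
  from choice[OF this] obtain g where gn: "\<And>k. norming (blk k) (g k)" by blast
  note g[measurable] = normingD(1)[OF gn] and g0 = normingD(2,3)[OF gn] and gp = normingD(4)[OF gn] and gw = normingD(5)[OF gn]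
  define cr where "cr = (\<lambda>k. enn2real (bconst k))"
  have cr: "bconst k = ennreal (cr k)" "cr k \<ge> 0" for k using bconst_finite[of k] by (auto simp: cr_def)
  define ka where "ka = (exp (- 1) / 2) powr q / 4"
  have ka: "ka > 0" by (simp add: ka_def)
  have main: "ennreal (\<Sum>k\<in>- tail_indices N. cr k powr r) \<le> enn_powr (ennreal (1 / ka) * B) (p / (p - q))" for N
  proof (cases "(\<Sum>k\<in>- tail_indices N. cr k powr r) = 0")
    case False
    let ?J = "- tail_indices N"
    define R where "R = (\<Sum>k\<in>?J. cr k powr r)"
    have R: "R > 0" using False by (simp add: R_def less_le sum_nonneg)
    note fin = finite_compl_tail_indices[of N]
    \<comment> \<open>These coefficients have unit norm in the sequence space of exponent \<open>p\<close>.\<close>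
    define al where "al = (\<lambda>k. cr k powr (q / (p - q)) * R powr (- 1 / p))"
    have al0: "al k \<ge> 0" for k by (simp add: al_def)
    have alp: "al k powr p = cr k powr r / R" for k
      using R qp q_pos by (simp add: al_def powr_mult powr_powr r_def powr_neg_one mult_ac)
    define f where "f = (\<lambda>y. \<Sum>k\<in>?J. al k * g k y)"
    have f[measurable]: "f \<in> borel_measurable HL" unfolding f_def by measurable
    have disj: "g k y = 0 \<or> g k' y = 0" if "k \<noteq> k'" for k k' y
      using g0(2)[of y k] g0(2)[of y k'] that by (auto simp: dyadic_block_def)
    have fpow: "\<bar>f y\<bar> powr p = (\<Sum>k\<in>?J. al k powr p * g k y powr p)" for y
    proof (cases "\<exists>k\<in>?J. g k y \<noteq> 0")
      case True
      then obtain k0 where k0: "k0 \<in> ?J" "g k0 y \<noteq> 0" by blast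
      then have z: "g k y = 0" if "k \<noteq> k0" for k using disj[OF that, of y] by auto
      have "f y = al k0 * g k0 y"
        unfolding f_def using fin k0 z by (subst sum.remove[of _ k0]) auto
      moreover have "(\<Sum>k\<in>?J. al k powr p * g k y powr p) = al k0 powr p * g k0 y powr p"
        using fin k0 z p_ge_1 by (subst sum.remove[of _ k0]) auto
      ultimately show ?thesis using g0(1)[of k0 y] al0[of k0] by (simp add: powr_mult)
    next
      case False
      then have "f y = 0" "(\<Sum>k\<in>?J. al k powr p * g k y powr p) = 0" using p_ge_1 by (auto simp: f_def)
      then show ?thesis using p_ge_1 by simp
    qed
    have "pow_int p f = (\<Sum>k\<in>?J. ennreal (al k powr p) * (\<integral>\<^sup>+y. ennreal (g k y powr p) \<partial>HL))"
      unfolding fpow by (simp add: sum_ennreal[symmetric] ennreal_mult nn_integral_sum nn_integral_cmult del: sum_ennreal)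
    also have "\<dots> \<le> (\<Sum>k\<in>?J. ennreal (al k powr p) * 1)"
      by (intro sum_mono mult_left_mono gp) auto
    also have "\<dots> = ennreal (\<Sum>k\<in>?J. cr k powr r / R)"
      using R by (simp add: alp)
    also have "(\<Sum>k\<in>?J. cr k powr r / R) = 1"
      using R by (simp add: R_def sum_divide_distrib[symmetric])
    finally have f1: "pow_int p f \<le> 1" by simp
    have f1': "pow_int p f < top" using f1 by (auto intro: le_less_trans)
    define h where "h = (\<lambda>x. ennreal (\<bar>laplace_op lam v f x\<bar> powr q))"
    have [measurable]: "laplace_op lam v f \<in> borel_measurable HL" by (rule laplace_op_measurable) simp
    have [measurable]: "h \<in> borel_measurable HL" unfolding h_def by measurable
    have lower: "ennreal (ka * (al k * cr k) powr q) \<le> (\<integral>\<^sup>+x. h x * indicator (dyadic_block 1 (- k - 2)) x \<partial>HL)"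
      if k: "k \<in> ?J" for k
    proof -
      have "AE x in HL. enn_powr (ennreal (exp (- 1) / 2 * al k) * wnorm (blk k)) q * indicator (dyadic_block 1 (- k - 2)) x
         \<le> h x * indicator (dyadic_block 1 (- k - 2)) x"
        using compact_integrable_AE[OF comp f f1']
      proof eventually_elim
        fix x assume i: "integrable HL (laplace_integrand lam v f x)"
        show "enn_powr (ennreal (exp (- 1) / 2 * al k) * wnorm (blk k)) q * indicator (dyadic_block 1 (- k - 2)) x
         \<le> h x * indicator (dyadic_block 1 (- k - 2)) x"
        proof (cases "x \<in> dyadic_block 1 (- k - 2)")
          case True
          then have x: "0 < x" "x < 2 powr (- 1 - real_of_int k)" by (auto simp: mem_dyadic_block_iff)
          have "ennreal (exp (- 1)) * (\<integral>\<^sup>+y. ennreal (al k * g k y * v y) \<partial>HL) \<le> ennreal (laplace_op lam v f x)"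
          proof (rule laplace_op_lower_bound[OF i])
            show "0 \<le> al k * g k y \<and> al k * g k y \<le> f y" for y
              unfolding f_def using fin k al0 g0(1) by (auto intro!: member_le_sum[of k ?J "\<lambda>k. al k * g k y"])
            fix y assume "al k * g k y \<noteq> 0"
            then have "y \<in> blk k" using g0(2)[of y k] by auto
            then have "y powr lam \<le> 2 powr (real_of_int k + 1)" by (auto simp: mem_dyadic_block_iff)
            then have "x * y powr lam \<le> 2 powr (- 1 - real_of_int k) * 2 powr (real_of_int k + 1)"
              using x by (intro mult_mono) auto
            also have "\<dots> = 1" by (simp add: powr_add[symmetric])
            finally show "x * y powr lam \<le> 1" .
          qed measurable
          also have "(\<integral>\<^sup>+y. ennreal (al k * g k y * v y) \<partial>HL) = ennreal (al k) * (\<integral>\<^sup>+y. ennreal (g k y * v y) \<partial>HL)"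
            using al0[of k] by (simp add: nn_integral_cmult[symmetric] ennreal_mult' mult.assoc)
          finally have "ennreal (exp (- 1) / 2 * al k) * (2 * (\<integral>\<^sup>+y. ennreal (g k y * v y) \<partial>HL)) \<le> ennreal (laplace_op lam v f x)"
            using al0[of k] by (simp add: ennreal_numeral[symmetric] mult.assoc[symmetric] del: ennreal_numeral flip: ennreal_mult)
          then have "ennreal (exp (- 1) / 2 * al k) * wnorm (blk k) \<le> ennreal \<bar>laplace_op lam v f x\<bar>"
            using mult_left_mono[OF gw[of k], of "ennreal (exp (- 1) / 2 * al k)"]
            by (meson abs_ge_self ennreal_leI order_trans zero_le)
          from enn_powr_mono[OF q_pos this] show ?thesis using True q_pos by (simp add: h_def enn_powr_ennreal)
        qed simp
      qed
      then have "(\<integral>\<^sup>+x. enn_powr (ennreal (exp (- 1) / 2 * al k) * wnorm (blk k)) q * indicator (dyadic_block 1 (- k - 2)) x \<partial>HL)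
        \<le> (\<integral>\<^sup>+x. h x * indicator (dyadic_block 1 (- k - 2)) x \<partial>HL)"
        by (rule nn_integral_mono_AE)
      also have "(\<integral>\<^sup>+x. enn_powr (ennreal (exp (- 1) / 2 * al k) * wnorm (blk k)) q * indicator (dyadic_block 1 (- k - 2)) x \<partial>HL)
        = enn_powr (ennreal (exp (- 1) / 2 * al k) * wnorm (blk k)) q * ennreal (2 powr (- real_of_int k - 2))"
        by (simp add: nn_integral_cmult emeasure_dyadic_block_1)
      also have "2 powr (- real_of_int k - 2) = 1 / 4 * (2 powr (- real_of_int k / q)) powr q"
        using q_pos by (simp add: powr_powr powr_diff)
      also have "ennreal (1 / 4 * (2 powr (- real_of_int k / q)) powr q) = ennreal (1 / 4) * enn_powr (ennreal (2 powr (- real_of_int k / q))) q"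
        using q_pos by (simp add: enn_powr_ennreal flip: ennreal_mult)
      also have "enn_powr (ennreal (exp (- 1) / 2 * al k) * wnorm (blk k)) q * (ennreal (1 / 4) * enn_powr (ennreal (2 powr (- real_of_int k / q))) q)
        = ennreal (1 / 4) * enn_powr (ennreal (exp (- 1) / 2 * al k) * bconst k) q"
        using q_pos by (simp add: enn_powr_mult[symmetric] bconst_def mult_ac)
      also have "\<dots> = ennreal (ka * (al k * cr k) powr q)"
      proof -
        have "ennreal (exp (- 1) / 2 * al k) * bconst k = ennreal (exp (- 1) / 2 * (al k * cr k))"
          using al0[of k] cr[of k] by (simp add: mult.assoc flip: ennreal_mult)
        then have "enn_powr (ennreal (exp (- 1) / 2 * al k) * bconst k) q = ennreal ((exp (- 1) / 2 * (al k * cr k)) powr q)"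
          using al0[of k] cr[of k] q_pos by (simp only:) (rule enn_powr_ennreal, auto)
        also have "(exp (- 1) / 2 * (al k * cr k)) powr q = (exp (- 1) / 2) powr q * (al k * cr k) powr q"
          by (rule powr_mult)
        finally show ?thesis by (simp add: ka_def flip: ennreal_mult)
      qed
      finally show ?thesis .
    qed
    have alc: "(al k * cr k) powr q = R powr (- q / p) * cr k powr r" for k
    proof -
      have "q + q * q / (p - q) = r" using qp by (simp add: r_def field_simps)
      then show ?thesis
        by (simp add: al_def powr_mult powr_powr powr_add[symmetric] mult_ac)
    qed
    have "ennreal (ka * R powr (1 - q / p)) = (\<Sum>k\<in>?J. ennreal (ka * (al k * cr k) powr q))"
    proof -
      have "(\<Sum>k\<in>?J. ka * (al k * cr k) powr q) = ka * (R powr (- q / p) * R)"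
        by (simp add: alc R_def sum_distrib_left)
      also have "R powr (- q / p) * R = R powr (1 - q / p)"
        using R by (simp add: powr_diff powr_minus field_simps)
      finally show ?thesis using ka by (simp add: sum_ennreal)
    qed
    also have "\<dots> \<le> (\<Sum>k\<in>?J. \<integral>\<^sup>+x. h x * indicator (dyadic_block 1 (- k - 2)) x \<partial>HL)"
      by (rule sum_mono[OF lower])
    also have "\<dots> = (ISUM k. (\<integral>\<^sup>+x. h x * indicator (dyadic_block 1 (- k - 2)) x \<partial>HL) * indicator ?J k)"
      using fin by (subst nn_integral_count_space'[of ?J]) auto
    also have "\<dots> \<le> (ISUM k. (\<integral>\<^sup>+x. h x * indicator (dyadic_block 1 (- k - 2)) x \<partial>HL))"
      by (intro nn_integral_mono) (auto split: split_indicator)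
    also have "\<dots> = (ISUM k. (\<integral>\<^sup>+x. h x * indicator (dyadic_block 1 k) x \<partial>HL))"
      by (rule nn_integral_bij_count_space) (rule bij_betwI[where g="\<lambda>m. - m - 2"], auto)
    also have "\<dots> = (\<integral>\<^sup>+x. h x \<partial>HL)"
      by (rule nn_integral_dyadic_blocks[symmetric]) simp
    also have "\<dots> \<le> B" unfolding h_def by (rule B(2)[OF f f1])
    finally have "ennreal (1 / ka) * ennreal (ka * R powr (1 - q / p)) \<le> ennreal (1 / ka) * B"
      by (intro mult_left_mono) auto
    then have "ennreal (R powr (1 - q / p)) \<le> ennreal (1 / ka) * B"
      using ka by (simp flip: ennreal_mult)
    then have "enn_powr (ennreal (R powr (1 - q / p))) (p / (p - q)) \<le> enn_powr (ennreal (1 / ka) * B) (p / (p - q))"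
      using qp q_pos by (intro enn_powr_mono) auto
    moreover have "(1 - q / p) * (p / (p - q)) = 1" using qp q_pos by (simp add: field_simps)
    then have "enn_powr (ennreal (R powr (1 - q / p))) (p / (p - q)) = ennreal R"
      using qp q_pos R by (simp add: enn_powr_ennreal powr_powr)
    ultimately show ?thesis by (simp add: R_def)
  qed simp
  have "(ISUM k. enn_powr (bconst k) r) \<le> enn_powr (ennreal (1 / ka) * B) (p / (p - q))"
  proof (rule Fatou_AE_bound[where u="\<lambda>N k. enn_powr (bconst k) r * indicator (- tail_indices N) k"])
    show "AE k in idx. (\<lambda>N. enn_powr (bconst k) r * indicator (- tail_indices N) k) \<longlonglongrightarrow> enn_powr (bconst k) r"
    proof (rule AE_I2, rule tendsto_eventually)
      fix k
      show "\<forall>\<^sub>F N in sequentially. enn_powr (bconst k) r * indicator (- tail_indices N) k = enn_powr (bconst k) r"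
        unfolding eventually_sequentially
        by (intro exI[of _ "nat (\<bar>k\<bar> + 1)"]) (auto simp: tail_indices_def split: split_indicator)
    qed
    fix N
    note fin = finite_compl_tail_indices[of N]
    have "(ISUM k. enn_powr (bconst k) r * indicator (- tail_indices N) k) = (\<Sum>k\<in>- tail_indices N. enn_powr (bconst k) r)"
      using fin by (subst nn_integral_count_space'[of "- tail_indices N"]) auto
    also have "\<dots> = ennreal (\<Sum>k\<in>- tail_indices N. cr k powr r)"
      using r cr by (simp add: enn_powr_ennreal)
    finally show "(ISUM k. enn_powr (bconst k) r * indicator (- tail_indices N) k) \<le> enn_powr (ennreal (1 / ka) * B) (p / (p - q))"
      using main[of N] by simp
  qed auto
  also have "\<dots> < top"
    using B(1) qp q_pos by (simp add: enn_powr_less_top_iff ennreal_mult_less_top)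
  finally show ?thesis by (simp add: r_def)
qed

end

section \<open>Comparison with the integral quantities\<close>

text \<open>
  The distribution function of a finite measure with density on the half-line is continuous, since points are
  null sets, and runs from \<open>0\<close> to the total mass.
\<close>

lemma half_mass_point:
  fixes rho :: "real \<Rightarrow> ennreal"
  assumes [measurable]: "rho \<in> borel_measurable (lebesgue_on {0..})"
    and u: "(\<integral>\<^sup>+y. rho y \<partial>lebesgue_on {0..}) = ennreal u" "u > 0"
  obtains m where "(\<integral>\<^sup>+y. rho y * indicator {..m} y \<partial>lebesgue_on {0..}) = ennreal (u / 2)"
    "(\<integral>\<^sup>+y. rho y * indicator {m<..} y \<partial>lebesgue_on {0..}) = ennreal (u / 2)"
proof -
  define nu where "nu = distr (density (lebesgue_on {0..}) rho) borel (\<lambda>x. x)"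
  have id[measurable]: "(\<lambda>x. x) \<in> density (lebesgue_on {0..}) rho \<rightarrow>\<^sub>M borel" by simp
  have em: "emeasure nu A = (\<integral>\<^sup>+y. rho y * indicator A y \<partial>lebesgue_on {0..})" if A: "A \<in> sets borel" for A
  proof -
    have [measurable]: "A \<inter> {0..} \<in> sets (lebesgue_on {0..})" using A by (intro sets_halfline_borel) auto
    have "emeasure nu A = emeasure (density (lebesgue_on {0..}) rho) (A \<inter> {0..})"
      unfolding nu_def using A by (subst emeasure_distr) auto
    also have "\<dots> = (\<integral>\<^sup>+y. rho y * indicator (A \<inter> {0..}) y \<partial>lebesgue_on {0..})"
      by (rule emeasure_density) auto
    also have "\<dots> = (\<integral>\<^sup>+y. rho y * indicator A y \<partial>lebesgue_on {0..})"
      by (intro nn_integral_cong) (auto split: split_indicator)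
    finally show ?thesis .
  qed
  have tot: "emeasure nu (space nu) = ennreal u" using em[of UNIV] u by (simp add: nu_def)
  have "finite_measure nu" by (rule finite_measureI) (simp add: tot)
  then interpret nu: finite_borel_measure nu
    by (simp add: finite_borel_measure_def finite_borel_measure_axioms_def nu_def)
  have "isCont (cdf nu) x" for x
  proof -
    have "AE y in lebesgue. y \<noteq> x" by (rule AE_completion) (rule AE_lborel_singleton)
    then have "AE y in lebesgue_on {0..}. rho y * indicator {x} y = 0"
      by (auto simp: AE_restrict_space_iff elim!: eventually_mono)
    then have "emeasure nu {x} = 0" by (simp add: em nn_integral_0_iff_AE)
    then show ?thesis by (simp add: nu.isCont_cdf measure_def)
  qed
  then have cont: "continuous_on S (cdf nu)" for S by (simp add: continuous_at_imp_continuous_on)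
  have "eventually (\<lambda>x. cdf nu x < u / 2) at_bot"
    using order_tendstoD(2)[OF nu.cdf_lim_at_bot, of "u / 2"] u by simp
  then obtain a where a: "cdf nu a < u / 2" by (auto simp: eventually_at_bot_linorder)
  have mu: "measure nu (space nu) = u" using tot u by (simp add: measure_def)
  have "eventually (\<lambda>x. u / 2 < cdf nu x) at_top"
    using order_tendstoD(1)[OF nu.cdf_lim_at_top, of "u / 2"] u by (simp add: mu)
  then obtain b where b: "a \<le> b" "u / 2 < cdf nu b"
    by (auto simp: eventually_at_top_linorder) (meson max.cobounded1 max.cobounded2)
  obtain m where m: "cdf nu m = u / 2"
    using IVT'[of "cdf nu" a "u / 2" b] a b cont by auto
  have "emeasure nu {..m} = ennreal (u / 2)"
    using m unfolding cdf_def by (simp only: nu.emeasure_eq_measure)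
  moreover have "emeasure nu {m<..} = ennreal (u / 2)"
  proof -
    have "measure nu (space nu - {..m}) = measure nu (space nu) - measure nu {..m}"
      by (rule nu.finite_measure_compl) (simp add: nu_def)
    moreover have "space nu - {..m} = {m<..}" by (auto simp: nu_def)
    ultimately have "measure nu {m<..} = u / 2" using m by (simp add: cdf_def mu)
    then show ?thesis by (simp only: nu.emeasure_eq_measure)
  qed
  ultimately show ?thesis by (intro that[of m]) (simp_all add: em)
qed

context laplace_weight
begin

lemma powr_on_blk:
  assumes "y \<in> blk k" "a \<ge> 0"
  shows "2 powr (- (real_of_int k + 1) * a) \<le> y powr (- lam * a)" "y powr (- lam * a) \<le> 2 powr (- real_of_int k * a)"
proof -
  have y: "0 < y" "2 powr real_of_int k \<le> y powr lam" "y powr lam \<le> 2 powr (real_of_int k + 1)"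
    using assms(1) by (auto simp: mem_dyadic_block_iff)
  then have pos: "0 < y powr lam" by simp
  have eq: "y powr (- lam * a) = (y powr lam) powr (- a)" by (simp add: powr_powr)
  have "(2 powr (real_of_int k + 1)) powr (- a) \<le> (y powr lam) powr (- a)"
    using y pos assms(2) by (intro powr_mono2') auto
  then show "2 powr (- (real_of_int k + 1) * a) \<le> y powr (- lam * a)"
    unfolding eq by (simp only: powr_powr mult_minus_left mult_minus_right)
  have "(y powr lam) powr (- a) \<le> (2 powr real_of_int k) powr (- a)"
    using y assms(2) by (intro powr_mono2') auto
  then show "y powr (- lam * a) \<le> 2 powr (- real_of_int k * a)"
    unfolding eq by (simp add: powr_powr)
qed

lemma dyadic_weight_shift:
  assumes "j \<le> k"
  shows "ennreal (2 powr (- real_of_int k * a)) = geom a (j - k) * ennreal (2 powr (- real_of_int j * a))"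
proof -
  have "- real_of_int k * a = - a * \<bar>real_of_int (j - k)\<bar> + - real_of_int j * a"
    using assms by (simp add: algebra_simps)
  then have "2 powr (- real_of_int k * a) = 2 powr (- a * \<bar>real_of_int (j - k)\<bar>) * 2 powr (- real_of_int j * a)"
    by (simp only: powr_add)
  then show ?thesis by (simp only: ennreal_mult powr_ge_zero)
qed

lemma enn_powr_bconst:
  assumes "a > 0" shows "enn_powr (bconst k) a = ennreal (2 powr (- real_of_int k * (a / q))) * enn_powr (wnorm (blk k)) a"
  using assms by (simp add: bconst_def enn_powr_mult enn_powr_ennreal powr_powr)

lemma wnorm_Ioo_measurable [measurable]: "(\<lambda>t. wnorm {0<..<t}) \<in> borel_measurable HL"
proof -
  have "mono (\<lambda>t. wnorm {0<..<t})" by (intro monoI wnorm_mono) auto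
  then have [measurable]: "(\<lambda>t. wnorm {0<..<t}) \<in> borel_measurable borel" by (rule borel_measurable_mono_ennreal)
  show ?thesis by measurable
qed

lemma char_fun_measurable [measurable]: "char_fun \<in> borel_measurable HL"
  unfolding char_fun_def[abs_def] by measurable

subsection \<open>The range \<open>p > 1\<close>\<close>

text \<open>
  Up to the power \<open>1/p'\<close> these are \<open>wnorm (blk k)\<close> and \<open>wnorm\<close> of the interval that ends with block \<open>k\<close>. All
  comparisons with the integral quantities below are between the masses of the blocks and their partial sums.
\<close>

definition blk_mass :: "int \<Rightarrow> ennreal" where
  "blk_mass k = (\<integral>\<^sup>+y. ennreal (v y powr conj_exp p) * indicator (blk k) y \<partial>HL)"

definition cum_mass :: "int \<Rightarrow> ennreal" where "cum_mass k = V0 p v (2 powr ((real_of_int k + 1) / lam))"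

lemma V0_eq: "V0 p v t = (\<integral>\<^sup>+y. ennreal (v y powr conj_exp p) * indicator {0<..<t} y \<partial>HL)"
  unfolding V0_def by (rule nn_integral_lebesgue_on_subset) simp

lemma V0_mono: "t \<le> t' \<Longrightarrow> V0 p v t \<le> V0 p v t'"
  unfolding V0_eq by (intro nn_integral_mono) (auto split: split_indicator)

lemma wnorm_Ioo_eq_V0: "1 < p \<Longrightarrow> wnorm {0<..<t} = enn_powr (V0 p v t) (1 / conj_exp p)"
  by (simp add: wnorm_eq_integral V0_eq)

lemma V0_finite:
  assumes "1 < p" shows "V0 p v t < top"
proof -
  have "wnorm {0<..<t} < top" by (rule wnorm_finite[where b=t]) auto
  then show ?thesis using conj_exp_gt_1[OF assms] by (simp add: wnorm_Ioo_eq_V0[OF assms] enn_powr_less_top_iff)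
qed

lemma V0_measurable [measurable]: "V0 p v \<in> borel_measurable HL"
proof -
  have "mono (V0 p v)" by (intro monoI V0_mono)
  then have [measurable]: "V0 p v \<in> borel_measurable borel" by (rule borel_measurable_mono_ennreal)
  show ?thesis by measurable
qed

lemma enn_powr_wnorm_blk:
  assumes "1 < p" "a > 0" shows "enn_powr (wnorm (blk k)) a = enn_powr (blk_mass k) (a / conj_exp p)"
  using assms conj_exp_gt_1[OF assms(1)] by (simp add: wnorm_eq_integral[OF assms(1)] blk_mass_def enn_powr_powr)

lemma blk_mass_le_cum_mass: "blk_mass k \<le> cum_mass k"
  unfolding blk_mass_def cum_mass_def V0_eq using blk_subset[of k]
  by (intro nn_integral_mono) (auto split: split_indicator)

lemma cum_mass_mono: "j \<le> k \<Longrightarrow> cum_mass j \<le> cum_mass k"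
  unfolding cum_mass_def using lam_pos by (intro V0_mono powr_mono divide_right_mono) auto

lemma V0_le_cum_mass: "t \<in> blk k \<Longrightarrow> V0 p v t \<le> cum_mass k"
  unfolding cum_mass_def using blk_subset[of k] by (intro V0_mono) auto

lemma cum_mass_le_sum: "cum_mass k \<le> (ISUM j. blk_mass j * indicator {..k} j)"
proof -
  have "cum_mass k = (ISUM j. (\<integral>\<^sup>+y. ennreal (v y powr conj_exp p) * indicator {0<..<2 powr ((real_of_int k + 1) / lam)} y * indicator (blk j) y \<partial>HL))"
    unfolding cum_mass_def V0_eq by (rule nn_integral_dyadic_blocks) measurable
  also have "\<dots> \<le> (ISUM j. blk_mass j * indicator {..k} j)"
  proof (rule nn_integral_mono)
    fix j
    have *: "j \<le> k" if "y \<in> blk j" "y < 2 powr ((real_of_int k + 1) / lam)" for y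
    proof -
      have y: "0 < y" "2 powr real_of_int j \<le> y powr lam" using that by (auto simp: mem_dyadic_block_iff)
      note y(2)
      also have "y powr lam < (2 powr ((real_of_int k + 1) / lam)) powr lam"
        using that y lam_pos by (intro powr_less_mono2) auto
      also have "\<dots> = 2 powr (real_of_int k + 1)"
        using lam_pos by (simp add: powr_powr)
      finally show ?thesis by simp
    qed
    have "(\<integral>\<^sup>+y. ennreal (v y powr conj_exp p) * indicator {0<..<2 powr ((real_of_int k + 1) / lam)} y * indicator (blk j) y \<partial>HL)
      \<le> (\<integral>\<^sup>+y. (ennreal (v y powr conj_exp p) * indicator (blk j) y) * indicator {..k} j \<partial>HL)"
      using * by (intro nn_integral_mono) (auto split: split_indicator)
    also have "\<dots> = blk_mass j * indicator {..k} j"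
      unfolding blk_mass_def by (rule nn_integral_multc) measurable
    finally show "(\<integral>\<^sup>+y. ennreal (v y powr conj_exp p) * indicator {0<..<2 powr ((real_of_int k + 1) / lam)} y * indicator (blk j) y \<partial>HL)
      \<le> blk_mass j * indicator {..k} j" .
  qed
  finally show ?thesis .
qed

text \<open>
  The integral that defines \<open>B\<^sub>\<L>\<close>, with the exponent \<open>s = r/q'\<close> of \<open>V\<^sub>0\<close> as a free parameter. In the application
  \<open>s + 1 = r/p'\<close>, and \<open>s\<close> has the sign of \<open>q - 1\<close>.
\<close>

definition B_integral :: "real \<Rightarrow> real \<Rightarrow> ennreal" where
  "B_integral r s = (\<integral>\<^sup>+t. ennreal (t powr (- lam * r / q)) * enn_powr (V0 p v t) s * ennreal (v t powr conj_exp p) \<partial>HL)"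

lemma B_integral_blocks:
  "B_integral r s = (ISUM k. (\<integral>\<^sup>+t. ennreal (t powr (- lam * r / q)) * enn_powr (V0 p v t) s * ennreal (v t powr conj_exp p) * indicator (blk k) t \<partial>HL))"
  unfolding B_integral_def by (rule nn_integral_dyadic_blocks) measurable

lemma B_integral_ge:
  assumes "r > 0" and le: "\<And>k. ka * X k \<le> (\<integral>\<^sup>+t. enn_powr (V0 p v t) s * (ennreal (v t powr conj_exp p) * indicator (blk k) t) \<partial>HL)"
  shows "ennreal (2 powr (- r / q)) * ka * (ISUM k. ennreal (2 powr (- real_of_int k * (r / q))) * X k) \<le> B_integral r s"
proof -
  have "ennreal (2 powr (- r / q)) * ka * (ISUM k. ennreal (2 powr (- real_of_int k * (r / q))) * X k)
    = (ISUM k. ennreal (2 powr (- r / q)) * ka * (ennreal (2 powr (- real_of_int k * (r / q))) * X k))"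
    by (simp add: nn_integral_cmult)
  also have "\<dots> \<le> B_integral r s"
    unfolding B_integral_blocks
  proof (rule nn_integral_mono)
    fix k
    have "2 powr (- r / q) * 2 powr (- real_of_int k * (r / q)) = 2 powr (- (real_of_int k + 1) * (r / q))"
      by (simp add: powr_add[symmetric] algebra_simps)
    then have "ennreal (2 powr (- r / q)) * ka * (ennreal (2 powr (- real_of_int k * (r / q))) * X k)
      = ennreal (2 powr (- (real_of_int k + 1) * (r / q))) * (ka * X k)"
      by (simp add: mult_ac flip: ennreal_mult)
    also have "\<dots> \<le> ennreal (2 powr (- (real_of_int k + 1) * (r / q))) * (\<integral>\<^sup>+t. enn_powr (V0 p v t) s * (ennreal (v t powr conj_exp p) * indicator (blk k) t) \<partial>HL)"
      by (intro mult_left_mono le) auto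
    also have "\<dots> = (\<integral>\<^sup>+t. ennreal (2 powr (- (real_of_int k + 1) * (r / q))) * (enn_powr (V0 p v t) s * (ennreal (v t powr conj_exp p) * indicator (blk k) t)) \<partial>HL)"
      by (rule nn_integral_cmult[symmetric]) measurable
    also have "\<dots> \<le> (\<integral>\<^sup>+t. ennreal (t powr (- lam * r / q)) * enn_powr (V0 p v t) s * ennreal (v t powr conj_exp p) * indicator (blk k) t \<partial>HL)"
    proof (rule nn_integral_mono)
      fix t
      show "ennreal (2 powr (- (real_of_int k + 1) * (r / q))) * (enn_powr (V0 p v t) s * (ennreal (v t powr conj_exp p) * indicator (blk k) t))
        \<le> ennreal (t powr (- lam * r / q)) * enn_powr (V0 p v t) s * ennreal (v t powr conj_exp p) * indicator (blk k) t"
      proof (cases "t \<in> blk k")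
        case True
        have "ennreal (2 powr (- (real_of_int k + 1) * (r / q))) \<le> ennreal (t powr (- lam * (r / q)))"
          using powr_on_blk(1)[OF True, of "r / q"] assms(1) q_pos by (intro ennreal_leI) auto
        then show ?thesis unfolding mult.assoc times_divide_eq_right[symmetric]
          by (rule mult_right_mono) simp
      qed simp
    qed
    finally show "ennreal (2 powr (- r / q)) * ka * (ennreal (2 powr (- real_of_int k * (r / q))) * X k)
      \<le> (\<integral>\<^sup>+t. ennreal (t powr (- lam * r / q)) * enn_powr (V0 p v t) s * ennreal (v t powr conj_exp p) * indicator (blk k) t \<partial>HL)" .
  qed
  finally show ?thesis .
qed

text \<open>
  A discrete form of \<open>\<integral> V\<^sup>s dV = V\<^bsup>s+1\<^esup>/(s+1)\<close>: to the right of a point that halves the mass of the block, \<open>V\<^sub>0\<close> is at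
  least half of the mass, and the other half is integrated there.
\<close>

lemma B_integral_block_ge:
  assumes p1: "1 < p" and s: "s > 0"
  shows "ennreal ((1 / 2) powr (s + 1)) * enn_powr (blk_mass k) (s + 1)
    \<le> (\<integral>\<^sup>+t. enn_powr (V0 p v t) s * (ennreal (v t powr conj_exp p) * indicator (blk k) t) \<partial>HL)"
proof (cases "blk_mass k = 0")
  case True
  then show ?thesis using s by simp
next
  case False
  have "blk_mass k < top" using V0_finite[OF p1] blk_mass_le_cum_mass[of k] by (auto simp: cum_mass_def intro: le_less_trans)
  define U where "U = enn2real (blk_mass k)"
  have U: "blk_mass k = ennreal U" "U > 0"
    using \<open>blk_mass k < top\<close> False by (auto simp: U_def enn2real_positive_iff zero_less_iff_neq_zero)
  define rho where "rho = (\<lambda>t. ennreal (v t powr conj_exp p) * indicator (blk k) t)"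
  have [measurable]: "rho \<in> borel_measurable HL" unfolding rho_def by measurable
  have "(\<integral>\<^sup>+y. rho y \<partial>HL) = ennreal U" using U by (simp add: rho_def blk_mass_def)
  from half_mass_point[OF \<open>rho \<in> _\<close> this U(2)] obtain m where
    m: "(\<integral>\<^sup>+y. rho y * indicator {..m} y \<partial>HL) = ennreal (U / 2)" "(\<integral>\<^sup>+y. rho y * indicator {m<..} y \<partial>HL) = ennreal (U / 2)" .
  have "ennreal ((1 / 2) powr (s + 1)) * enn_powr (blk_mass k) (s + 1) = enn_powr (ennreal (U / 2)) (s + 1)"
    using U s by (simp add: enn_powr_ennreal powr_divide flip: ennreal_mult)
  also have "\<dots> = enn_powr (ennreal (U / 2)) s * (\<integral>\<^sup>+y. rho y * indicator {m<..} y \<partial>HL)"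
    unfolding m(2) using enn_powr_add[OF s, of 1 "ennreal (U / 2)"] by simp
  also have "\<dots> = (\<integral>\<^sup>+y. enn_powr (ennreal (U / 2)) s * (rho y * indicator {m<..} y) \<partial>HL)"
    by (simp add: nn_integral_cmult)
  also have "\<dots> \<le> (\<integral>\<^sup>+t. enn_powr (V0 p v t) s * rho t \<partial>HL)"
  proof (rule nn_integral_mono)
    fix t
    show "enn_powr (ennreal (U / 2)) s * (rho t * indicator {m<..} t) \<le> enn_powr (V0 p v t) s * rho t"
    proof (cases "m < t")
      case True
      have "ennreal (U / 2) \<le> V0 p v t"
        unfolding m(1)[symmetric] V0_eq rho_def using True
        by (intro nn_integral_mono) (auto simp: dyadic_block_def split: split_indicator)
      then show ?thesis using True s by (auto intro!: mult_right_mono enn_powr_mono)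
    qed simp
  qed
  finally show ?thesis by (simp add: rho_def)
qed

lemma enn_powr_bconst_blk_mass:
  assumes "1 < p" "r > 0"
  shows "enn_powr (bconst k) r = ennreal (2 powr (- real_of_int k * (r / q))) * enn_powr (blk_mass k) (r / conj_exp p)"
  using assms by (simp add: enn_powr_bconst enn_powr_wnorm_blk)

lemma bconst_summable_if_B_integral_pos:
  assumes p1: "1 < p" and s: "s > 0" "s + 1 = r / conj_exp p" and fin: "B_integral r s < top"
  shows "(ISUM k. enn_powr (bconst k) r) < top"
proof -
  have r: "r > 0" using s conj_exp_gt_1[OF p1] by (simp add: field_simps) (smt (verit) mult_pos_pos)
  have "ennreal (2 powr (- r / q)) * ennreal ((1 / 2) powr (s + 1)) * (ISUM k. enn_powr (bconst k) r) \<le> B_integral r s"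
    using B_integral_ge[OF r B_integral_block_ge[OF p1 s(1)]] by (simp add: enn_powr_bconst_blk_mass[OF p1 r] s(2))
  then have "ennreal (2 powr (- r / q)) * ennreal ((1 / 2) powr (s + 1)) * (ISUM k. enn_powr (bconst k) r) < top"
    using fin by (rule le_less_trans)
  then show ?thesis by (auto simp: ennreal_mult_less_top ennreal_mult_eq_top_iff less_top)
qed

text \<open>
  For \<open>s < 0\<close> the factor \<open>V\<^sub>0\<^sup>s\<close> is small on a block that is preceded by large masses, so the integral over
  block \<open>k\<close> does not control the power \<open>s + 1\<close> of \<open>blk_mass k\<close>. It does control \<open>cum_mass k\<^sup>s \<cdot> blk_mass k\<close>, and
  \<open>cum_mass k\<^bsup>s+1\<^esup> = cum_mass k\<^sup>s \<cdot> \<Sum>\<^bsub>j\<le>k\<^esub> blk_mass j \<le> \<Sum>\<^bsub>j\<le>k\<^esub> cum_mass j\<^sup>s \<cdot> blk_mass j\<close>, because \<open>cum_mass\<close> increases and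
  \<open>s < 0\<close>. With the weights \<open>2\<^bsup>-kr/q\<^esup>\<close> the right-hand side is a geometric convolution of the block contributions.
\<close>

lemma bconst_summable_if_B_integral_neg:
  assumes p1: "1 < p" and s: "s < 0" "s + 1 = r / conj_exp p" and r: "r > 0" and fin: "B_integral r s < top"
  shows "(ISUM k. enn_powr (bconst k) r) < top"
proof -
  have rq: "r / q > 0" using r q_pos by simp
  have s1: "s + 1 > 0" using s(2) r conj_exp_gt_1[OF p1] by simp
  define b where "b = (\<lambda>k. ennreal (2 powr (- real_of_int k * (r / q))) * (enn_powr (cum_mass k) s * blk_mass k))"
  obtain K where K: "K < top" "\<And>b :: int \<Rightarrow> ennreal.
    (ISUM j. enn_powr (ISUM k. geom (r / q) (k - j) * b k) 1)
      \<le> K * (ISUM k. enn_powr (b k) 1)"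
    using convolution_geometric[OF rq zero_less_one] by blast
  have Sfin: "cum_mass k < top" for k using V0_finite[OF p1] by (simp add: cum_mass_def)
  have "enn_powr (bconst k) r \<le> (ISUM j. geom (r / q) (j - k) * b j)" for k
  proof -
    have "enn_powr (cum_mass k) (s + 1) \<le> (ISUM j. enn_powr (cum_mass j) s * (blk_mass j * indicator {..k} j))"
    proof (cases "cum_mass k = 0")
      case True then show ?thesis using s1 by simp
    next
      case False
      then have "enn_powr (cum_mass k) (s + 1) = enn_powr (cum_mass k) s * cum_mass k"
        using Sfin[of k] by (cases "cum_mass k") (auto simp: enn_powr_ennreal_pos powr_add simp flip: ennreal_mult)
      also have "\<dots> \<le> enn_powr (cum_mass k) s * (ISUM j. blk_mass j * indicator {..k} j)"
        by (intro mult_left_mono cum_mass_le_sum) simp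
      also have "\<dots> = (ISUM j. enn_powr (cum_mass k) s * (blk_mass j * indicator {..k} j))"
        by (simp add: nn_integral_cmult)
      also have "\<dots> \<le> (ISUM j. enn_powr (cum_mass j) s * (blk_mass j * indicator {..k} j))"
        using s(1) cum_mass_mono
        by (intro nn_integral_mono) (auto intro!: mult_right_mono enn_powr_antimono split: split_indicator)
      finally show ?thesis .
    qed
    then have "enn_powr (blk_mass k) (s + 1) \<le> (ISUM j. enn_powr (cum_mass j) s * (blk_mass j * indicator {..k} j))"
      using enn_powr_mono[OF s1 blk_mass_le_cum_mass[of k]] by (rule order_trans[rotated])
    then have "enn_powr (bconst k) r \<le> ennreal (2 powr (- real_of_int k * (r / q))) * (ISUM j. enn_powr (cum_mass j) s * (blk_mass j * indicator {..k} j))"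
      unfolding enn_powr_bconst_blk_mass[OF p1 r] s(2)[symmetric] by (intro mult_left_mono) auto
    also have "\<dots> = (ISUM j. ennreal (2 powr (- real_of_int k * (r / q))) * (enn_powr (cum_mass j) s * (blk_mass j * indicator {..k} j)))"
      by (simp add: nn_integral_cmult)
    also have "\<dots> \<le> (ISUM j. geom (r / q) (j - k) * b j)"
    proof (rule nn_integral_mono)
      fix j
      show "ennreal (2 powr (- real_of_int k * (r / q))) * (enn_powr (cum_mass j) s * (blk_mass j * indicator {..k} j))
        \<le> geom (r / q) (j - k) * b j"
      proof (cases "j \<le> k")
        case True
        then show ?thesis unfolding dyadic_weight_shift[OF True] by (simp add: b_def mult.assoc)
      qed simp
    qed
    finally show ?thesis .
  qed
  then have "(ISUM k. enn_powr (bconst k) r)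
     \<le> (ISUM k. enn_powr (ISUM j. geom (r / q) (j - k) * b j) 1)"
    by (intro nn_integral_mono) simp
  also have "\<dots> \<le> K * (ISUM k. b k)" using K(2)[of b] by simp
  also have "\<dots> < top"
  proof -
    have le: "1 * (enn_powr (cum_mass k) s * blk_mass k) \<le> (\<integral>\<^sup>+t. enn_powr (V0 p v t) s * (ennreal (v t powr conj_exp p) * indicator (blk k) t) \<partial>HL)" for k
    proof -
      have "enn_powr (cum_mass k) s * blk_mass k = (\<integral>\<^sup>+t. enn_powr (cum_mass k) s * (ennreal (v t powr conj_exp p) * indicator (blk k) t) \<partial>HL)"
        unfolding blk_mass_def by (rule nn_integral_cmult[symmetric]) measurable
      also have "\<dots> \<le> (\<integral>\<^sup>+t. enn_powr (V0 p v t) s * (ennreal (v t powr conj_exp p) * indicator (blk k) t) \<partial>HL)"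
        using s(1) V0_le_cum_mass[of _ k]
        by (intro nn_integral_mono) (auto intro!: mult_right_mono enn_powr_antimono split: split_indicator)
      finally show ?thesis by simp
    qed
    have "ennreal (2 powr (- r / q)) * 1 * (ISUM k. b k) \<le> B_integral r s"
      unfolding b_def by (rule B_integral_ge[OF r le])
    then have "ennreal (2 powr (- r / q)) * 1 * (ISUM k. b k) < top"
      using fin by (rule le_less_trans)
    then show ?thesis using K(1) by (auto simp: ennreal_mult_less_top)
  qed
  finally show ?thesis .
qed

text \<open>
  A discrete Hardy inequality: \<open>2\<^bsup>-kp'/q\<^esup> cum_mass k\<close> is dominated by a geometric convolution of \<open>bconst k\<close> to the
  power \<open>p'\<close>, and convolution is bounded on \<open>l\<^bsup>r/p'\<^esup>\<close>.
\<close>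

lemma B_integral_finite_if_bconst_summable:
  assumes p1: "1 < p" and s: "s > 0" "s + 1 = r / conj_exp p" and r: "r > 0"
    and fin: "(ISUM k. enn_powr (bconst k) r) < top"
  shows "B_integral r s < top"
proof -
  define p' where "p' = conj_exp p"
  have p': "p' > 1" using conj_exp_gt_1[OF p1] by (simp add: p'_def)
  have pq: "p' / q > 0" "r / p' > 0" using p' q_pos r by auto
  obtain K where K: "K < top" "\<And>b :: int \<Rightarrow> ennreal.
    (ISUM j. enn_powr (ISUM k. geom (p' / q) (k - j) * b k) (r / p'))
      \<le> K * (ISUM k. enn_powr (b k) (r / p'))"
    using convolution_geometric[OF pq] by blast
  have "B_integral r s \<le> (ISUM k. ennreal (2 powr (- real_of_int k * (r / q))) * enn_powr (cum_mass k) (s + 1))"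
    unfolding B_integral_blocks
  proof (rule nn_integral_mono)
    fix k
    have "(\<integral>\<^sup>+t. ennreal (t powr (- lam * r / q)) * enn_powr (V0 p v t) s * ennreal (v t powr conj_exp p) * indicator (blk k) t \<partial>HL)
      \<le> (\<integral>\<^sup>+t. (ennreal (2 powr (- real_of_int k * (r / q))) * enn_powr (cum_mass k) s) * (ennreal (v t powr conj_exp p) * indicator (blk k) t) \<partial>HL)"
    proof (rule nn_integral_mono)
      fix t
      show "ennreal (t powr (- lam * r / q)) * enn_powr (V0 p v t) s * ennreal (v t powr conj_exp p) * indicator (blk k) t
        \<le> (ennreal (2 powr (- real_of_int k * (r / q))) * enn_powr (cum_mass k) s) * (ennreal (v t powr conj_exp p) * indicator (blk k) t)"
      proof (cases "t \<in> blk k")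
        case True
        have "t powr (- lam * r / q) \<le> 2 powr (- real_of_int k * (r / q))"
          using powr_on_blk(2)[OF True, of "r / q"] r q_pos by simp
        then have "ennreal (t powr (- lam * r / q)) * enn_powr (V0 p v t) s \<le> ennreal (2 powr (- real_of_int k * (r / q))) * enn_powr (cum_mass k) s"
          by (intro mult_mono ennreal_leI enn_powr_mono s V0_le_cum_mass True) auto
        then show ?thesis unfolding mult.assoc[of "ennreal (t powr _) * _"] by (rule mult_right_mono) simp
      qed simp
    qed
    also have "\<dots> = (ennreal (2 powr (- real_of_int k * (r / q))) * enn_powr (cum_mass k) s) * blk_mass k"
      unfolding blk_mass_def by (rule nn_integral_cmult) measurable
    also have "\<dots> \<le> (ennreal (2 powr (- real_of_int k * (r / q))) * enn_powr (cum_mass k) s) * cum_mass k"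
      by (intro mult_left_mono blk_mass_le_cum_mass) simp
    also have "\<dots> = ennreal (2 powr (- real_of_int k * (r / q))) * enn_powr (cum_mass k) (s + 1)"
      using enn_powr_add[OF s(1), of 1 "cum_mass k"] by (simp add: mult.assoc)
    finally show "(\<integral>\<^sup>+t. ennreal (t powr (- lam * r / q)) * enn_powr (V0 p v t) s * ennreal (v t powr conj_exp p) * indicator (blk k) t \<partial>HL)
      \<le> ennreal (2 powr (- real_of_int k * (r / q))) * enn_powr (cum_mass k) (s + 1)" .
  qed
  also have "\<dots> \<le> (ISUM j. enn_powr (ISUM k. geom (p' / q) (k - j) * enn_powr (bconst k) p') (r / p'))"
  proof (rule nn_integral_mono)
    fix k
    have "ennreal (2 powr (- real_of_int k * (r / q))) * enn_powr (cum_mass k) (s + 1) = enn_powr (ennreal (2 powr (- real_of_int k * (p' / q))) * cum_mass k) (r / p')"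
      using pq p' by (simp add: s(2) p'_def[symmetric] enn_powr_mult enn_powr_ennreal powr_powr)
    also have "\<dots> \<le> enn_powr (ISUM j. geom (p' / q) (j - k) * enn_powr (bconst j) p') (r / p')"
    proof (rule enn_powr_mono[OF pq(2)])
      have "ennreal (2 powr (- real_of_int k * (p' / q))) * cum_mass k \<le> ennreal (2 powr (- real_of_int k * (p' / q))) * (ISUM j. blk_mass j * indicator {..k} j)"
        by (intro mult_left_mono cum_mass_le_sum) simp
      also have "\<dots> = (ISUM j. ennreal (2 powr (- real_of_int k * (p' / q))) * (blk_mass j * indicator {..k} j))"
        by (simp add: nn_integral_cmult)
      also have "\<dots> \<le> (ISUM j. geom (p' / q) (j - k) * enn_powr (bconst j) p')"
      proof (rule nn_integral_mono)
        fix j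
        show "ennreal (2 powr (- real_of_int k * (p' / q))) * (blk_mass j * indicator {..k} j)
          \<le> geom (p' / q) (j - k) * enn_powr (bconst j) p'"
        proof (cases "j \<le> k")
          case True
          have "enn_powr (bconst j) p' = ennreal (2 powr (- real_of_int j * (p' / q))) * blk_mass j"
            using enn_powr_bconst_blk_mass[OF p1, of p' j] p' by (simp add: p'_def)
          then show ?thesis using True unfolding dyadic_weight_shift[OF True] by (simp add: mult.assoc)
        qed simp
      qed
      finally show "ennreal (2 powr (- real_of_int k * (p' / q))) * cum_mass k \<le> (ISUM j. geom (p' / q) (j - k) * enn_powr (bconst j) p')" .
    qed
    finally show "ennreal (2 powr (- real_of_int k * (r / q))) * enn_powr (cum_mass k) (s + 1)
      \<le> enn_powr (ISUM j. geom (p' / q) (j - k) * enn_powr (bconst j) p') (r / p')" .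
  qed
  also have "\<dots> \<le> K * (ISUM k. enn_powr (enn_powr (bconst k) p') (r / p'))" by (rule K(2))
  also have "\<dots> = K * (ISUM k. enn_powr (bconst k) r)"
    using p' pq by (simp add: enn_powr_powr)
  also have "\<dots> < top" using K(1) fin by (simp add: ennreal_mult_less_top)
  finally show ?thesis .
qed

text \<open>
  On each block \<open>y\<^bsup>-\<lambda>\<^esup>\<close> is \<open>2\<^bsup>-k\<^esup>\<close> up to a factor \<open>2\<close>, so the integral is comparable to the sum of \<open>bconst k\<close> to
  the power \<open>p'\<close>. For \<open>q = 1\<close> the integral defines \<open>B\<^sub>p\<close> and \<open>r = p'\<close>; for \<open>q < 1\<close> it gives the norm of \<open>B\<^sub>q\<close>.
\<close>

lemma weighted_integral_finite_iff:
  assumes p1: "1 < p"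
  shows "(\<integral>\<^sup>+y. ennreal (y powr (- lam * (conj_exp p / q))) * ennreal (v y powr conj_exp p) \<partial>HL) < top
    \<longleftrightarrow> (ISUM k. enn_powr (bconst k) (conj_exp p)) < top"
proof -
  define a where "a = conj_exp p / q"
  have a: "a > 0" using conj_exp_gt_1[OF p1] q_pos by (simp add: a_def)
  have cu: "enn_powr (bconst k) (conj_exp p) = ennreal (2 powr (- real_of_int k * a)) * blk_mass k" for k
    using enn_powr_bconst_blk_mass[OF p1, of "conj_exp p" k] conj_exp_gt_1[OF p1] by (simp add: a_def)
  let ?F = "\<lambda>y. ennreal (y powr (- lam * a)) * ennreal (v y powr conj_exp p)"
  have J: "(\<integral>\<^sup>+y. ?F y \<partial>HL) = (ISUM k. (\<integral>\<^sup>+y. ?F y * indicator (blk k) y \<partial>HL))"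
    by (rule nn_integral_dyadic_blocks) measurable
  have "(\<integral>\<^sup>+y. ?F y \<partial>HL) \<le> (ISUM k. enn_powr (bconst k) (conj_exp p))"
    unfolding J
  proof (rule nn_integral_mono)
    fix k
    have "(\<integral>\<^sup>+y. ?F y * indicator (blk k) y \<partial>HL)
      \<le> (\<integral>\<^sup>+y. ennreal (2 powr (- real_of_int k * a)) * (ennreal (v y powr conj_exp p) * indicator (blk k) y) \<partial>HL)"
      unfolding mult.assoc using powr_on_blk(2)[of _ k a] a
      by (intro nn_integral_mono) (auto intro!: mult_right_mono ennreal_leI split: split_indicator)
    also have "\<dots> = enn_powr (bconst k) (conj_exp p)"
      unfolding cu blk_mass_def by (rule nn_integral_cmult) measurable
    finally show "(\<integral>\<^sup>+y. ?F y * indicator (blk k) y \<partial>HL) \<le> enn_powr (bconst k) (conj_exp p)" .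
  qed
  moreover have "ennreal (2 powr (- a)) * (ISUM k. enn_powr (bconst k) (conj_exp p)) \<le> (\<integral>\<^sup>+y. ?F y \<partial>HL)"
  proof -
    have "ennreal (2 powr (- a)) * (ISUM k. enn_powr (bconst k) (conj_exp p))
      = (ISUM k. ennreal (2 powr (- a)) * enn_powr (bconst k) (conj_exp p))"
      by (simp add: nn_integral_cmult)
    also have "\<dots> \<le> (\<integral>\<^sup>+y. ?F y \<partial>HL)"
      unfolding J
    proof (rule nn_integral_mono)
      fix k
      have "2 powr (- (real_of_int k + 1) * a) = 2 powr (- a) * 2 powr (- real_of_int k * a)"
        by (simp add: powr_add[symmetric] algebra_simps)
      then have "ennreal (2 powr (- (real_of_int k + 1) * a)) = ennreal (2 powr (- a)) * ennreal (2 powr (- real_of_int k * a))"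
        by (simp only: ennreal_mult powr_ge_zero)
      then have "ennreal (2 powr (- a)) * enn_powr (bconst k) (conj_exp p) = ennreal (2 powr (- (real_of_int k + 1) * a)) * blk_mass k"
        by (simp only: cu mult.assoc)
      also have "\<dots> = (\<integral>\<^sup>+y. ennreal (2 powr (- (real_of_int k + 1) * a)) * (ennreal (v y powr conj_exp p) * indicator (blk k) y) \<partial>HL)"
        unfolding blk_mass_def by (rule nn_integral_cmult[symmetric]) measurable
      also have "\<dots> \<le> (\<integral>\<^sup>+y. ?F y * indicator (blk k) y \<partial>HL)"
        unfolding mult.assoc using powr_on_blk(1)[of _ k a] a
        by (intro nn_integral_mono) (auto intro!: mult_right_mono ennreal_leI split: split_indicator)
      finally show "ennreal (2 powr (- a)) * enn_powr (bconst k) (conj_exp p) \<le> (\<integral>\<^sup>+y. ?F y * indicator (blk k) y \<partial>HL)" .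
    qed
    finally show ?thesis .
  qed
  ultimately have "(\<integral>\<^sup>+y. ?F y \<partial>HL) < top \<longleftrightarrow> (ISUM k. enn_powr (bconst k) (conj_exp p)) < top"
    using le_less_trans[of "ennreal (2 powr (- a)) * (ISUM k. enn_powr (bconst k) (conj_exp p))" "\<integral>\<^sup>+y. ?F y \<partial>HL" top]
    by (auto simp: ennreal_mult_less_top intro: le_less_trans)
  then show ?thesis by (simp only: a_def)
qed

text \<open>
  The inclusion of \<open>l\<^sup>a\<close> in \<open>l\<^sup>b\<close>; for \<open>q < 1\<close> it is applied with \<open>a = r\<close> and \<open>b = p'\<close>.
\<close>

lemma bconst_summable_mono:
  assumes "0 < a" "a < b" and fin: "(ISUM k. enn_powr (bconst k) a) < top"
  shows "(ISUM k. enn_powr (bconst k) b) < top"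
proof -
  define R where "R = (ISUM k. enn_powr (bconst k) a)"
  have ba: "b / a - 1 > 0" using assms by simp
  have "(ISUM k. enn_powr (bconst k) b) \<le> (ISUM k. enn_powr R (b / a - 1) * enn_powr (bconst k) a)"
  proof (rule nn_integral_mono)
    fix k
    have "enn_powr (bconst k) a \<le> R" unfolding R_def by (rule nn_integral_ge_point) simp
    then have "enn_powr (enn_powr (bconst k) a) (b / a - 1) * enn_powr (bconst k) a \<le> enn_powr R (b / a - 1) * enn_powr (bconst k) a"
      by (intro mult_right_mono enn_powr_mono ba) auto
    moreover have "a * (b / a - 1) + a = b" "a * (b / a - 1) > 0" using assms by (auto simp: field_simps)
    ultimately show "enn_powr (bconst k) b \<le> enn_powr R (b / a - 1) * enn_powr (bconst k) a"
      using assms ba by (simp add: enn_powr_powr enn_powr_add)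
  qed
  also have "\<dots> = enn_powr R (b / a - 1) * R" by (simp add: nn_integral_cmult R_def)
  also have "\<dots> < top" using fin ba by (simp add: R_def ennreal_mult_less_top enn_powr_less_top_iff)
  finally show ?thesis .
qed

lemma A_fun_eq_char_fun: "1 < p \<Longrightarrow> A_fun lam p q v = char_fun"
  by (simp add: fun_eq_iff A_fun_def char_fun_def wnorm_Ioo_eq_V0)

subsection \<open>The case \<open>p = 1\<close> and the criteria\<close>

lemma vbar0_eq: assumes "p = 1" shows "vbar0 v t = wnorm {0<..<t}"
proof -
  have e: "conj_exp_ext p = \<infinity>" using assms by (simp add: conj_exp_ext_def)
  have m: "(\<lambda>x. ennreal (v x)) \<in> borel_measurable (lebesgue_on {0<..<t})" "(\<lambda>x. ennreal \<bar>v x\<bar>) \<in> borel_measurable (lebesgue_on {0<..<t})"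
    by (rule measurable_lebesgue_on_subset; simp)+
  show ?thesis
    unfolding vbar0_def wnorm_def Lr_norm_def e
    by (simp, rule esssup_AE_cong[OF m], intro AE_I2) (simp add: v_nonneg)
qed

lemma Bbarq_fun_eq_char_fun: assumes "p = 1" shows "Bbarq_fun lam q v = char_fun"
  by (rule ext) (simp add: Bbarq_fun_def char_fun_def vbar0_eq[OF assms])

text \<open>
  On block \<open>k + 1\<close> the interval \<open>(0,t)\<close> contains block \<open>k\<close>, and the power of \<open>t\<close> integrates over block \<open>k + 1\<close> to a
  constant multiple of \<open>2\<^bsup>-k/(1-q)\<^esup>\<close>. Shifting the index by one therefore turns the integral of \<open>vbar0\<close> into the sum
  of \<open>bconst k\<close> to the power \<open>q/(1-q)\<close>.
\<close>

lemma bconst_summable_if_Bq':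
  assumes p1: "p = 1" and q1: "q < 1" and fin: "Bq'_const lam q v < top"
  shows "(ISUM k. enn_powr (bconst k) (q / (1 - q))) < top"
proof -
  define r where "r = q / (1 - q)"
  have r: "r > 0" using q1 q_pos by (simp add: r_def)
  define e where "e = - lam / (1 - q) - 1"
  have e: "e < 0" using q1 lam_pos by (simp add: e_def) (smt (verit) divide_pos_pos)
  let ?F = "\<lambda>t. ennreal (t powr e) * enn_powr (wnorm {0<..<t}) r"
  define I where "I = (\<integral>\<^sup>+t. ?F t \<partial>HL)"
  have I: "I < top"
    using fin q1 q_pos unfolding Bq'_const_def
    by (simp add: enn_powr_less_top_iff I_def e_def r_def vbar0_eq[OF p1])
  define ka where "ka = (1 - 2 powr (- 1 / lam)) * 2 powr (- 2 / (1 - q))"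
  have "2 powr (- 1 / lam) < 2 powr 0" using lam_pos by (intro powr_less_mono) auto
  then have ka: "ka > 0" by (simp add: ka_def)
  have "ennreal ka * (ISUM k. enn_powr (bconst k) r) = (ISUM k. ennreal ka * enn_powr (bconst k) r)"
    by (simp add: nn_integral_cmult)
  also have "\<dots> \<le> (ISUM k. (\<integral>\<^sup>+t. ?F t * indicator (blk (k + 1)) t \<partial>HL))"
  proof (rule nn_integral_mono)
    fix k
    define T1 where "T1 = 2 powr ((real_of_int k + 1) / lam)"
    define T2 where "T2 = 2 powr ((real_of_int k + 2) / lam)"
    have T: "0 < T1" "T1 \<le> T2" using lam_pos by (auto simp: T1_def T2_def divide_right_mono)
    have blk: "T1 \<le> t" "t < T2" "0 < t" "blk k \<subseteq> {0<..<t}" if "t \<in> blk (k + 1)" for t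
    proof -
      have t: "0 < t" "2 powr (real_of_int k + 1) \<le> t powr lam" using that by (auto simp: mem_dyadic_block_iff)
      then have "(2 powr (real_of_int k + 1)) powr (1 / lam) \<le> (t powr lam) powr (1 / lam)"
        using lam_pos by (intro powr_mono2) auto
      then show T1: "T1 \<le> t" using t lam_pos by (simp add: T1_def powr_powr)
      show "0 < t" by fact
      show "t < T2" using blk_subset[of "k + 1"] that by (auto simp: T2_def add_ac)
      show "blk k \<subseteq> {0<..<t}" using blk_subset[of k] T1 by (auto simp: T1_def)
    qed
    have blk': "t \<in> blk (k + 1)" if "T1 \<le> t" "t < T2" for t
    proof -
      have "0 < t" using that T by linarith
      moreover have "T1 powr lam \<le> t powr lam" using that T lam_pos by (intro powr_mono2) auto
      moreover have "t powr lam < T2 powr lam" using that T lam_pos by (intro powr_less_mono2) auto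
      ultimately show ?thesis using lam_pos by (simp add: mem_dyadic_block_iff T1_def T2_def powr_powr add_ac)
    qed
    have "blk (k + 1) = {T1..<T2}" using blk blk' by force
    then have em: "emeasure HL (blk (k + 1)) = ennreal (T2 - T1)"
      using T by (simp, subst emeasure_restrict_space) auto
    have "2 powr ((real_of_int k + 1) / lam) = 2 powr ((real_of_int k + 2) / lam) * 2 powr (- 1 / lam)"
      by (simp add: powr_add[symmetric] add_divide_distrib add.commute)
    then have T12: "T2 - T1 = T2 * (1 - 2 powr (- 1 / lam))" by (simp add: T1_def T2_def right_diff_distrib)
    have "T2 powr e * T2 = T2 powr (- lam / (1 - q))" using T by (simp add: e_def powr_diff)
    also have "\<dots> = 2 powr (- ((real_of_int k + 2) / (1 - q)))" using lam_pos by (simp add: T2_def powr_powr)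
    also have "\<dots> = 2 powr (- 2 / (1 - q)) * 2 powr (- real_of_int k * (r / q))"
    proof -
      have "- ((real_of_int k + 2) / (1 - q)) = - 2 / (1 - q) + - real_of_int k * (r / q)"
        using q_pos by (simp add: r_def add_divide_distrib)
      then show ?thesis by (simp only: powr_add)
    qed
    finally have "T2 powr e * (T2 - T1) = ka * 2 powr (- real_of_int k * (r / q))"
      by (simp add: T12 ka_def mult_ac)
    then have prod: "ennreal (T2 powr e) * ennreal (T2 - T1) = ennreal ka * ennreal (2 powr (- real_of_int k * (r / q)))"
      using T ka by (simp flip: ennreal_mult)
    have "ennreal ka * enn_powr (bconst k) r = (ennreal ka * ennreal (2 powr (- real_of_int k * (r / q)))) * enn_powr (wnorm (blk k)) r"
      by (simp only: enn_powr_bconst[OF r] mult.assoc)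
    also have "\<dots> = (ennreal (T2 powr e) * enn_powr (wnorm (blk k)) r) * emeasure HL (blk (k + 1))"
      by (simp only: prod[symmetric] em mult_ac)
    also have "\<dots> = (\<integral>\<^sup>+t. ennreal (T2 powr e) * enn_powr (wnorm (blk k)) r * indicator (blk (k + 1)) t \<partial>HL)"
      by (simp add: nn_integral_cmult)
    also have "\<dots> \<le> (\<integral>\<^sup>+t. ?F t * indicator (blk (k + 1)) t \<partial>HL)"
    proof (rule nn_integral_mono)
      fix t
      show "ennreal (T2 powr e) * enn_powr (wnorm (blk k)) r * indicator (blk (k + 1)) t \<le> ?F t * indicator (blk (k + 1)) t"
      proof (cases "t \<in> blk (k + 1)")
        case True
        note b = blk[OF True]
        have "T2 powr e \<le> t powr e" using b e by (intro powr_mono2') auto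
        then have "ennreal (T2 powr e) * enn_powr (wnorm (blk k)) r \<le> ?F t"
          using b(4) by (intro mult_mono ennreal_leI enn_powr_mono r wnorm_mono) auto
        then show ?thesis using True by simp
      qed simp
    qed
    finally show "ennreal ka * enn_powr (bconst k) r \<le> (\<integral>\<^sup>+t. ?F t * indicator (blk (k + 1)) t \<partial>HL)" .
  qed
  also have "\<dots> = (ISUM k. (\<integral>\<^sup>+t. ?F t * indicator (blk k) t \<partial>HL))"
    by (rule nn_integral_bij_count_space) (rule bij_betwI[where g="\<lambda>m. m - 1"], auto)
  also have "\<dots> = I"
    unfolding I_def by (rule nn_integral_dyadic_blocks[symmetric]) measurable
  finally have "ennreal ka * (ISUM k. enn_powr (bconst k) r) < top"
    using I by (rule le_less_trans)
  then show ?thesis using ka by (auto simp: ennreal_mult_less_top r_def)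
qed

text \<open>
  Almost everywhere on block \<open>k\<close> the function is at most \<open>bconst k\<close>, which is controlled by \<open>char_fun\<close> at the right
  end of the block.
\<close>

lemma esssup_Bq_finite:
  assumes p1: "p = 1" and B: "B < top" "\<And>t. 0 < t \<Longrightarrow> char_fun t \<le> B"
  shows "esssup HL (\<lambda>t. ennreal (Bq_fun lam q v t)) < top"
proof -
  have "AE y in HL. \<forall>k. y \<in> blk k \<longrightarrow> ennreal (v y) \<le> wnorm (blk k)"
    using wnorm_le_iff_1[OF p1] by (simp add: AE_all_countable) (metis dyadic_block_halfline order_refl)
  then have "AE y in HL. ennreal (Bq_fun lam q v y) \<le> ennreal (2 powr (1 / q)) * B"
    using AE_halfline_pos
  proof eventually_elim
    fix y :: real assume le: "\<forall>k. y \<in> blk k \<longrightarrow> ennreal (v y) \<le> wnorm (blk k)" and y: "0 < y"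
    define k where "k = \<lfloor>lam * log 2 y\<rfloor>"
    have k: "y \<in> blk k" using y by (simp add: k_def dyadic_block_def)
    have "y powr (- lam / q) \<le> 2 powr (- real_of_int k / q)"
      using powr_on_blk(2)[OF k, of "1 / q"] q_pos by simp
    then have "ennreal (Bq_fun lam q v y) \<le> bconst k"
      unfolding Bq_fun_def bconst_def using le k by (subst ennreal_mult') (auto intro!: mult_mono ennreal_leI)
    also have "\<dots> \<le> ennreal (2 powr (1 / q)) * char_fun (2 powr ((real_of_int k + 1) / lam))" by (rule bconst_le_char_fun)
    also have "\<dots> \<le> ennreal (2 powr (1 / q)) * B" by (intro mult_left_mono B) auto
    finally show "ennreal (Bq_fun lam q v y) \<le> ennreal (2 powr (1 / q)) * B" .
  qed
  moreover have "(\<lambda>t. ennreal (Bq_fun lam q v t)) \<in> borel_measurable HL"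
    unfolding Bq_fun_def by measurable
  ultimately have "esssup HL (\<lambda>t. ennreal (Bq_fun lam q v t)) \<le> ennreal (2 powr (1 / q)) * B" by (intro esssup_I)
  also have "\<dots> < top" using B(1) by (simp add: ennreal_mult_less_top)
  finally show ?thesis .
qed

lemma compact_imp_char_fun_bounded:
  assumes "laplace_compact lam v (ennreal p) (ennreal q)"
  obtains B where "B < top" "\<And>t. 0 < t \<Longrightarrow> char_fun t \<le> B"
  using char_fun_bounded[OF compact_imp_char_fun_at_right_0[OF assms] compact_imp_char_fun_at_top[OF assms]] by blast

lemma compact_iff_A:
  assumes "1 < p" "p \<le> q"
  shows "laplace_compact lam v (ennreal p) (ennreal q) \<longleftrightarrow>
    A_const lam p q v < \<infinity> \<and> (A_fun lam p q v \<longlongrightarrow> 0) (at_right 0) \<and> (A_fun lam p q v \<longlongrightarrow> 0) at_top"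
proof -
  have "A_const lam p q v < \<infinity>" if comp: "laplace_compact lam v (ennreal p) (ennreal q)"
  proof -
    obtain B where B: "B < top" "\<And>t. 0 < t \<Longrightarrow> char_fun t \<le> B" using compact_imp_char_fun_bounded[OF comp] by blast
    have "A_const lam p q v \<le> B"
      unfolding A_const_def A_fun_eq_char_fun[OF assms(1)] by (rule SUP_least) (use B in auto)
    then show ?thesis using B(1) by (auto intro: le_less_trans)
  qed
  then show ?thesis unfolding A_fun_eq_char_fun[OF assms(1)] using compact_iff_char_fun[OF assms(2)] by blast
qed

lemma compact_iff_Bbarq:
  assumes "p = 1" "p \<le> q"
  shows "laplace_compact lam v (ennreal p) (ennreal q) \<longleftrightarrow>
    esssup HL (Bbarq_fun lam q v) < \<infinity> \<and> (Bbarq_fun lam q v \<longlongrightarrow> 0) (at_right 0) \<and> (Bbarq_fun lam q v \<longlongrightarrow> 0) at_top"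
proof -
  have "esssup HL char_fun < \<infinity>" if comp: "laplace_compact lam v (ennreal p) (ennreal q)"
  proof -
    obtain B where B: "B < top" "\<And>t. 0 < t \<Longrightarrow> char_fun t \<le> B" using compact_imp_char_fun_bounded[OF comp] by blast
    have "AE t in HL. char_fun t \<le> B" using AE_halfline_pos by eventually_elim (rule B(2))
    then have "esssup HL char_fun \<le> B" by (intro esssup_I) auto
    then show ?thesis using B(1) by (auto intro: le_less_trans)
  qed
  then show ?thesis unfolding Bbarq_fun_eq_char_fun[OF assms(1)] using compact_iff_char_fun[OF assms(2)] by blast
qed

lemma compact_iff_bconst_summable:
  assumes "q < p"
  shows "laplace_compact lam v (ennreal p) (ennreal q) \<longleftrightarrow> (ISUM k. enn_powr (bconst k) (p * q / (p - q))) < top"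
  using compact_if_q_less_p[OF assms] compact_imp_bconst_summable[OF _ assms] by blast

lemma B_const_finite_iff:
  assumes "q < p"
  shows "B_const lam p q v < \<infinity> \<longleftrightarrow> B_integral (p * q / (p - q)) (p * q / (p - q) / conj_exp q) < top"
  using assms q_pos p_ge_1 by (simp add: B_const_def Let_def B_integral_def enn_powr_less_top_iff)

lemma exponent_identity:
  assumes "q < p" "q \<noteq> 1" "1 < p"
  shows "p * q / (p - q) / conj_exp q + 1 = p * q / (p - q) / conj_exp p"
  using assms q_pos unfolding conj_exp_def by (simp add: field_simps)

lemma compact_iff_B:
  assumes "1 < q" "q < p"
  shows "laplace_compact lam v (ennreal p) (ennreal q) \<longleftrightarrow> B_const lam p q v < \<infinity>"
proof -
  define r where "r = p * q / (p - q)"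
  define s where "s = r / conj_exp q"
  have p1: "1 < p" using assms by simp
  have r: "r > 0" using assms by (simp add: r_def)
  have s: "s > 0" using r assms by (simp add: s_def conj_exp_def)
  have s1: "s + 1 = r / conj_exp p" unfolding s_def r_def by (rule exponent_identity) (use assms in auto)
  show ?thesis
    unfolding compact_iff_bconst_summable[OF assms(2)] B_const_finite_iff[OF assms(2)] r_def[symmetric] s_def[symmetric]
    using bconst_summable_if_B_integral_pos[OF p1 s s1] B_integral_finite_if_bconst_summable[OF p1 s s1 r] by blast
qed

lemma compact_if_B:
  assumes "q < 1" "1 < p" "B_const lam p q v < \<infinity>"
  shows "laplace_compact lam v (ennreal p) (ennreal q)"
proof -
  define r where "r = p * q / (p - q)"
  define s where "s = r / conj_exp q"
  have qp: "q < p" using assms by simp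
  have r: "r > 0" using qp assms q_pos by (simp add: r_def)
  have s: "s < 0" using r assms q_pos by (simp add: s_def conj_exp_def divide_less_0_iff mult_less_0_iff)
  have s1: "s + 1 = r / conj_exp p" unfolding s_def r_def by (rule exponent_identity) (use assms qp in auto)
  show ?thesis
    unfolding compact_iff_bconst_summable[OF qp] r_def[symmetric]
    using bconst_summable_if_B_integral_neg[OF assms(2) s s1 r] assms(3)
    unfolding B_const_finite_iff[OF qp] r_def[symmetric] s_def[symmetric] by blast
qed

lemma compact_iff_Bp:
  assumes "q = 1" "1 < p"
  shows "laplace_compact lam v (ennreal p) (ennreal q) \<longleftrightarrow> Bp_const lam p v < \<infinity>"
proof -
  have qp: "q < p" using assms by simp
  have e: "p * q / (p - q) = conj_exp p" using assms by (simp add: conj_exp_def)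
  have "Bp_const lam p v < \<infinity> \<longleftrightarrow> (\<integral>\<^sup>+y. ennreal (y powr (- lam * (conj_exp p / q))) * ennreal (v y powr conj_exp p) \<partial>HL) < top"
    using assms conj_exp_gt_1[OF assms(2)] by (simp add: Bp_const_def enn_powr_less_top_iff)
  then show ?thesis
    unfolding compact_iff_bconst_summable[OF qp] e weighted_integral_finite_iff[OF assms(2)] by blast
qed

lemma compact_imp_Bq_norm:
  assumes "q < 1" "1 < p" "laplace_compact lam v (ennreal p) (ennreal q)"
  shows "Lr_norm (conj_exp_ext p) {0..} (Bq_fun lam q v) < \<infinity>"
proof -
  have qp: "q < p" using assms by simp
  have p': "conj_exp p > 1" by (rule conj_exp_gt_1[OF assms(2)])
  have "p * q / (p - q) < conj_exp p"
    using assms(1,2) q_pos qp unfolding conj_exp_def by (simp add: field_simps) 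
  moreover have "0 < p * q / (p - q)" using assms q_pos qp by simp
  ultimately have "(ISUM k. enn_powr (bconst k) (conj_exp p)) < top"
    using bconst_summable_mono compact_iff_bconst_summable[OF qp] assms(3) by blast
  then have "(\<integral>\<^sup>+y. ennreal (y powr (- lam * (conj_exp p / q))) * ennreal (v y powr conj_exp p) \<partial>HL) < top"
    unfolding weighted_integral_finite_iff[OF assms(2)] .
  also have "(\<integral>\<^sup>+y. ennreal (y powr (- lam * (conj_exp p / q))) * ennreal (v y powr conj_exp p) \<partial>HL)
    = (\<integral>\<^sup>+y. ennreal (\<bar>Bq_fun lam q v y\<bar> powr conj_exp p) \<partial>HL)"
    by (intro nn_integral_cong) (simp add: Bq_fun_def abs_mult v_nonneg powr_mult powr_powr mult.commute flip: ennreal_mult)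
  finally show ?thesis
    using p' assms(2) by (simp add: Lr_norm_def conj_exp_ext_def enn_powr_less_top_iff)
qed

end

theorem theorem3p1:
  fixes lam p q :: real and v :: "real \<Rightarrow> real"
  assumes "lam > 0" and "p \<ge> 1" and "q > 0"
    and "\<And>x. x \<ge> 0 \<Longrightarrow> v x \<ge> 0"
    and "v \<in> Lr_loc (conj_exp_ext p)"
  shows
    "(1 < p \<and> p \<le> q \<longrightarrow>
        (laplace_compact lam v p q \<longleftrightarrow>
           A_const lam p q v < \<infinity>
           \<and> (A_fun lam p q v \<longlongrightarrow> 0) (at_right 0)
           \<and> (A_fun lam p q v \<longlongrightarrow> 0) at_top))
     \<and>
     (1 \<le> q \<and> q < p \<longrightarrow>
        (q > 1 \<longrightarrow> (laplace_compact lam v p q \<longleftrightarrow> B_const lam p q v < \<infinity>))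
        \<and> (q = 1 \<longrightarrow> (laplace_compact lam v p 1 \<longleftrightarrow> Bp_const lam p v < \<infinity>)))
     \<and>
     (q < 1 \<and> 1 < p \<longrightarrow>
        (B_const lam p q v < \<infinity> \<longrightarrow> laplace_compact lam v p q)
        \<and> (laplace_compact lam v p q \<longrightarrow>
             Lr_norm (conj_exp_ext p) {0..} (Bq_fun lam q v) < \<infinity>))
     \<and>
     (q < 1 \<and> p = 1 \<longrightarrow>
        (Bq'_const lam q v < \<infinity> \<longrightarrow> laplace_compact lam v 1 q)
        \<and> (laplace_compact lam v 1 q \<longrightarrow>
             esssup (lebesgue_on {0..}) (\<lambda>t. ennreal (Bq_fun lam q v t)) < \<infinity>))
     \<and>
     (p = 1 \<and> 1 \<le> q \<longrightarrow>
        (laplace_compact lam v 1 q \<longleftrightarrow>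
           esssup (lebesgue_on {0..}) (Bbarq_fun lam q v) < \<infinity>
           \<and> (Bbarq_fun lam q v \<longlongrightarrow> 0) (at_right 0)
           \<and> (Bbarq_fun lam q v \<longlongrightarrow> 0) at_top))"
proof -
  interpret L: laplace_weight lam p q v
    by unfold_locales (use assms in auto)
  have p1: "(1 :: ennreal) = ennreal p" if "p = 1" using that by simp
  have q1: "(1 :: ennreal) = ennreal q" if "q = 1" using that by simp
  show ?thesis
  proof (intro conjI impI; (elim conjE)?)
    assume "1 < p" "p \<le> q"
    then show "laplace_compact lam v p q \<longleftrightarrow> A_const lam p q v < \<infinity>
        \<and> (A_fun lam p q v \<longlongrightarrow> 0) (at_right 0) \<and> (A_fun lam p q v \<longlongrightarrow> 0) at_top"
      by (rule L.compact_iff_A)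
  next
    assume "1 < q" "q < p"
    then show "laplace_compact lam v p q \<longleftrightarrow> B_const lam p q v < \<infinity>" by (rule L.compact_iff_B)
  next
    assume "q = 1" "q < p"
    then show "laplace_compact lam v p 1 \<longleftrightarrow> Bp_const lam p v < \<infinity>"
      unfolding q1[OF \<open>q = 1\<close>] by (intro L.compact_iff_Bp) auto
  next
    assume "q < 1" "1 < p" "B_const lam p q v < \<infinity>"
    then show "laplace_compact lam v p q" by (rule L.compact_if_B)
  next
    assume "q < 1" "1 < p" "laplace_compact lam v p q"
    then show "Lr_norm (conj_exp_ext p) {0..} (Bq_fun lam q v) < \<infinity>" by (rule L.compact_imp_Bq_norm)
  next
    assume "q < 1" "p = 1" "Bq'_const lam q v < \<infinity>"
    then have "(\<integral>\<^sup>+k. enn_powr (L.bconst k) (p * q / (p - q)) \<partial>count_space UNIV) < top"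
      using L.bconst_summable_if_Bq' by simp
    then show "laplace_compact lam v 1 q"
      unfolding p1[OF \<open>p = 1\<close>] using \<open>q < 1\<close> \<open>p = 1\<close> by (intro L.compact_if_q_less_p) auto
  next
    assume "q < 1" "p = 1" "laplace_compact lam v 1 q"
    then have "laplace_compact lam v (ennreal p) (ennreal q)" by simp
    then obtain B where "B < top" "\<And>t. 0 < t \<Longrightarrow> L.char_fun t \<le> B" using L.compact_imp_char_fun_bounded by blast
    then show "esssup (lebesgue_on {0..}) (\<lambda>t. ennreal (Bq_fun lam q v t)) < \<infinity>"
      using L.esssup_Bq_finite[OF \<open>p = 1\<close>] by simp
  next
    assume "p = 1" "1 \<le> q"
    then show "laplace_compact lam v 1 q \<longleftrightarrow> esssup (lebesgue_on {0..}) (Bbarq_fun lam q v) < \<infinity>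
           \<and> (Bbarq_fun lam q v \<longlongrightarrow> 0) (at_right 0) \<and> (Bbarq_fun lam q v \<longlongrightarrow> 0) at_top"
      unfolding p1[OF \<open>p = 1\<close>] by (intro L.compact_iff_Bbarq) auto
  qed
qed

end
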